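(* Let $(L,[\cdot,\cdot,\cdot])$ be a Lie triple system, $(M,\theta)$ a representation of it, and $\mathcal H:L\times L\times L\to M$ a 3-cocycle of $L$ with coefficients in $(M,\theta)$. Then the graded vector space $C^\ast(M,L)=\bigoplus_{n\ge 0}C^n(M,L)$ (with $C^n(M,L)$ placed in degree $n$), equipped with the operations $l_1=l_2=0$, $$l_3(P,Q,R)=[[[\pi+\theta,P]_{L.t.s},Q]_{L.t.s},R]_{L.t.s},$$ $$l_4(P,Q,R,S)=[[[[\mathcal H,P]_{L.t.s},Q]_{L.t.s},R]_{L.t.s},S]_{L.t.s},$$ and $l_k=0$ for $k\ge 5$, is an $L_\infty$-algebra.
   Context: All vector spaces are over a field $\mathbb K$ of characteristic $0$. A Lie triple system (L.t.s.) is a vector space $L$ with a trilinear bracket satisfying $[x,x,y]=0$, $[x,y,z]+[y,z,x]+[z,x,y]=0$ and $[x,y,[z,t,e]]=[[x,y,z],t,e]+[z,[x,y,t],e]+[z,t,[x,y,e]]$ for all elements. A representation of $L$ on a vector space $M$ is a bilinear map $\theta:L\times L\to \mathrm{End}(M)$ such that, with $D(x,y):=\theta(y,x)-\theta(x,y)$, $\theta(z,t)\theta(x,y)-\theta(y,t)\theta(x,z)-\theta(x,[y,z,t])+D(y,z)\theta(x,t)=0$ and $\theta(z,t)D(x,y)-D(x,y)\theta(z,t)+\theta([x,y,z],t)+\theta(z,[x,y,t])=0$. A 3-cocycle is a trilinear map $\mathcal H:L\times L\times L\to M$ with $\mathcal H(x,x,y)=0$, $\mathcal H(x,y,z)+\mathcal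 H(y,z,x)+\mathcal H(z,x,y)=0$ and $\mathcal H(x_1,x_2,[y_1,y_2,y_3])+D(x_1,x_2)\mathcal H(y_1,y_2,y_3)-\mathcal H([x_1,x_2,y_1],y_2,y_3)-\mathcal H(y_1,[x_1,x_2,y_2],y_3)=\mathcal H(y_1,y_2,[x_1,x_2,y_3])+\theta(y_2,y_3)\mathcal H(x_1,x_2,y_1)-\theta(y_1,y_3)\mathcal H(x_1,x_2,y_2)+D(y_1,y_2)\mathcal H(x_1,x_2,y_3)$. For vector spaces $V,W$, let $C^n(V,W)$ ($n\ge0$) be the space of linear maps $P:(\wedge^2V)^{\otimes n}\otimes V\to W$ such that, for $n\ge1$, $P(\mathfrak X_1,\dots,\mathfrak X_{n-1},x,x,y)=0$ and $P(\mathfrak X_1,\dots,\mathfrak X_{n-1},x,y,z)+P(\mathfrak X_1,\dots,\mathfrak X_{n-1},y,z,x)+P(\mathfrak X_1,\dots,\mathfrak X_{n-1},z,x,y)=0$; elements of $C^n(V,W)$ have degree $n$. On $C^\ast(V,V)$ there is a graded Lie bracket $[P,Q]_{L.t.s}=P\circ Q-(-1)^{pq}Q\circ P$ for $P\in C^p(V,V)$, $Q\in C^q(V,V)$, where, writing $\mathfrak X_i=x_i\wedge y_i$, $$\begin{aligned}(P\circ Q)&(\mathfrak X_1,\dots,\mathfrak X_{p+q},x)\\ =&\sum_{k=1}^p(-1)^{(k-1)q}\sum_{\sigma\in S(k-1,q)}(-1)^\sigma P(\mathfrak X_{\sigma(1)},\dots,\mathfrak X_{\sigma(k-1)},Q(\mathfrak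 X_{\sigma(k)},\dots,\mathfrak X_{\sigma(k+q-1)},x_{k+q})\wedge y_{k+q},\mathfrak X_{k+q+1},\dots,\mathfrak X_{p+q},x)\\ +&\sum_{k=1}^p(-1)^{(k-1)q}\sum_{\sigma\in S(k-1,q)}(-1)^\sigma P(\mathfrak X_{\sigma(1)},\dots,\mathfrak X_{\sigma(k-1)},x_{k+q}\wedge Q(\mathfrak X_{\sigma(k)},\dots,\mathfrak X_{\sigma(k+q-1)},y_{k+q}),\mathfrak X_{k+q+1},\dots,\mathfrak X_{p+q},x)\\ +&\sum_{\sigma\in S(p,q)}(-1)^{pq}(-1)^\sigma P(\mathfrak X_{\sigma(1)},\dots,\mathfrak X_{\sigma(p)},Q(\mathfrak X_{\sigma(p+1)},\dots,\mathfrak X_{\sigma(p+q)},x)).\end{aligned}$$ Here $S(i,j)$ is the set of $(i,j)$-shuffles: permutations $\sigma$ of $\{1,\dots,i+j\}$ with $\sigma(1)<\dots<\sigma(i)$ and $\sigma(i+1)<\dots<\sigma(i+j)$, and $(-1)^\sigma$ is the sign of $\sigma$. Apply this with $V=L\oplus M$. The elements $\pi+\theta,\mathcal H\in C^1(L\oplus M,L\oplus M)$ are $(\pi+\theta)(x+u,y+v,z+w)=[x,y,z]+\theta(y,z)u-\theta(x,z)v+D(x,y)w$ and $\mathcal H(x+u,y+v,z+w)=\mathcal H(x,y,z)$ for $x,y,z\in L$, $u,v,w\in M$. $C^n(M,L)$ is regarded as a subspace of $C^n(L\oplus M,L\oplus M)$ via extension by zero (precompose with the projection to $M$, postcompose with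 the inclusion of $L$). An $L_\infty$-algebra is a $\mathbb Z$-graded vector space $\mathfrak g=\bigoplus_k\mathfrak g^k$ with linear maps $l_k:\otimes^k\mathfrak g\to\mathfrak g$ ($k\ge1$) of degree $1$ such that for homogeneous $x_1,\dots,x_n$: $l_n(x_{\sigma(1)},\dots,x_{\sigma(n)})=\varepsilon(\sigma)l_n(x_1,\dots,x_n)$ for all permutations $\sigma$ ($\varepsilon(\sigma)$ the Koszul sign), and $\sum_{i=1}^n\sum_{\sigma\in S(i,n-i)}\varepsilon(\sigma)\,l_{n-i+1}(l_i(x_{\sigma(1)},\dots,x_{\sigma(i)}),x_{\sigma(i+1)},\dots,x_{\sigma(n)})=0$ for all $n\ge1$. *)

theory Defs
  imports
    "HOL-Analysis.Product_Vector"
    "HOL-Library.Function_Algebras"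
    "HOL-Combinatorics.Permutations"
begin

section \<open>Lie triple systems, representations and 3-cocycles\<close>

locale lie_triple_system = vector_space sL
  for sL :: "'k::field \<Rightarrow> 'l::ab_group_add \<Rightarrow> 'l" +
  fixes br :: "'l \<Rightarrow> 'l \<Rightarrow> 'l \<Rightarrow> 'l"
  assumes br_linear:
      "Vector_Spaces.linear sL sL (\<lambda>x. br x y z)"
      "Vector_Spaces.linear sL sL (\<lambda>y. br x y z)"
      "Vector_Spaces.linear sL sL (\<lambda>z. br x y z)"
    and br_alt: "br x x y = 0"
    and br_cyclic: "br x y z + br y z x + br z x y = 0"
    and br_fundamental:
      "br x y (br z t e) = br (br x y z) t e + br z (br x y t) e + br z t (br x y e)"

definition rep_D :: "('l \<Rightarrow> 'l \<Rightarrow> 'm \<Rightarrow> 'm::ab_group_add) \<Rightarrow> 'l \<Rightarrow> 'l \<Rightarrow> 'm \<Rightarrow> 'm"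
  where "rep_D \<theta> x y u = \<theta> y x u - \<theta> x y u"

locale lts_representation = L: lie_triple_system sL br + M: vector_space sM
  for sL :: "'k::field \<Rightarrow> 'l::ab_group_add \<Rightarrow> 'l"
    and br :: "'l \<Rightarrow> 'l \<Rightarrow> 'l \<Rightarrow> 'l"
    and sM :: "'k \<Rightarrow> 'm::ab_group_add \<Rightarrow> 'm" +
  fixes \<theta> :: "'l \<Rightarrow> 'l \<Rightarrow> 'm \<Rightarrow> 'm"
  assumes rep_linear:
      "Vector_Spaces.linear sL sM (\<lambda>x. \<theta> x y u)"
      "Vector_Spaces.linear sL sM (\<lambda>y. \<theta> x y u)"
      "Vector_Spaces.linear sM sM (\<theta> x y)"
    and rep_1:
      "\<theta> z t (\<theta> x y u) - \<theta> y t (\<theta> x z u) - \<theta> x (br y z t) u + rep_D \<theta> y z (\<theta> x t u) = 0"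
    and rep_2:
      "\<theta> z t (rep_D \<theta> x y u) - rep_D \<theta> x y (\<theta> z t u) + \<theta> (br x y z) t u + \<theta> z (br x y t) u = 0"

locale lts_3cocycle = lts_representation sL br sM \<theta>
  for sL :: "'k::field \<Rightarrow> 'l::ab_group_add \<Rightarrow> 'l"
    and br :: "'l \<Rightarrow> 'l \<Rightarrow> 'l \<Rightarrow> 'l"
    and sM :: "'k \<Rightarrow> 'm::ab_group_add \<Rightarrow> 'm"
    and \<theta> :: "'l \<Rightarrow> 'l \<Rightarrow> 'm \<Rightarrow> 'm" +
  fixes H :: "'l \<Rightarrow> 'l \<Rightarrow> 'l \<Rightarrow> 'm"
  assumes H_linear:
      "Vector_Spaces.linear sL sM (\<lambda>x. H x y z)"
      "Vector_Spaces.linear sL sM (\<lambda>y. H x y z)"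
      "Vector_Spaces.linear sL sM (\<lambda>z. H x y z)"
    and H_alt: "H x x y = 0"
    and H_cyclic: "H x y z + H y z x + H z x y = 0"
    and H_cocycle:
      "H x1 x2 (br y1 y2 y3) + rep_D \<theta> x1 x2 (H y1 y2 y3)
         - H (br x1 x2 y1) y2 y3 - H y1 (br x1 x2 y2) y3
       = H y1 y2 (br x1 x2 y3) + \<theta> y2 y3 (H x1 x2 y1)
         - \<theta> y1 y3 (H x1 x2 y2) + rep_D \<theta> y1 y2 (H x1 x2 y3)"


section \<open>The graded Lie algebra of cochains\<close>

text \<open>
  A linear map \<open>(\<And>\<^sup>2 V)\<^sup>\<otimes>\<^sup>n \<otimes> V \<rightarrow> W\<close> is encoded, through the universal properties of tensor and
  exterior powers, as a function \<open>P Xs z\<close> of a list \<open>Xs = [(x\<^sub>1,y\<^sub>1), \<dots>, (x\<^sub>n,y\<^sub>n)]\<close> of pairs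
  (the pair \<open>(x,y)\<close> stands for \<open>x \<and> y\<close>) and of \<open>z\<close>, linear in \<open>z\<close> and in all \<open>x\<^sub>i\<close>, \<open>y\<^sub>i\<close>, and
  alternating in each pair. It is set to \<open>0\<close> on lists of length other than \<open>n\<close>, so that all
  degrees live in one function space and the sum of the \<open>lts_cochains s1 s2 n\<close> over \<open>n\<close> is direct:
  the degree \<open>n\<close> component of an element of the sum is its restriction to lists of length \<open>n\<close>.
  The condition \<open>P (X\<^sub>1, \<dots>, X\<^sub>n\<^sub>-\<^sub>1, x, x, y) = 0\<close> is the case \<open>i = n - 1\<close> of alternation.
\<close>

type_synonym ('v, 'w) cochain = "('v \<times> 'v) list \<Rightarrow> 'v \<Rightarrow> 'w"

definition lts_cochains ::
    "('k::field \<Rightarrow> 'v::ab_group_add \<Rightarrow> 'v) \<Rightarrow> ('k \<Rightarrow> 'w::ab_group_add \<Rightarrow> 'w) \<Rightarrow> nat \<Rightarrow> ('v, 'w) cochain set"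
  where "lts_cochains s1 s2 n = {P.
     (\<forall>Xs z. length Xs \<noteq> n \<longrightarrow> P Xs z = 0) \<and>
     (\<forall>Xs. length Xs = n \<longrightarrow> Vector_Spaces.linear s1 s2 (P Xs)) \<and>
     (\<forall>Xs i x y z. length Xs = n \<and> i < n \<longrightarrow>
        Vector_Spaces.linear s1 s2 (\<lambda>x. P (Xs[i := (x, y)]) z) \<and>
        Vector_Spaces.linear s1 s2 (\<lambda>y. P (Xs[i := (x, y)]) z) \<and>
        P (Xs[i := (x, x)]) z = 0) \<and>
     (\<forall>Xs x y z. Suc (length Xs) = n \<longrightarrow>
        P (Xs @ [(x, y)]) z + P (Xs @ [(y, z)]) x + P (Xs @ [(z, x)]) y = 0)}"

definition cochain_scale ::
    "('k \<Rightarrow> 'w \<Rightarrow> 'w) \<Rightarrow> 'k \<Rightarrow> ('v, 'w) cochain \<Rightarrow> ('v, 'w) cochain"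
  where "cochain_scale s c P = (\<lambda>Xs z. s c (P Xs z))"

text \<open>Indices are shifted: permutations act on \<open>{0..<i+j}\<close> instead of \<open>{1..i+j}\<close>.\<close>

definition shuffle_perms :: "nat \<Rightarrow> nat \<Rightarrow> (nat \<Rightarrow> nat) set"
  where "shuffle_perms i j =
    {\<sigma>. \<sigma> permutes {..<i+j} \<and> strict_mono_on {..<i} \<sigma> \<and> strict_mono_on {i..<i+j} \<sigma>}"

text \<open>
  \<open>lts_circ s p q P Q Xs z\<close> is the value of \<open>P \<circ> Q\<close>, for \<open>P\<close> of degree \<open>p\<close> and \<open>Q\<close> of degree \<open>q\<close>,
  on a list \<open>Xs\<close> of length \<open>p + q\<close>. The summation index \<open>k\<close> is the usual one minus \<open>1\<close>.
\<close>

definition lts_circ ::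
    "('k::field \<Rightarrow> 'v::ab_group_add \<Rightarrow> 'v) \<Rightarrow> nat \<Rightarrow> nat \<Rightarrow> ('v, 'v) cochain \<Rightarrow> ('v, 'v) cochain \<Rightarrow> ('v, 'v) cochain"
  where "lts_circ s p q P Q Xs z =
    (\<Sum>k<p. \<Sum>\<sigma>\<in>shuffle_perms k q.
       let Ys = permute_list \<sigma> (take (k + q) Xs); (x, y) = Xs ! (k + q) in
       s ((-1) ^ (k * q) * of_int (sign \<sigma>))
         (P (take k Ys @ [(Q (drop k Ys) x, y)] @ drop (k + q + 1) Xs) z)) +
    (\<Sum>k<p. \<Sum>\<sigma>\<in>shuffle_perms k q.
       let Ys = permute_list \<sigma> (take (k + q) Xs); (x, y) = Xs ! (k + q) in
       s ((-1) ^ (k * q) * of_int (sign \<sigma>))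
         (P (take k Ys @ [(x, Q (drop k Ys) y)] @ drop (k + q + 1) Xs) z)) +
    (\<Sum>\<sigma>\<in>shuffle_perms p q.
       let Ys = permute_list \<sigma> Xs in
       s ((-1) ^ (p * q) * of_int (sign \<sigma>)) (P (take p Ys) (Q (drop p Ys) z)))"

definition lts_bracket_deg ::
    "('k::field \<Rightarrow> 'v::ab_group_add \<Rightarrow> 'v) \<Rightarrow> nat \<Rightarrow> nat \<Rightarrow> ('v, 'v) cochain \<Rightarrow> ('v, 'v) cochain \<Rightarrow> ('v, 'v) cochain"
  where "lts_bracket_deg s p q P Q Xs z =
    lts_circ s p q P Q Xs z - s ((-1) ^ (p * q)) (lts_circ s q p Q P Xs z)"

text \<open>
  The bilinear extension to the direct sum of all degrees: \<open>lts_bracket_deg s p q P Q\<close> only uses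
  the values of \<open>P\<close> on lists of length \<open>p\<close> and of \<open>Q\<close> on lists of length \<open>q\<close>, that is, the
  components of degrees \<open>p\<close> and \<open>q\<close>. See \<open>lts_bracket_homogeneous\<close> below.
\<close>

definition lts_bracket ::
    "('k::field \<Rightarrow> 'v::ab_group_add \<Rightarrow> 'v) \<Rightarrow> ('v, 'v) cochain \<Rightarrow> ('v, 'v) cochain \<Rightarrow> ('v, 'v) cochain"
  where "lts_bracket s P Q Xs z =
    (\<Sum>p\<le>length Xs. lts_bracket_deg s p (length Xs - p) P Q Xs z)"

lemma lts_circ_eq_0:
  assumes "vector_space s" "P \<in> lts_cochains s s p" "Q \<in> lts_cochains s s q"
    and "length Xs = p' + q'" "p' \<noteq> p \<or> q' \<noteq> q"
  shows "lts_circ s p' q' P Q Xs z = 0"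
proof -
  interpret vector_space s by fact
  have P0: "P Ys z = 0" if "length Ys \<noteq> p" for Ys z
    using assms(2) that by (auto simp: lts_cochains_def)
  have Q0: "Q Ys z = 0" if "length Ys \<noteq> q" for Ys z
    using assms(3) that by (auto simp: lts_cochains_def)
  have linear_0: "f 0 = 0" if "Vector_Spaces.linear s s f" for f
    using that by (rule module_hom.zero[OF Vector_Spaces.linear.axioms(3)])
  have lin: "P Ys 0 = 0" for Ys
  proof (cases "length Ys = p")
    case True
    then have "Vector_Spaces.linear s s (P Ys)"
      using assms(2) by (auto simp: lts_cochains_def)
    then show ?thesis by (rule linear_0)
  qed (rule P0)
  have lin1: "P (Ys @ [(0, y)] @ Zs) z = 0" "P (Ys @ [(y, 0)] @ Zs) z = 0" for Ys Zs y z
  proof -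
    have "P (Ys @ [(0, y)] @ Zs) z = 0 \<and> P (Ys @ [(y, 0)] @ Zs) z = 0"
    proof (cases "length Ys + Suc (length Zs) = p")
      case True
      define Us where "Us = Ys @ [(y, y)] @ Zs"
      have "length Us = p" "length Ys < p" using True by (auto simp: Us_def)
      then have "Vector_Spaces.linear s s (\<lambda>x. P (Us[length Ys := (x, y)]) z)"
        "Vector_Spaces.linear s s (\<lambda>x. P (Us[length Ys := (y, x)]) z)"
        using assms(2) unfolding lts_cochains_def by blast+
      from this[THEN linear_0] show ?thesis by (simp add: Us_def)
    qed (simp add: P0)
    then show "P (Ys @ [(0, y)] @ Zs) z = 0" "P (Ys @ [(y, 0)] @ Zs) z = 0" by auto
  qed
  show ?thesis
  proof (cases "q' = q")
    case True
    then have "p' \<noteq> p" using assms(5) by simp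
    then show ?thesis using assms(4) True
      by (auto simp: lts_circ_def Let_def P0 split: prod.splits intro!: sum.neutral)
  next
    case False
    then show ?thesis using assms(4)
      by (auto simp: lts_circ_def Let_def Q0 lin lin1[simplified] split: prod.splits intro!: sum.neutral)
  qed
qed

lemma lts_bracket_homogeneous:
  assumes "vector_space s" "P \<in> lts_cochains s s p" "Q \<in> lts_cochains s s q"
  shows "lts_bracket s P Q Xs z =
    (if length Xs = p + q then lts_bracket_deg s p q P Q Xs z else 0)"
proof -
  interpret vector_space s by fact
  have 0: "lts_bracket_deg s p' (length Xs - p') P Q Xs z = 0"
    if "p' \<le> length Xs" "p' \<noteq> p \<or> length Xs - p' \<noteq> q" for p'
    using that lts_circ_eq_0[OF assms, of Xs p' "length Xs - p'" z]
      lts_circ_eq_0[OF assms(1,3,2), of Xs "length Xs - p'" p' z]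
    by (auto simp: lts_bracket_deg_def)
  show ?thesis
  proof (cases "length Xs = p + q")
    case True
    have "lts_bracket s P Q Xs z = (\<Sum>p'\<in>{p}. lts_bracket_deg s p' (length Xs - p') P Q Xs z)"
      unfolding lts_bracket_def
    proof (rule sum.mono_neutral_right)
      show "\<forall>i\<in>{..length Xs} - {p}. lts_bracket_deg s i (length Xs - i) P Q Xs z = 0"
        by (auto intro: 0)
    qed (use True in auto)
    then show ?thesis using True by simp
  next
    case False
    then show ?thesis unfolding lts_bracket_def
      by (auto intro!: sum.neutral 0)
  qed
qed


section \<open>\<open>L\<^sub>\<infinity>\<close>-algebras\<close>

text \<open>
  A \<open>\<int>\<close>-graded vector space is given as a family of subspaces \<open>g k\<close> of an ambient vector space
  whose sum is direct.
\<close>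

locale graded_vector_space = vector_space s
  for s :: "'k::field \<Rightarrow> 'v::ab_group_add \<Rightarrow> 'v" +
  fixes g :: "int \<Rightarrow> 'v set"
  assumes graded_subspace: "subspace (g k)"
    and graded_direct:
      "\<lbrakk>finite F; \<And>k. k \<in> F \<Longrightarrow> v k \<in> g k; (\<Sum>k\<in>F. v k) = 0; k \<in> F\<rbrakk> \<Longrightarrow> v k = 0"
begin

definition total :: "'v set"
  where "total = span (\<Union>k. g k)"

end

text \<open>
  The sign with \<open>x\<^sub>1 \<odot> \<dots> \<odot> x\<^sub>n = \<epsilon>(\<sigma>) x\<^bsub>\<sigma>(1)\<^esub> \<odot> \<dots> \<odot> x\<^bsub>\<sigma>(n)\<^esub>\<close> in the graded
  symmetric algebra, where \<open>ds\<close> lists the degrees of \<open>x\<^sub>1, \<dots>, x\<^sub>n\<close>.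
\<close>

definition koszul_sign :: "(nat \<Rightarrow> nat) \<Rightarrow> int list \<Rightarrow> int"
  where "koszul_sign \<sigma> ds =
    (\<Prod>(i, j)\<in>{(i, j). i < j \<and> j < length ds \<and> \<sigma> j < \<sigma> i}.
       if odd (ds ! \<sigma> i * ds ! \<sigma> j) then -1 else 1)"

text \<open>
  \<open>l k\<close> is the \<open>k\<close>-ary operation; only its values on lists of length \<open>k \<ge> 1\<close> of elements of the
  total space matter. A linear map on the \<open>k\<close>-th tensor power is encoded as a \<open>k\<close>-linear map.
\<close>

locale L_infinity_algebra = graded_vector_space s g
  for s :: "'k::field \<Rightarrow> 'v::ab_group_add \<Rightarrow> 'v"
    and g :: "int \<Rightarrow> 'v set" +
  fixes l :: "nat \<Rightarrow> 'v list \<Rightarrow> 'v"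
  assumes l_closed:
      "\<lbrakk>k \<ge> 1; length xs = k; set xs \<subseteq> total\<rbrakk> \<Longrightarrow> l k xs \<in> total"
    and l_add:
      "\<lbrakk>k \<ge> 1; length xs = k; set xs \<subseteq> total; i < k; x \<in> total; y \<in> total\<rbrakk>
       \<Longrightarrow> l k (xs[i := x + y]) = l k (xs[i := x]) + l k (xs[i := y])"
    and l_scale:
      "\<lbrakk>k \<ge> 1; length xs = k; set xs \<subseteq> total; i < k; x \<in> total\<rbrakk>
       \<Longrightarrow> l k (xs[i := s c x]) = s c (l k (xs[i := x]))"
    and l_degree:
      "\<lbrakk>k \<ge> 1; length xs = k; list_all2 (\<lambda>x d. x \<in> g d) xs ds\<rbrakk> \<Longrightarrow> l k xs \<in> g (sum_list ds + 1)"
    and l_symmetric: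
      "\<lbrakk>n \<ge> 1; length xs = n; list_all2 (\<lambda>x d. x \<in> g d) xs ds; \<sigma> permutes {..<n}\<rbrakk>
       \<Longrightarrow> l n (permute_list \<sigma> xs) = s (of_int (koszul_sign \<sigma> ds)) (l n xs)"
    and l_jacobi:
      "\<lbrakk>n \<ge> 1; length xs = n; list_all2 (\<lambda>x d. x \<in> g d) xs ds\<rbrakk>
       \<Longrightarrow> (\<Sum>i=1..n. \<Sum>\<sigma>\<in>shuffle_perms i (n - i).
              let ys = permute_list \<sigma> xs in
              s (of_int (koszul_sign \<sigma> ds)) (l (n - i + 1) (l i (take i ys) # drop i ys))) = 0"


section \<open>The operations on \<open>C\<^sup>*(M, L)\<close>\<close>

text \<open>A trilinear map as a cochain of degree 1.\<close>

definition cochain1 :: "('v \<Rightarrow> 'v \<Rightarrow> 'v \<Rightarrow> 'w::zero) \<Rightarrow> ('v, 'w) cochain"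
  where "cochain1 f Xs z = (case Xs of [(x, y)] \<Rightarrow> f x y z | _ \<Rightarrow> 0)"

definition semidirect_cochain ::
    "('l \<Rightarrow> 'l \<Rightarrow> 'l \<Rightarrow> 'l::ab_group_add) \<Rightarrow> ('l \<Rightarrow> 'l \<Rightarrow> 'm \<Rightarrow> 'm::ab_group_add) \<Rightarrow> ('l \<times> 'm, 'l \<times> 'm) cochain"
  where "semidirect_cochain br \<theta> = cochain1 (\<lambda>(x, u) (y, v) (z, w).
    (br x y z, \<theta> y z u - \<theta> x z v + rep_D \<theta> x y w))"

definition cocycle_cochain ::
    "('l \<Rightarrow> 'l \<Rightarrow> 'l \<Rightarrow> 'm) \<Rightarrow> ('l::ab_group_add \<times> 'm::ab_group_add, 'l \<times> 'm) cochain"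
  where "cocycle_cochain H = cochain1 (\<lambda>(x, u) (y, v) (z, w). (0, H x y z))"

text \<open>Extension by zero of a map with arguments in \<open>M\<close> and values in \<open>L\<close> to \<open>L \<oplus> M\<close>.\<close>

definition cochain_extend :: "('m, 'l) cochain \<Rightarrow> ('l \<times> 'm, 'l \<times> 'm::zero) cochain"
  where "cochain_extend P Xs z = (P (map (map_prod snd snd) Xs) (snd z), 0)"

text \<open>
  \<open>C\<^sup>*(M, L)\<close> as a graded subspace of \<open>C\<^sup>*(L \<oplus> M, L \<oplus> M)\<close>. That the operations below take values
  in it is part of \<open>L_infinity_algebra\<close>.
\<close>

definition cochains_ML ::
    "('k::field \<Rightarrow> 'l::ab_group_add \<Rightarrow> 'l) \<Rightarrow> ('k \<Rightarrow> 'm::ab_group_add \<Rightarrow> 'm) \<Rightarrow> int \<Rightarrow> ('l \<times> 'm, 'l \<times> 'm) cochain set"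
  where "cochains_ML sL sM k =
    (if k \<ge> 0 then cochain_extend ` lts_cochains sM sL (nat k) else {0})"

definition cochain_ops ::
    "('k::field \<Rightarrow> 'l::ab_group_add \<Rightarrow> 'l) \<Rightarrow> ('k \<Rightarrow> 'm::ab_group_add \<Rightarrow> 'm) \<Rightarrow> ('l \<Rightarrow> 'l \<Rightarrow> 'l \<Rightarrow> 'l) \<Rightarrow>
     ('l \<Rightarrow> 'l \<Rightarrow> 'm \<Rightarrow> 'm) \<Rightarrow> ('l \<Rightarrow> 'l \<Rightarrow> 'l \<Rightarrow> 'm) \<Rightarrow>
     nat \<Rightarrow> ('l \<times> 'm, 'l \<times> 'm) cochain list \<Rightarrow> ('l \<times> 'm, 'l \<times> 'm) cochain"
  where "cochain_ops sL sM br \<theta> H k Ps =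
    (let B = lts_bracket (module_prod.scale sL sM) in
     if k = 3 then B (B (B (semidirect_cochain br \<theta>) (Ps ! 0)) (Ps ! 1)) (Ps ! 2)
     else if k = 4 then B (B (B (B (cocycle_cochain H) (Ps ! 0)) (Ps ! 1)) (Ps ! 2)) (Ps ! 3)
     else 0)"

end

theory Submission
  imports Defs
begin

text \<open>
  The operations are higher derived brackets. On \<open>V = L \<oplus> M\<close> the cochains form a graded Lie
  algebra, in which \<open>C\<^sup>*(M, L)\<close> is abelian, and the degree one elements \<open>\<Delta>\<^sub>3 = \<pi> + \<theta>\<close> and
  \<open>\<Delta>\<^sub>4 = \<H>\<close> satisfy \<open>[\<Delta>\<^sub>i, \<Delta>\<^sub>j] = 0\<close>: this is the fundamental identity of the semidirect product,
  the cocycle condition, and the vanishing of \<open>\<H>\<close> on its own values. Three facts turn this into an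
  \<open>L\<^sub>\<infinity>\<close>-algebra.

  \<^item> Since the \<open>a\<^sub>i\<close> commute, \<open>[\<dots>[\<Delta>, a\<^sub>1], \<dots>, a\<^sub>n]\<close> is graded symmetric. Expanding
    \<open>0 = [\<dots>[[\<Delta>\<^sub>i, \<Delta>\<^sub>j], a\<^sub>1], \<dots>, a\<^sub>n]\<close> with the Jacobi identity gives a signed sum over shuffles of
    brackets of an iterated bracket of \<open>\<Delta>\<^sub>i\<close> with one of \<open>\<Delta>\<^sub>j\<close>. As \<open>i + j = n + 1\<close>, in every surviving
    term one of the two has received its full number of arguments. It then lies in \<open>C\<^sup>*(M, L)\<close> and
    can be moved inside the other one; this gives the terms of the generalised Jacobi identity
    (\<open>nested_bracket\<close>, \<open>nested_bracket_\<Delta>\<close>, \<open>derived_brackets.L_infinity_algebra\<close>).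

  \<^item> The graded Jacobi identity of the cochain bracket holds because \<open>\<circ>\<close> is a graded pre-Lie
    product. The sum over shuffles in \<open>P \<circ> Q\<close> says that the first argument \<open>X\<^sub>1\<close> goes either to \<open>P\<close>
    or to \<open>Q\<close>, or else has \<open>Q\<close> of degree 0 applied to it. Hence filling the first slot is a graded
    derivation of \<open>\<circ>\<close> up to one correction term (\<open>circ\<close>, \<open>lts_circ_eq_circ\<close>). An induction on the
    number of slots shows that the associator is graded symmetric in its last two arguments
    (\<open>associator_graded_symmetric\<close>); the part of the correction terms that does not cancel is
    visibly symmetric.

  \<^item> Membership in \<open>C\<^sup>*(M, L)\<close> is a matter of weights. Give \<open>L\<close> weight 0 and \<open>M\<close> weight 1. A cochain
    of degree \<open>n\<close> has \<open>2 n + 1\<close> arguments, so its weight is at least \<open>- (2 n + 1)\<close> unless it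
    vanishes, and \<open>C\<^sup>n(M, L)\<close> consists of those with this least weight (\<open>cochains_ML_eq\<close>). Weights and
    degrees add up under brackets; \<open>\<pi> + \<theta>\<close> has weight 0 and \<open>\<H>\<close> has weight 1, so that precisely
    three and four brackets, respectively, lead into \<open>C\<^sup>*(M, L)\<close>. The same count shows that it is
    abelian.
\<close>

section \<open>Koszul signs and shuffles\<close>

definition parity_sign :: "int \<Rightarrow> 'a::ring_1"
  where "parity_sign d = (if even d then 1 else - 1)"

lemma parity_sign_add: "parity_sign (a + b) = parity_sign a * parity_sign b"
  by (auto simp: parity_sign_def)

lemma parity_sign_0 [simp]: "parity_sign 0 = 1"
  by (simp add: parity_sign_def)

lemma of_int_parity_sign [simp]: "of_int (parity_sign d) = parity_sign d"
  by (simp add: parity_sign_def)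

lemma minus_one_power_parity_sign: "(- 1) ^ n = parity_sign (int n)"
  by (auto simp: parity_sign_def)

text \<open>
  The Koszul sign is a product over inversions, so it is computed below by following how the set of
  inversions changes when a permutation is modified.
\<close>

definition inversions :: "nat \<Rightarrow> (nat \<Rightarrow> nat) \<Rightarrow> (nat \<times> nat) set"
  where "inversions n \<sigma> = {(i, j). i < j \<and> j < n \<and> \<sigma> j < \<sigma> i}"

lemma finite_inversions [simp]: "finite (inversions n \<sigma>)"
  by (rule finite_subset[of _ "{..<n} \<times> {..<n}"]) (auto simp: inversions_def)

lemma koszul_sign_alt:
  "koszul_sign \<sigma> ds = (\<Prod>(i, j)\<in>inversions (length ds) \<sigma>. parity_sign (ds ! \<sigma> i * ds ! \<sigma> j))"
  unfolding koszul_sign_def inversions_def parity_sign_def by (auto intro!: prod.cong)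

text \<open>
  Composing with an adjacent transposition at an ascent creates exactly one new inversion, at that
  ascent; the other ones are carried along by the transposition.
\<close>

lemma inversions_transpose:
  assumes "Suc k < n" "\<sigma> k < \<sigma> (Suc k)"
  defines "t \<equiv> transpose k (Suc k)"
  shows "inversions n (\<sigma> \<circ> t) = insert (k, Suc k) (map_prod t t ` inversions n \<sigma>)"
    and "(k, Suc k) \<notin> map_prod t t ` inversions n \<sigma>"
proof -
  have tt: "t (t i) = i" for i by (simp add: t_def)
  have lt: "t i < t j" if "i < j" "(i, j) \<noteq> (k, Suc k)" for i j
    using that by (auto simp: t_def transpose_def)
  have tn: "t i < n" if "i < n" for i using that assms(1) by (auto simp: t_def transpose_def)
  have tk: "t k = Suc k" "t (Suc k) = k" by (auto simp: t_def)
  show "(k, Suc k) \<notin> map_prod t t ` inversions n \<sigma>"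
  proof
    assume "(k, Suc k) \<in> map_prod t t ` inversions n \<sigma>"
    then obtain i j where "(i, j) \<in> inversions n \<sigma>" "k = t i" "Suc k = t j" by auto
    then show False using tk tt[of i] tt[of j] by (auto simp: inversions_def)
  qed
  show "inversions n (\<sigma> \<circ> t) = insert (k, Suc k) (map_prod t t ` inversions n \<sigma>)"
  proof (intro equalityI subsetI)
    fix z assume z: "z \<in> inversions n (\<sigma> \<circ> t)"
    obtain i j where [simp]: "z = (i, j)" by (cases z)
    show "z \<in> insert (k, Suc k) (map_prod t t ` inversions n \<sigma>)"
    proof (cases "z = (k, Suc k)")
      case False
      then have "(t i, t j) \<in> inversions n \<sigma>"
        using z lt[of i j] tn by (auto simp: inversions_def)
      then have "(t (t i), t (t j)) \<in> map_prod t t ` inversions n \<sigma>" by auto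
      then show ?thesis by (simp add: tt)
    qed simp
  next
    fix z assume z: "z \<in> insert (k, Suc k) (map_prod t t ` inversions n \<sigma>)"
    then consider "z = (k, Suc k)" | i j where "(i, j) \<in> inversions n \<sigma>" "z = (t i, t j)" by auto
    then show "z \<in> inversions n (\<sigma> \<circ> t)"
    proof cases
      case 1
      then show ?thesis using assms(1,2) tk by (auto simp: inversions_def)
    next
      case 2
      then have "(i, j) \<noteq> (k, Suc k)" using assms(2) by (auto simp: inversions_def)
      then show ?thesis using 2 lt[of i j] tn by (auto simp: inversions_def tt)
    qed
  qed
qed

lemma koszul_sign_transpose:
  assumes "Suc k < length ds" "\<sigma> k < \<sigma> (Suc k)"
  shows "koszul_sign (\<sigma> \<circ> transpose k (Suc k)) ds
    = parity_sign (ds ! \<sigma> k * ds ! \<sigma> (Suc k)) * koszul_sign \<sigma> ds"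
proof -
  let ?t = "transpose k (Suc k)"
  have inj: "inj_on (map_prod ?t ?t) A" for A
    by (rule inj_on_subset[OF prod.inj_map]) auto
  show ?thesis
    unfolding koszul_sign_alt inversions_transpose(1)[where \<sigma>=\<sigma>, OF assms]
    by (subst prod.insert)
      (use inversions_transpose(2)[where \<sigma>=\<sigma>, OF assms] inj
        in \<open>auto simp: prod.reindex case_prod_beta mult.commute\<close>)
qed

lemma permute_list_transpose:
  assumes "Suc k < length ws"
  shows "permute_list (transpose k (Suc k)) ws = take k ws @ ws ! Suc k # ws ! k # drop (Suc (Suc k)) ws"
proof (rule nth_equalityI)
  fix i assume "i < length (permute_list (transpose k (Suc k)) ws)"
  then have i: "i < length ws" by simp
  then show "permute_list (transpose k (Suc k)) ws ! i
    = (take k ws @ ws ! Suc k # ws ! k # drop (Suc (Suc k)) ws) ! i"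
    using assms
    by (cases i k rule: linorder_cases; cases "i = Suc k")
      (auto simp: permute_list_def nth_append min_def transpose_def nth_Cons' Suc_diff_le Suc_diff_Suc
        numeral_2_eq_2)
qed (use assms in auto)

lemma ex_descent:
  assumes "\<sigma> permutes {..<n}" "\<sigma> \<noteq> id"
  shows "\<exists>k. Suc k < n \<and> \<sigma> (Suc k) < \<sigma> k"
proof (rule ccontr)
  assume neg: "\<not> ?thesis"
  have le: "\<sigma> k \<le> \<sigma> (Suc k)" if "Suc k < n" for k
    by (rule leI) (use neg that in blast)
  have lt: "\<sigma> k < \<sigma> (Suc k)" if "Suc k < n" for k
    using le[OF that] inj_eq[OF permutes_inj[OF assms(1)], of k "Suc k"] by simp
  have ge: "k \<le> \<sigma> k" if "k < n" for k
    using that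
  proof (induction k)
    case (Suc k)
    then show ?case using lt[of k] by auto
  qed simp
  have "\<sigma> k = k" for k
  proof (cases "k < n")
    case True
    have "k < n \<longrightarrow> \<sigma> k = k"
    proof (induction "n - k" arbitrary: k rule: less_induct)
      case less
      show ?case
      proof
        assume k: "k < n"
        show "\<sigma> k = k"
        proof (rule ccontr)
          assume ne: "\<sigma> k \<noteq> k"
          with ge[OF k] have gt: "k < \<sigma> k" by simp
          have "\<sigma> k < n" using permutes_in_image[OF assms(1), of k] k by simp
          then have "\<sigma> (\<sigma> k) = \<sigma> k" using less[of "\<sigma> k"] gt k by auto
          then show False using ne inj_eq[OF permutes_inj[OF assms(1)]] by simp
        qed
      qed
    qed
    then show ?thesis using True by simp
  next
    case False
    then show ?thesis using permutes_not_in[OF assms(1)] by simp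
  qed
  then show False using assms(2) by auto
qed

text \<open>
  A permutation other than the identity has a descent, and undoing it lowers the number of
  inversions. Identities for the Koszul sign are thereby reduced to adjacent transpositions.
\<close>

lemma permutes_descent_induct [consumes 1, case_names id descent]:
  assumes "\<sigma> permutes {..<n}"
    and "P id"
    and "\<And>\<tau> k. \<lbrakk>\<tau> permutes {..<n}; P \<tau>; Suc k < n; \<tau> k < \<tau> (Suc k)\<rbrakk> \<Longrightarrow> P (\<tau> \<circ> transpose k (Suc k))"
  shows "P \<sigma>"
  using assms(1)
proof (induction "card (inversions n \<sigma>)" arbitrary: \<sigma> rule: less_induct)
  case less
  show ?case
  proof (cases "\<sigma> = id")
    case False
    from ex_descent[OF less.prems this] obtain k where k: "Suc k < n" "\<sigma> (Suc k) < \<sigma> k" by blast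
    let ?t = "transpose k (Suc k)"
    let ?\<tau> = "\<sigma> \<circ> ?t"
    have \<tau>: "?\<tau> permutes {..<n}"
      using k by (intro permutes_compose[OF _ less.prems] permutes_swap_id) auto
    have lt: "?\<tau> k < ?\<tau> (Suc k)" using k by simp
    have \<sigma>: "?\<tau> \<circ> ?t = \<sigma>" by (simp add: comp_assoc)
    have "inj_on (map_prod ?t ?t) A" for A
      by (rule inj_on_subset[OF prod.inj_map]) auto
    then have "card (inversions n \<sigma>) = Suc (card (inversions n ?\<tau>))"
      using inversions_transpose[where \<sigma>="?\<tau>", OF k(1) lt] by (simp only: \<sigma>) (simp add: card_image)
    then show ?thesis using assms(3)[OF \<tau> less.hyps[OF _ \<tau>] k(1) lt] by (simp only: \<sigma>)
  qed (simp add: assms(2))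
qed

text \<open>
  This identifies the signs of the shuffle formula for \<open>\<circ>\<close> with Koszul signs of elements of degree 1,
  so that one recursion for shuffles serves for both kinds of sign.
\<close>

lemma sign_eq_koszul_sign:
  assumes "\<sigma> permutes {..<n}"
  shows "sign \<sigma> = koszul_sign \<sigma> (replicate n 1)"
  using assms
proof (induction rule: permutes_descent_induct)
  case id
  have "z \<notin> inversions n (\<lambda>a. a)" for z
    by (cases z) (simp add: inversions_def)
  then have "inversions n (\<lambda>a. a) = {}" by blast
  then show ?case by (simp add: koszul_sign_alt)
next
  case (descent \<tau> k)
  let ?t = "transpose k (Suc k)"
  have lt: "\<tau> k < n" "\<tau> (Suc k) < n"
    using \<open>Suc k < n\<close> permutes_in_image[OF \<open>\<tau> permutes {..<n}\<close>, of k]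
      permutes_in_image[OF \<open>\<tau> permutes {..<n}\<close>, of "Suc k"]
    by simp_all
  have "sign (\<tau> \<circ> ?t) = sign \<tau> * sign ?t"
    by (intro sign_compose permutation_swap_id permutes_imp_permutation[OF _ \<open>\<tau> permutes {..<n}\<close>]) simp
  also have "sign ?t = - 1" by (simp add: sign_swap_id)
  also have "sign \<tau> * - 1 = parity_sign (replicate n 1 ! \<tau> k * replicate n 1 ! \<tau> (Suc k)) * sign \<tau>"
    using lt by (simp add: parity_sign_def)
  also have "\<dots> = koszul_sign (\<tau> \<circ> ?t) (replicate n 1)"
    using descent by (simp add: koszul_sign_transpose)
  finally show ?case .
qed

text \<open>
  If \<open>\<sigma>\<close> is written as the word \<open>\<sigma> 0, \<sigma> 1, \<dots>\<close>, all letters are raised by one and the letter \<open>0\<close> is put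
  at position \<open>i\<close>. On lists, this permutes the tail by \<open>\<sigma>\<close> and then moves the head to position \<open>i\<close>.
\<close>

definition insert_zero_at :: "nat \<Rightarrow> (nat \<Rightarrow> nat) \<Rightarrow> nat \<Rightarrow> nat"
  where "insert_zero_at i \<sigma> k = (if k < i then Suc (\<sigma> k) else if k = i then 0 else Suc (\<sigma> (k - 1)))"

definition skip :: "nat \<Rightarrow> nat \<Rightarrow> nat"
  where "skip i k = (if k < i then k else Suc k)"

lemma insert_zero_at_skip [simp]: "insert_zero_at i \<sigma> (skip i k) = Suc (\<sigma> k)"
  by (auto simp: insert_zero_at_def skip_def)

lemma insert_zero_at_eq [simp]: "insert_zero_at i \<sigma> i = 0"
  by (auto simp: insert_zero_at_def)

lemma skip_less_skip_iff [simp]: "skip i j < skip i k \<longleftrightarrow> j < k"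
  by (auto simp: skip_def)

lemma skip_eq_skip_iff [simp]: "skip i j = skip i k \<longleftrightarrow> j = k"
  by (auto simp: skip_def)

lemma skip_cases:
  obtains "k = i" | k' where "k = skip i k'"
  by (cases k i rule: linorder_cases) (auto simp: skip_def intro: that(2)[of k] that(2)[of "k - 1"])

lemma skip_less_Suc_iff: "i \<le> n \<Longrightarrow> skip i k < Suc n \<longleftrightarrow> k < n"
  by (auto simp: skip_def)

lemma insert_zero_at_permutes:
  assumes "\<sigma> permutes {..<n}" "i \<le> n"
  shows "insert_zero_at i \<sigma> permutes {..<Suc n}"
proof (rule bij_imp_permutes)
  note im = permutes_in_image[OF assms(1), simplified]
  show "bij_betw (insert_zero_at i \<sigma>) {..<Suc n} {..<Suc n}"
    unfolding bij_betw_def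
  proof
    have "inj (insert_zero_at i \<sigma>)"
    proof (rule injI)
      fix k l assume "insert_zero_at i \<sigma> k = insert_zero_at i \<sigma> l"
      then show "k = l"
        by (cases k i rule: skip_cases; cases l i rule: skip_cases)
          (simp_all add: inj_eq[OF permutes_inj[OF assms(1)]])
    qed
    then show inj: "inj_on (insert_zero_at i \<sigma>) {..<Suc n}" by (rule inj_on_subset) simp
    have "insert_zero_at i \<sigma> ` {..<Suc n} \<subseteq> {..<Suc n}"
    proof safe
      fix k assume "k < Suc n"
      then show "insert_zero_at i \<sigma> k < Suc n"
        by (cases k i rule: skip_cases) (auto simp: skip_less_Suc_iff[OF assms(2)] im)
    qed
    then show "insert_zero_at i \<sigma> ` {..<Suc n} = {..<Suc n}"
      using inj by (intro card_subset_eq) (auto simp: card_image)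
  qed
  fix k assume "k \<notin> {..<Suc n}"
  then show "insert_zero_at i \<sigma> k = k"
    using assms(2) permutes_not_in[OF assms(1), of "k - 1"] by (auto simp: insert_zero_at_def)
qed

lemma permute_list_insert_zero_at:
  assumes "i \<le> length xs"
  shows "permute_list (insert_zero_at i \<sigma>) (x # xs)
    = take i (permute_list \<sigma> xs) @ x # drop i (permute_list \<sigma> xs)"
proof (rule nth_equalityI)
  fix k assume "k < length (permute_list (insert_zero_at i \<sigma>) (x # xs))"
  then have k: "k \<le> length xs" by simp
  then have "permute_list (insert_zero_at i \<sigma>) (x # xs) ! k = (x # xs) ! insert_zero_at i \<sigma> k"
    by (simp add: permute_list_def del: upt_Suc)
  also have "\<dots> = (take i (permute_list \<sigma> xs) @ x # drop i (permute_list \<sigma> xs)) ! k"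
    using k assms
    by (cases k i rule: linorder_cases)
      (auto simp: insert_zero_at_def nth_append permute_list_def min_def nth_Cons' Suc_diff_le)
  finally show "permute_list (insert_zero_at i \<sigma>) (x # xs) ! k
    = (take i (permute_list \<sigma> xs) @ x # drop i (permute_list \<sigma> xs)) ! k" .
qed (use assms in auto)

text \<open>
  The new inversions are those between the letter \<open>0\<close> and the \<open>i\<close> letters before it.
\<close>

lemma koszul_sign_insert_zero_at:
  assumes "i \<le> length ds"
  shows "koszul_sign (insert_zero_at i \<sigma>) (d # ds)
    = parity_sign (d * sum_list (take i (permute_list \<sigma> ds))) * koszul_sign \<sigma> ds"
proof -
  let ?\<sigma> = "insert_zero_at i \<sigma>" and ?n = "length ds"
  let ?A = "(\<lambda>k. (k, i)) ` {..<i}" and ?B = "map_prod (skip i) (skip i) ` inversions ?n \<sigma>"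
  let ?f = "\<lambda>(j, k). parity_sign ((d # ds) ! ?\<sigma> j * (d # ds) ! ?\<sigma> k) :: int"
  have inv: "inversions (Suc ?n) ?\<sigma> = ?A \<union> ?B"
  proof (intro equalityI subsetI)
    fix z assume "z \<in> inversions (Suc ?n) ?\<sigma>"
    moreover obtain j k where "z = (j, k)" by (cases z)
    ultimately show "z \<in> ?A \<union> ?B"
      by (cases j i rule: skip_cases; cases k i rule: skip_cases)
        (auto simp: inversions_def skip_less_Suc_iff[OF assms])
  next
    fix z assume "z \<in> ?A \<union> ?B"
    then show "z \<in> inversions (Suc ?n) ?\<sigma>"
      using assms by (auto simp: inversions_def skip_less_Suc_iff[OF assms]) (simp add: insert_zero_at_def)
  qed
  have disj: "?A \<inter> ?B = {}"
    using insert_zero_at_skip[of i \<sigma>] by (auto simp: skip_def split: if_splits)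
  have injB: "inj_on (map_prod (skip i) (skip i)) X" for X by (auto simp: inj_on_def)
  have "(\<Prod>z\<in>?A. ?f z) = (\<Prod>k<i. parity_sign (ds ! \<sigma> k * d))"
    by (subst prod.reindex) (auto simp: inj_on_def insert_zero_at_def intro!: prod.cong)
  also have "\<dots> = parity_sign (d * (\<Sum>k<i. ds ! \<sigma> k))"
    by (induction i) (simp_all add: parity_sign_add distrib_left mult.commute)
  also have "(\<Sum>k<i. ds ! \<sigma> k) = sum_list (take i (permute_list \<sigma> ds))"
    using assms by (simp add: sum_list_sum_nth permute_list_def atLeast0LessThan min_def)
  finally have A: "(\<Prod>z\<in>?A. ?f z) = parity_sign (d * sum_list (take i (permute_list \<sigma> ds)))" .
  have "(\<Prod>z\<in>?B. ?f z) = koszul_sign \<sigma> ds"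
    unfolding koszul_sign_alt by (subst prod.reindex[OF injB]) (auto intro!: prod.cong)
  then show ?thesis
    unfolding koszul_sign_alt[of ?\<sigma>] length_Cons inv
    by (subst prod.union_disjoint) (auto simp: disj A)
qed

lemma shuffle_perms_mono:
  assumes "\<sigma> \<in> shuffle_perms i j"
  shows "a < b \<Longrightarrow> b < i \<Longrightarrow> \<sigma> a < \<sigma> b" "i \<le> a \<Longrightarrow> a < b \<Longrightarrow> b < i + j \<Longrightarrow> \<sigma> a < \<sigma> b"
  using assms by (auto simp: shuffle_perms_def strict_mono_on_def)

lemma shuffle_perms_zero_position:
  assumes "\<sigma> \<in> shuffle_perms i j" "i + j > 0"
  shows "i > 0 \<and> \<sigma> 0 = 0 \<or> j > 0 \<and> \<sigma> i = 0"
proof -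
  have p: "\<sigma> permutes {..<i + j}" using assms by (auto simp: shuffle_perms_def)
  then have "0 \<in> \<sigma> ` {..<i + j}" using assms(2) by (simp add: permutes_image)
  then obtain a where a: "a < i + j" "\<sigma> a = 0" by auto
  show ?thesis
  proof (cases "a < i")
    case True
    then show ?thesis using shuffle_perms_mono(1)[OF assms(1), of 0 a] a by (cases "a = 0") auto
  next
    case False
    then show ?thesis using shuffle_perms_mono(2)[OF assms(1), of i a] a by (cases "a = i") auto
  qed
qed

lemma insert_zero_at_surj:
  assumes "\<sigma> permutes {..<Suc n}" "i \<le> n" "\<sigma> i = 0"
  obtains \<tau> where "\<sigma> = insert_zero_at i \<tau>" "\<tau> permutes {..<n}"
proof
  define \<tau> where "\<tau> k = \<sigma> (skip i k) - 1" for k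
  have pos: "\<sigma> (skip i k) > 0" for k
  proof -
    have "skip i k \<noteq> i" by (simp add: skip_def)
    then have "\<sigma> (skip i k) \<noteq> \<sigma> i" using inj_eq[OF permutes_inj[OF assms(1)]] by simp
    then show ?thesis using assms(3) by simp
  qed
  show \<sigma>: "\<sigma> = insert_zero_at i \<tau>"
  proof
    fix k show "\<sigma> k = insert_zero_at i \<tau> k"
      by (cases k i rule: skip_cases) (use assms(3) pos in \<open>auto simp: \<tau>_def\<close>)
  qed
  show "\<tau> permutes {..<n}"
  proof (rule bij_imp_permutes)
    have inj: "inj \<tau>"
    proof (rule injI)
      fix k l assume "\<tau> k = \<tau> l"
      then have "\<sigma> (skip i k) = \<sigma> (skip i l)" unfolding \<sigma> by simp
      then have "skip i k = skip i l" by (rule injD[OF permutes_inj[OF assms(1)]])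
      then show "k = l" by simp
    qed
    have "\<tau> ` {..<n} \<subseteq> {..<n}"
    proof safe
      fix k assume "k < n"
      then have "\<sigma> (skip i k) < Suc n"
        using permutes_in_image[OF assms(1), of "skip i k"] by (simp add: skip_less_Suc_iff[OF assms(2)])
      then show "\<tau> k < n" unfolding \<sigma> by simp
    qed
    then show "bij_betw \<tau> {..<n} {..<n}"
      unfolding bij_betw_def using inj_on_subset[OF inj]
      by (simp add: card_subset_eq card_image)
    fix k assume "k \<notin> {..<n}"
    then have "skip i k = Suc k" using assms(2) by (simp add: skip_def)
    then show "\<tau> k = k" using permutes_not_in[OF assms(1), of "Suc k"] \<open>k \<notin> {..<n}\<close> by (simp add: \<tau>_def)
  qed
qed

lemma insert_zero_at_eq_iff: "insert_zero_at i \<sigma> = insert_zero_at i \<tau> \<longleftrightarrow> \<sigma> = \<tau>"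
proof
  assume eq: "insert_zero_at i \<sigma> = insert_zero_at i \<tau>"
  have "\<sigma> k = \<tau> k" for k using fun_cong[OF eq, of "skip i k"] by simp
  then show "\<sigma> = \<tau>" ..
qed simp

lemma insert_zero_at_0_shuffle_perms_iff:
  assumes "\<sigma> permutes {..<i + j}"
  shows "insert_zero_at 0 \<sigma> \<in> shuffle_perms (Suc i) j \<longleftrightarrow> \<sigma> \<in> shuffle_perms i j"
proof -
  have eq: "insert_zero_at 0 \<sigma> k = (case k of 0 \<Rightarrow> 0 | Suc k \<Rightarrow> Suc (\<sigma> k))" for k
    by (simp add: insert_zero_at_def split: nat.split)
  have "strict_mono_on {..<Suc i} (insert_zero_at 0 \<sigma>) \<longleftrightarrow> strict_mono_on {..<i} \<sigma>"
    unfolding strict_mono_on_def eq by (auto split: nat.split)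
  moreover have "strict_mono_on {Suc i..<Suc i + j} (insert_zero_at 0 \<sigma>) \<longleftrightarrow> strict_mono_on {i..<i + j} \<sigma>"
    unfolding strict_mono_on_def eq by (auto split: nat.split)
  ultimately show ?thesis
    using assms insert_zero_at_permutes[OF assms, of 0] by (auto simp: shuffle_perms_def)
qed

lemma insert_zero_at_shuffle_perms_iff:
  assumes "\<sigma> permutes {..<i + j}"
  shows "insert_zero_at i \<sigma> \<in> shuffle_perms i (Suc j) \<longleftrightarrow> \<sigma> \<in> shuffle_perms i j"
proof -
  have "strict_mono_on {..<i} (insert_zero_at i \<sigma>) \<longleftrightarrow> strict_mono_on {..<i} \<sigma>"
    by (auto simp: strict_mono_on_def insert_zero_at_def)
  moreover have "strict_mono_on {i..<i + Suc j} (insert_zero_at i \<sigma>) \<longleftrightarrow> strict_mono_on {i..<i + j} \<sigma>"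
  proof
    assume L: "strict_mono_on {i..<i + Suc j} (insert_zero_at i \<sigma>)"
    show "strict_mono_on {i..<i + j} \<sigma>"
    proof (rule strict_mono_onI)
      fix a b assume "a \<in> {i..<i + j}" "b \<in> {i..<i + j}" "a < b"
      then show "\<sigma> a < \<sigma> b" using strict_mono_onD[OF L, of "Suc a" "Suc b"] by (simp add: insert_zero_at_def)
    qed
  next
    assume R: "strict_mono_on {i..<i + j} \<sigma>"
    show "strict_mono_on {i..<i + Suc j} (insert_zero_at i \<sigma>)"
    proof (rule strict_mono_onI)
      fix a b assume "a \<in> {i..<i + Suc j}" "b \<in> {i..<i + Suc j}" "a < b"
      then show "insert_zero_at i \<sigma> a < insert_zero_at i \<sigma> b"
        using strict_mono_onD[OF R, of "a - 1" "b - 1"] by (auto simp: insert_zero_at_def)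
    qed
  qed
  ultimately show ?thesis
    using assms insert_zero_at_permutes[OF assms, of i] by (auto simp: shuffle_perms_def)
qed

lemma shuffle_perms_permutes: "\<sigma> \<in> shuffle_perms i j \<Longrightarrow> \<sigma> permutes {..<i + j}"
  by (simp add: shuffle_perms_def)

lemma finite_shuffle_perms [simp]: "finite (shuffle_perms i j)"
  by (rule finite_subset[OF _ finite_permutations[of "{..<i + j}"]]) (auto simp: shuffle_perms_def)

text \<open>
  In an \<open>(i, j)\<close>-shuffle the letter \<open>0\<close> stands at the beginning of one of the two increasing blocks,
  that is, at position \<open>0\<close> or \<open>i\<close>.
\<close>

lemma shuffle_perms_split:
  assumes "i + j = Suc n"
  shows "shuffle_perms i j =
    (if i = 0 then {} else insert_zero_at 0 ` shuffle_perms (i - 1) j) \<union>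
    (if j = 0 then {} else insert_zero_at i ` shuffle_perms i (j - 1))" (is "_ = ?A \<union> ?B")
    and "(if i = 0 then {} else insert_zero_at 0 ` shuffle_perms (i - 1) j) \<inter>
    (if j = 0 then {} else insert_zero_at i ` shuffle_perms i (j - 1)) = {}"
proof -
  have "insert_zero_at 0 \<sigma> \<noteq> insert_zero_at i \<tau>" if "i > 0" for \<sigma> \<tau>
    using insert_zero_at_eq[of 0 \<sigma>] that by (auto simp: insert_zero_at_def fun_eq_iff)
  then show "?A \<inter> ?B = {}" by auto
  show "shuffle_perms i j = ?A \<union> ?B"
  proof (intro equalityI subsetI)
    fix \<sigma> assume \<sigma>: "\<sigma> \<in> shuffle_perms i j"
    then have p: "\<sigma> permutes {..<Suc n}" using assms by (simp add: shuffle_perms_def)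
    from shuffle_perms_zero_position[OF \<sigma>] assms
    consider "i > 0" "\<sigma> 0 = 0" | "j > 0" "\<sigma> i = 0" by auto
    then show "\<sigma> \<in> ?A \<union> ?B"
    proof cases
      case 1
      obtain \<tau> where \<tau>: "\<sigma> = insert_zero_at 0 \<tau>" "\<tau> permutes {..<n}"
        by (rule insert_zero_at_surj[OF p _ 1(2)]) auto
      then have "\<tau> \<in> shuffle_perms (i - 1) j"
        using 1(1) \<sigma> insert_zero_at_0_shuffle_perms_iff[of \<tau> "i - 1" j] assms by simp
      then show ?thesis using 1(1) \<tau>(1) by simp
    next
      case 2
      obtain \<tau> where \<tau>: "\<sigma> = insert_zero_at i \<tau>" "\<tau> permutes {..<n}"
        using 2(1) assms by (auto intro: insert_zero_at_surj[OF p _ 2(2)])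
      then have "\<tau> \<in> shuffle_perms i (j - 1)"
        using 2(1) \<sigma> insert_zero_at_shuffle_perms_iff[of \<tau> i "j - 1"] assms by simp
      then show ?thesis using 2(1) \<tau>(1) by simp
    qed
  next
    fix \<sigma> assume "\<sigma> \<in> ?A \<union> ?B"
    then consider \<tau> where "i > 0" "\<sigma> = insert_zero_at 0 \<tau>" "\<tau> \<in> shuffle_perms (i - 1) j"
      | \<tau> where "j > 0" "\<sigma> = insert_zero_at i \<tau>" "\<tau> \<in> shuffle_perms i (j - 1)"
      by (auto split: if_splits)
    then show "\<sigma> \<in> shuffle_perms i j"
    proof cases
      case 1
      then show ?thesis
        using insert_zero_at_0_shuffle_perms_iff[of \<tau> "i - 1" j] shuffle_perms_permutes[OF 1(3)] by simp
    next
      case 2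
      then show ?thesis
        using insert_zero_at_shuffle_perms_iff[of \<tau> i "j - 1"] shuffle_perms_permutes[OF 2(3)] by simp
    qed
  qed
qed

lemma sum_shuffle_perms:
  assumes "i + j = Suc n"
  shows "(\<Sum>\<sigma>\<in>shuffle_perms i j. f \<sigma>) =
    (if i = 0 then 0 else \<Sum>\<sigma>\<in>shuffle_perms (i - 1) j. f (insert_zero_at 0 \<sigma>)) +
    (if j = 0 then 0 else \<Sum>\<sigma>\<in>shuffle_perms i (j - 1). f (insert_zero_at i \<sigma>))"
proof -
  have inj: "inj_on (insert_zero_at k) A" for k A by (auto simp: inj_on_def insert_zero_at_eq_iff)
  show ?thesis
    unfolding shuffle_perms_split(1)[OF assms]
    by (subst sum.union_disjoint[OF _ _ shuffle_perms_split(2)[OF assms]])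
      (simp_all add: sum.reindex[OF inj])
qed

lemma shuffle_perms_0_0: "shuffle_perms 0 0 = {id}"
  by (simp add: shuffle_perms_def)

text \<open>
  The second components of the list entries are degrees. They are kept with the elements because the
  recursion below produces signs that depend on the degrees of a sublist.
\<close>

definition shuffle_sum ::
    "('k::comm_ring_1 \<Rightarrow> 'b \<Rightarrow> 'b::ab_group_add) \<Rightarrow> nat \<Rightarrow> nat \<Rightarrow> ('x \<times> int) list \<Rightarrow> (('x \<times> int) list \<Rightarrow> ('x \<times> int) list \<Rightarrow> 'b) \<Rightarrow> 'b"
  where "shuffle_sum s i j zs F = (\<Sum>\<sigma>\<in>shuffle_perms i j.
    s (of_int (koszul_sign \<sigma> (map snd zs)))
      (F (take i (permute_list \<sigma> zs)) (drop i (permute_list \<sigma> zs))))"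

definition degree_sum :: "('x \<times> int) list \<Rightarrow> int"
  where "degree_sum zs = sum_list (map snd zs)"

lemma degree_sum_simps [simp]: "degree_sum [] = 0" "degree_sum (z # zs) = snd z + degree_sum zs"
  by (simp_all add: degree_sum_def)

context module
begin

lemma shuffle_sum_Nil: "shuffle_sum scale 0 0 [] F = F [] []"
  by (simp add: shuffle_sum_def shuffle_perms_0_0 koszul_sign_def)

text \<open>
  The head of the list goes to the front of one of the two parts. In the second case it passes all of
  the first part, which gives the sign.
\<close>

lemma shuffle_sum_Cons:
  fixes zs :: "('x \<times> int) list" and F :: "('x \<times> int) list \<Rightarrow> ('x \<times> int) list \<Rightarrow> 'b"
  assumes "i + j = Suc (length zs)"
  shows "shuffle_sum scale i j (z # zs) F =
    (if i = 0 then 0 else shuffle_sum scale (i - 1) j zs (\<lambda>A B. F (z # A) B)) +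
    (if j = 0 then 0 else shuffle_sum scale i (j - 1) zs
       (\<lambda>A B. scale (parity_sign (snd z * degree_sum A)) (F A (z # B))))"
proof -
  have 1: "(\<Sum>\<sigma>\<in>shuffle_perms (i - 1) j.
      scale (of_int (koszul_sign (insert_zero_at 0 \<sigma>) (map snd (z # zs))))
        (F (take i (permute_list (insert_zero_at 0 \<sigma>) (z # zs)))
           (drop i (permute_list (insert_zero_at 0 \<sigma>) (z # zs)))))
    = shuffle_sum scale (i - 1) j zs (\<lambda>A B. F (z # A) B)" if "i \<noteq> 0"
    unfolding shuffle_sum_def
    using that by (auto intro!: sum.cong simp: permute_list_insert_zero_at koszul_sign_insert_zero_at
      take_Cons' drop_Cons')
  have 2: "(\<Sum>\<sigma>\<in>shuffle_perms i (j - 1).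
      scale (of_int (koszul_sign (insert_zero_at i \<sigma>) (map snd (z # zs))))
        (F (take i (permute_list (insert_zero_at i \<sigma>) (z # zs)))
           (drop i (permute_list (insert_zero_at i \<sigma>) (z # zs)))))
    = shuffle_sum scale i (j - 1) zs (\<lambda>A B. scale (parity_sign (snd z * degree_sum A)) (F A (z # B)))" if "j \<noteq> 0"
    unfolding shuffle_sum_def
  proof (rule sum.cong[OF refl])
    fix \<sigma> assume "\<sigma> \<in> shuffle_perms i (j - 1)"
    then have "\<sigma> permutes {..<length zs}" using shuffle_perms_permutes[of \<sigma> i "j - 1"] assms that by simp
    then have "permute_list \<sigma> (map snd zs) = map snd (permute_list \<sigma> zs)"
      by (rule permute_list_map)
    moreover have "i \<le> length zs" using assms that by simp
    ultimately show "scale (of_int (koszul_sign (insert_zero_at i \<sigma>) (map snd (z # zs))))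
        (F (take i (permute_list (insert_zero_at i \<sigma>) (z # zs)))
           (drop i (permute_list (insert_zero_at i \<sigma>) (z # zs))))
      = scale (of_int (koszul_sign \<sigma> (map snd zs)))
         (scale (parity_sign (snd z * degree_sum (take i (permute_list \<sigma> zs))))
           (F (take i (permute_list \<sigma> zs)) (z # drop i (permute_list \<sigma> zs))))"
      by (simp add: permute_list_insert_zero_at koszul_sign_insert_zero_at degree_sum_def take_map
          mult.commute)
  qed
  show ?thesis
    unfolding shuffle_sum_def[of _ i j] sum_shuffle_perms[OF assms]
    by (rule arg_cong2[where f = "(+)"]; rule if_cong[OF refl refl]) (fact 1 2)+
qed

lemma shuffle_sum_cong:
  assumes "i + j = length zs"
    and "\<And>A B. \<lbrakk>length A = i; length B = j; set A \<subseteq> set zs; set B \<subseteq> set zs\<rbrakk> \<Longrightarrow> F A B = F' A B"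
  shows "shuffle_sum scale i j zs F = shuffle_sum scale i j zs F'"
  unfolding shuffle_sum_def
proof (rule sum.cong[OF refl])
  fix \<sigma> assume "\<sigma> \<in> shuffle_perms i j"
  then have "\<sigma> permutes {..<length zs}" using shuffle_perms_permutes[of \<sigma> i j] assms(1) by simp
  then have "set (permute_list \<sigma> zs) = set zs" by (rule set_permute_list)
  then have "F (take i (permute_list \<sigma> zs)) (drop i (permute_list \<sigma> zs))
    = F' (take i (permute_list \<sigma> zs)) (drop i (permute_list \<sigma> zs))"
    using assms(1) set_take_subset[of i "permute_list \<sigma> zs"] set_drop_subset[of i "permute_list \<sigma> zs"]
    by (intro assms(2)) auto
  then show "scale (of_int (koszul_sign \<sigma> (map snd zs)))
      (F (take i (permute_list \<sigma> zs)) (drop i (permute_list \<sigma> zs))) =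
    scale (of_int (koszul_sign \<sigma> (map snd zs)))
      (F' (take i (permute_list \<sigma> zs)) (drop i (permute_list \<sigma> zs)))" by simp
qed

lemma shuffle_sum_scale:
  "shuffle_sum scale i j zs (\<lambda>A B. scale c (F A B)) = scale c (shuffle_sum scale i j zs F)"
  by (simp add: shuffle_sum_def scale_sum_right mult.commute)

text \<open>
  Exchanging the two parts of a shuffle costs the Koszul sign of moving one part past the other.
\<close>

lemma shuffle_sum_swap:
  assumes "i + j = length zs"
  shows "shuffle_sum scale i j zs (\<lambda>A B. scale (parity_sign (degree_sum A * degree_sum B)) (F B A))
    = shuffle_sum scale j i zs F"
  using assms
proof (induction zs arbitrary: i j F)
  case Nil
  then show ?case by (simp add: shuffle_sum_Nil)
next
  case (Cons z zs)
  have 1: "shuffle_sum scale (i - 1) j zs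
      (\<lambda>A B. scale (parity_sign (degree_sum (z # A) * degree_sum B)) (F B (z # A)))
    = shuffle_sum scale j (i - 1) zs (\<lambda>A B. scale (parity_sign (snd z * degree_sum A)) (F A (z # B)))"
    if "i \<noteq> 0"
  proof -
    have "i - 1 + j = length zs" using that Cons.prems by simp
    have sign: "parity_sign (degree_sum A * degree_sum B) * parity_sign (snd z * degree_sum B)
      = (parity_sign (degree_sum (z # A) * degree_sum B) :: 'a)" for A B
      unfolding degree_sum_simps by (auto simp: parity_sign_def)
    from Cons.IH[OF \<open>i - 1 + j = length zs\<close>,
        of "\<lambda>A B. scale (parity_sign (snd z * degree_sum A)) (F A (z # B))"]
    show ?thesis by (simp only: scale_scale sign)
  qed
  have 2: "shuffle_sum scale i (j - 1) zs (\<lambda>A B. scale (parity_sign (snd z * degree_sum A))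
      (scale (parity_sign (degree_sum A * degree_sum (z # B))) (F (z # B) A)))
    = shuffle_sum scale (j - 1) i zs (\<lambda>A B. F (z # A) B)"
    if "j \<noteq> 0"
  proof -
    have "i + (j - 1) = length zs" using that Cons.prems by simp
    have sign: "parity_sign (snd z * degree_sum A) * parity_sign (degree_sum A * degree_sum (z # B))
      = (parity_sign (degree_sum A * degree_sum B) :: 'a)" for A B
      unfolding degree_sum_simps by (auto simp: parity_sign_def)
    from Cons.IH[OF \<open>i + (j - 1) = length zs\<close>, of "\<lambda>A B. F (z # A) B"]
    show ?thesis by (simp only: scale_scale sign)
  qed
  have n: "i + j = Suc (length zs)" "j + i = Suc (length zs)" using Cons.prems by simp_all
  show ?case
    unfolding shuffle_sum_Cons[OF n(1)] shuffle_sum_Cons[OF n(2)]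
    using 1 2 by (auto simp: add.commute)
qed

end

section \<open>Derived brackets\<close>

text \<open>
  The bracket is only required to be bilinear on a subspace \<open>T\<close> of the ambient space, and Jacobi is
  stated as a derivation rule for \<open>\<lambda>x. B x z\<close>, the form in which it is iterated.
\<close>

locale graded_lie_algebra = vector_space s
  for s :: "'k::field \<Rightarrow> 'v::ab_group_add \<Rightarrow> 'v" +
  fixes T :: "'v set" and G :: "int \<Rightarrow> 'v set" and B :: "'v \<Rightarrow> 'v \<Rightarrow> 'v"
  assumes subspace_T: "subspace T"
    and subspace_G: "subspace (G d)"
    and G_subset_T: "G d \<subseteq> T"
    and B_closed: "\<lbrakk>x \<in> T; y \<in> T\<rbrakk> \<Longrightarrow> B x y \<in> T"
    and B_add_left: "\<lbrakk>x \<in> T; x' \<in> T; y \<in> T\<rbrakk> \<Longrightarrow> B (x + x') y = B x y + B x' y"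
    and B_add_right: "\<lbrakk>x \<in> T; y \<in> T; y' \<in> T\<rbrakk> \<Longrightarrow> B x (y + y') = B x y + B x y'"
    and B_scale_left: "\<lbrakk>x \<in> T; y \<in> T\<rbrakk> \<Longrightarrow> B (s c x) y = s c (B x y)"
    and B_scale_right: "\<lbrakk>x \<in> T; y \<in> T\<rbrakk> \<Longrightarrow> B x (s c y) = s c (B x y)"
    and B_degree: "\<lbrakk>x \<in> G p; y \<in> G q\<rbrakk> \<Longrightarrow> B x y \<in> G (p + q)"
    and B_antisym: "\<lbrakk>x \<in> G p; y \<in> G q\<rbrakk> \<Longrightarrow> B x y = - s (parity_sign (p * q)) (B y x)"
    and B_jacobi: "\<lbrakk>x \<in> G p; y \<in> G q; z \<in> G r\<rbrakk> \<Longrightarrow>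
      B (B x y) z = B x (B y z) + s (parity_sign (q * r)) (B (B x z) y)"
begin

lemma G_T: "x \<in> G d \<Longrightarrow> x \<in> T"
  using G_subset_T by blast

lemma B_0_left: "y \<in> T \<Longrightarrow> B 0 y = 0"
  using B_scale_left[of 0 y 0] subspace_0[OF subspace_T] by simp

lemma B_0_right: "y \<in> T \<Longrightarrow> B y 0 = 0"
  using B_scale_right[of y 0 0] subspace_0[OF subspace_T] by simp

lemma nested_closed: "\<lbrakk>x \<in> T; set xs \<subseteq> T\<rbrakk> \<Longrightarrow> foldl B x xs \<in> T"
  by (induction xs arbitrary: x) (auto simp: B_closed)

lemma nested_add:
  "\<lbrakk>x \<in> T; y \<in> T; set xs \<subseteq> T\<rbrakk> \<Longrightarrow> foldl B (x + y) xs = foldl B x xs + foldl B y xs"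
  by (induction xs arbitrary: x y) (auto simp: B_add_left B_closed)

lemma nested_scale: "\<lbrakk>x \<in> T; set xs \<subseteq> T\<rbrakk> \<Longrightarrow> foldl B (s c x) xs = s c (foldl B x xs)"
  by (induction xs arbitrary: x) (auto simp: B_scale_left B_closed)

lemma nested_0: "set xs \<subseteq> T \<Longrightarrow> foldl B 0 xs = 0"
  by (induction xs) (auto simp: B_0_left)

lemma nested_sum:
  assumes "finite I" "\<And>i. i \<in> I \<Longrightarrow> f i \<in> T" "set xs \<subseteq> T"
  shows "foldl B (\<Sum>i\<in>I. f i) xs = (\<Sum>i\<in>I. foldl B (f i) xs)"
  using assms by (induction I) (auto simp: nested_0 nested_add subspace_sum[OF subspace_T])

lemma nested_update:
  assumes "i < length xs"
  shows "foldl B D (xs[i := x]) = foldl B (B (foldl B D (take i xs)) x) (drop (Suc i) xs)"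
  using assms by (simp add: upd_conv_take_nth_drop)

lemma nested_update_T:
  assumes "D \<in> T" "set xs \<subseteq> T"
  shows "foldl B D (take i xs) \<in> T" "set (drop j xs) \<subseteq> T"
  using assms set_take_subset[of i xs] set_drop_subset[of j xs] by (auto intro!: nested_closed)

lemma nested_update_add:
  assumes "D \<in> T" "set xs \<subseteq> T" "i < length xs" "x \<in> T" "y \<in> T"
  shows "foldl B D (xs[i := x + y]) = foldl B D (xs[i := x]) + foldl B D (xs[i := y])"
  using assms nested_update_T[OF assms(1,2)]
  by (simp add: nested_update B_add_right nested_add B_closed)

lemma nested_update_scale:
  assumes "D \<in> T" "set xs \<subseteq> T" "i < length xs" "x \<in> T"
  shows "foldl B D (xs[i := s c x]) = s c (foldl B D (xs[i := x]))"
  using assms nested_update_T[OF assms(1,2)]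
  by (simp add: nested_update B_scale_right nested_scale B_closed)

definition graded :: "('v \<times> int) list \<Rightarrow> bool"
  where "graded zs \<longleftrightarrow> (\<forall>(x, d)\<in>set zs. x \<in> G d)"

lemma graded_Cons [simp]: "graded (z # zs) \<longleftrightarrow> fst z \<in> G (snd z) \<and> graded zs"
  by (auto simp: graded_def)

lemma graded_Nil [simp]: "graded []"
  by (simp add: graded_def)

lemma graded_T: "graded zs \<Longrightarrow> set (map fst zs) \<subseteq> T"
  using G_T unfolding graded_def by fastforce

lemma nested_degree:
  "\<lbrakk>D \<in> G e; graded zs\<rbrakk> \<Longrightarrow> foldl B D (map fst zs) \<in> G (e + degree_sum zs)"
proof (induction zs arbitrary: D e)
  case (Cons z zs)
  then have "foldl B (B D (fst z)) (map fst zs) \<in> G (e + snd z + degree_sum zs)"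
    by (intro Cons.IH B_degree) auto
  then show ?case by (simp add: add.assoc)
qed simp

text \<open>
  The iterated Leibniz rule: every \<open>\<lambda>x. B x a\<close> is a graded derivation, and in the expansion each
  argument goes either to \<open>D\<close> or to \<open>E\<close>. The remaining sign comes from moving the arguments of \<open>D\<close>
  past \<open>E\<close>.
\<close>

lemma nested_bracket:
  assumes "D \<in> G e" "E \<in> G e'" "graded zs"
  shows "foldl B (B D E) (map fst zs) = (\<Sum>i\<le>length zs. shuffle_sum s i (length zs - i) zs
    (\<lambda>X Y. s (parity_sign (e' * degree_sum X)) (B (foldl B D (map fst X)) (foldl B E (map fst Y)))))"
  using assms
proof (induction zs arbitrary: D E e e')
  case Nil
  then show ?case by (simp add: shuffle_sum_Nil)
next
  case (Cons z zs)
  obtain a d where z: "z = (a, d)" by (cases z)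
  let ?n = "length zs"
  let ?F = "\<lambda>D E e' X Y. s (parity_sign (e' * degree_sum X)) (B (foldl B D (map fst X)) (foldl B E (map fst Y)))"
  have a: "a \<in> G d" and zs: "graded zs" using Cons.prems z by auto
  have T: "D \<in> T" "E \<in> T" "a \<in> T" "set (map fst zs) \<subseteq> T"
    using Cons.prems a zs G_T graded_T by auto
  have "foldl B (B D E) (map fst (z # zs))
    = foldl B (B D (B E a) + s (parity_sign (e' * d)) (B (B D a) E)) (map fst zs)"
    using B_jacobi[OF Cons.prems(1,2) a] by (simp add: z)
  also have "\<dots> = foldl B (B D (B E a)) (map fst zs)
      + s (parity_sign (e' * d)) (foldl B (B (B D a) E) (map fst zs))"
    using T by (simp add: nested_add nested_scale B_closed subspace_scale[OF subspace_T])
  also have "foldl B (B D (B E a)) (map fst zs)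
      = (\<Sum>i\<le>?n. shuffle_sum s i (?n - i) zs (?F D (B E a) (e' + d)))"
    by (rule Cons.IH[OF Cons.prems(1) B_degree[OF Cons.prems(2) a] zs])
  also have "foldl B (B (B D a) E) (map fst zs)
      = (\<Sum>i\<le>?n. shuffle_sum s i (?n - i) zs (?F (B D a) E e'))"
    by (rule Cons.IH[OF B_degree[OF Cons.prems(1) a] Cons.prems(2) zs])
  also have "s (parity_sign (e' * d)) \<dots>
      = (\<Sum>i\<le>?n. shuffle_sum s i (?n - i) zs (\<lambda>X Y. ?F D E e' (z # X) Y))"
    by (simp add: z scale_sum_right distrib_left parity_sign_add
        flip: shuffle_sum_scale)
  also have "\<dots> = (\<Sum>i\<le>Suc ?n. if i = 0 then 0 else
      shuffle_sum s (i - 1) (Suc ?n - i) zs (\<lambda>X Y. ?F D E e' (z # X) Y))"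
    by (simp add: sum.atMost_Suc_shift del: sum.atMost_Suc)
  also have "(\<Sum>i\<le>?n. shuffle_sum s i (?n - i) zs (?F D (B E a) (e' + d)))
      = (\<Sum>i\<le>Suc ?n. if Suc ?n - i = 0 then 0 else shuffle_sum s i (Suc ?n - i - 1) zs
          (\<lambda>X Y. s (parity_sign (snd z * degree_sum X)) (?F D E e' X (z # Y))))"
  proof -
    have sign: "parity_sign (d * degree_sum X) * parity_sign (e' * degree_sum X)
      = (parity_sign ((e' + d) * degree_sum X) :: 'k)" for X :: "('v \<times> int) list"
      by (auto simp: parity_sign_def)
    show ?thesis by (simp add: z sign)
  qed
  finally have "foldl B (B D E) (map fst (z # zs)) = (\<Sum>i\<le>Suc ?n.
      (if i = 0 then 0 else
        shuffle_sum s (i - 1) (Suc ?n - i) zs (\<lambda>X Y. ?F D E e' (z # X) Y)) +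
      (if Suc ?n - i = 0 then 0 else shuffle_sum s i (Suc ?n - i - 1) zs
          (\<lambda>X Y. s (parity_sign (snd z * degree_sum X)) (?F D E e' X (z # Y)))))"
    by (simp only: sum.distrib add.commute)
  also have "\<dots> = (\<Sum>i\<le>Suc ?n. shuffle_sum s i (Suc ?n - i) (z # zs) (?F D E e'))"
    by (intro sum.cong refl shuffle_sum_Cons[symmetric]) auto
  finally show ?case by simp
qed

end

text \<open>
  The Maurer-Cartan equation for \<open>\<Sum>k. \<Delta> k\<close> is split here according to the number of arguments: an
  operation of arity \<open>i\<close> composed with one of arity \<open>n + 1 - i\<close> has arity \<open>n\<close>.
\<close>

locale derived_brackets = graded_lie_algebra s T G B
  for s :: "'k::field_char_0 \<Rightarrow> 'v::ab_group_add \<Rightarrow> 'v" and T G B +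
  fixes F :: "int \<Rightarrow> 'v set" and \<Delta> :: "nat \<Rightarrow> 'v"
  assumes subspace_F: "subspace (F d)"
    and F_subset_G: "F d \<subseteq> G d"
    and F_direct: "\<lbrakk>finite I; \<And>d. d \<in> I \<Longrightarrow> v d \<in> F d; (\<Sum>d\<in>I. v d) = 0; d \<in> I\<rbrakk> \<Longrightarrow> v d = 0"
    and F_abelian: "\<lbrakk>x \<in> F p; y \<in> F q\<rbrakk> \<Longrightarrow> B x y = 0"
    and \<Delta>_degree: "\<Delta> k \<in> G 1"
    and \<Delta>_closed: "\<lbrakk>k \<ge> 1; length zs = k; \<forall>(x, d)\<in>set zs. x \<in> F d\<rbrakk> \<Longrightarrow>
      foldl B (\<Delta> k) (map fst zs) \<in> F (1 + degree_sum zs)"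
    and \<Delta>_maurer_cartan: "n \<ge> 1 \<Longrightarrow> (\<Sum>i=1..n. B (\<Delta> (n + 1 - i)) (\<Delta> i)) = 0"
begin

definition F_graded :: "('v \<times> int) list \<Rightarrow> bool"
  where "F_graded zs \<longleftrightarrow> (\<forall>(x, d)\<in>set zs. x \<in> F d)"

lemma F_graded_simps [simp]:
  "F_graded []"
  "F_graded (z # zs) \<longleftrightarrow> fst z \<in> F (snd z) \<and> F_graded zs"
  "F_graded (xs @ ys) \<longleftrightarrow> F_graded xs \<and> F_graded ys"
  by (auto simp: F_graded_def)

lemma F_graded_subset: "F_graded zs \<Longrightarrow> set ws \<subseteq> set zs \<Longrightarrow> F_graded ws"
  by (auto simp: F_graded_def)

lemma F_G: "x \<in> F d \<Longrightarrow> x \<in> G d"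
  using F_subset_G by blast

lemma F_T: "x \<in> F d \<Longrightarrow> x \<in> T"
  using F_G G_T by blast

lemma F_graded_graded: "F_graded zs \<Longrightarrow> graded zs"
  using F_G by (auto simp: F_graded_def graded_def)

lemma F_graded_T: "F_graded zs \<Longrightarrow> set (map fst zs) \<subseteq> T"
  using F_graded_graded graded_T by blast

lemma F_graded_permute_list:
  assumes "\<sigma> permutes {..<length zs}" "F_graded zs"
  shows "F_graded (permute_list \<sigma> zs)"
  using assms by (auto simp: F_graded_def set_permute_list)

text \<open>
  By the Jacobi identity, the two sides differ by \<open>B D (B x y)\<close>, and \<open>F\<close> is abelian.
\<close>

lemma bracket_swap:
  assumes "D \<in> G e" "x \<in> F p" "y \<in> F q"
  shows "B (B D x) y = s (parity_sign (p * q)) (B (B D y) x)"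
  using B_jacobi[OF assms(1) F_G[OF assms(2)] F_G[OF assms(3)]] F_abelian[OF assms(2,3)]
    B_0_right[OF G_T[OF assms(1)]] by simp

lemma nested_swap:
  assumes "D \<in> G e" "F_graded ws" "Suc k < length ws"
  shows "foldl B D (map fst (permute_list (transpose k (Suc k)) ws))
    = s (parity_sign (snd (ws ! k) * snd (ws ! Suc k))) (foldl B D (map fst ws))"
proof -
  let ?x = "ws ! k" and ?y = "ws ! Suc k" and ?us = "take k ws" and ?vs = "drop (Suc (Suc k)) ws"
  have "drop k ws = ?x # ?y # ?vs"
    using assms(3) Cons_nth_drop_Suc[of k ws] Cons_nth_drop_Suc[of "Suc k" ws] by simp
  then have ws: "ws = ?us @ ?x # ?y # ?vs" using append_take_drop_id[of k ws] by simp
  have gr: "F_graded ?us" "F_graded ?vs" "fst ?x \<in> F (snd ?x)" "fst ?y \<in> F (snd ?y)"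
    using assms(2) by (subst (asm) ws, simp)+
  let ?D = "foldl B D (map fst ?us)"
  have D: "?D \<in> G (e + degree_sum ?us)"
    by (rule nested_degree[OF assms(1) F_graded_graded[OF gr(1)]])
  have "foldl B D (map fst (permute_list (transpose k (Suc k)) ws))
    = foldl B (B (B ?D (fst ?y)) (fst ?x)) (map fst ?vs)"
    unfolding permute_list_transpose[OF assms(3)] by simp
  also have "\<dots> = s (parity_sign (snd ?y * snd ?x)) (foldl B (B (B ?D (fst ?x)) (fst ?y)) (map fst ?vs))"
    using gr F_T G_T[OF D] F_graded_T
    by (simp add: bracket_swap[OF D gr(4,3)] nested_scale B_closed)
  also have "foldl B (B (B ?D (fst ?x)) (fst ?y)) (map fst ?vs) = foldl B D (map fst (?us @ ?x # ?y # ?vs))"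
    by simp
  finally show ?thesis unfolding ws[symmetric] by (simp add: mult.commute)
qed

lemma nested_permute:
  assumes "\<sigma> permutes {..<length zs}" "D \<in> G e" "F_graded zs"
  shows "foldl B D (map fst (permute_list \<sigma> zs))
    = s (of_int (koszul_sign \<sigma> (map snd zs))) (foldl B D (map fst zs))"
  using assms(1)
proof (induction rule: permutes_descent_induct)
  case id
  have "koszul_sign (\<lambda>a. a) (map snd zs) = 1"
    unfolding koszul_sign_alt by (rule prod.neutral) (auto simp: inversions_def)
  then show ?case by simp
next
  case (descent \<tau> k)
  note p = \<open>\<tau> permutes {..<length zs}\<close> and k = \<open>Suc k < length zs\<close>
  let ?t = "transpose k (Suc k)"
  have t: "?t permutes {..<length zs}" using k by (intro permutes_swap_id) auto
  have lt: "\<tau> k < length zs" "\<tau> (Suc k) < length zs"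
    using k permutes_in_image[OF p, of k] permutes_in_image[OF p, of "Suc k"] by simp_all
  have "foldl B D (map fst (permute_list (\<tau> \<circ> ?t) zs))
    = s (parity_sign (snd (permute_list \<tau> zs ! k) * snd (permute_list \<tau> zs ! Suc k)))
        (foldl B D (map fst (permute_list \<tau> zs)))"
    unfolding permute_list_compose[OF t]
    using k by (intro nested_swap[OF assms(2) F_graded_permute_list[OF p assms(3)]]) simp
  also have "\<dots> = s (of_int (koszul_sign (\<tau> \<circ> ?t) (map snd zs))) (foldl B D (map fst zs))"
    using descent k lt by (simp add: koszul_sign_transpose permute_list_nth[OF p])
  finally show ?case .
qed

lemma nested_move_front:
  assumes "D \<in> G e" "x \<in> F p" "F_graded zs"
  shows "B (foldl B D (map fst zs)) x = s (parity_sign (p * degree_sum zs)) (foldl B D (x # map fst zs))"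
  using assms
proof (induction zs arbitrary: D e)
  case (Cons z zs)
  then have z: "fst z \<in> F (snd z)" and zs: "F_graded zs" by auto
  have T: "D \<in> T" "fst z \<in> T" "x \<in> T" "set (map fst zs) \<subseteq> T"
    using Cons.prems(1,2) z zs F_T G_T F_graded_T by auto
  have "B (foldl B (B D (fst z)) (map fst zs)) x
      = s (parity_sign (p * degree_sum zs)) (foldl B (B D (fst z)) (x # map fst zs))"
    by (rule Cons.IH[OF B_degree[OF Cons.prems(1) F_G[OF z]] Cons.prems(2) zs])
  also have "foldl B (B D (fst z)) (x # map fst zs)
      = s (parity_sign (snd z * p)) (foldl B (B (B D x) (fst z)) (map fst zs))"
    using T by (simp add: bracket_swap[OF Cons.prems(1) z Cons.prems(2)] nested_scale B_closed)
  finally show ?case by (simp add: distrib_left parity_sign_add mult.commute)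
qed simp

text \<open>
  After \<open>k\<close> brackets \<open>\<Delta> k\<close> has become an element of the abelian \<open>F\<close>.
\<close>

lemma nested_eq_0:
  assumes "k \<ge> 1" "length zs > k" "F_graded zs"
  shows "foldl B (\<Delta> k) (map fst zs) = 0"
proof -
  obtain z us where z: "drop k zs = z # us"
    using assms(2) by (cases "drop k zs") auto
  have zs: "zs = take k zs @ z # us" using append_take_drop_id[of k zs] unfolding z by simp
  have gr: "F_graded (take k zs)" "fst z \<in> F (snd z)" "F_graded us"
    using assms(3) by (subst (asm) zs, simp)+
  have "foldl B (\<Delta> k) (map fst (take k zs)) \<in> F (1 + degree_sum (take k zs))"
    using assms gr(1) by (intro \<Delta>_closed) (auto simp: F_graded_def)
  then have "B (foldl B (\<Delta> k) (map fst (take k zs))) (fst z) = 0"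
    using gr(2) F_abelian by blast
  moreover have "foldl B (\<Delta> k) (map fst (take k zs @ z # us))
    = foldl B (B (foldl B (\<Delta> k) (map fst (take k zs))) (fst z)) (map fst us)" by simp
  ultimately show ?thesis
    using nested_0[OF F_graded_T[OF gr(3)]] by (subst zs) simp
qed

text \<open>
  The part of the generalised Jacobi identity in which the inner operation has arity \<open>m\<close> and the outer
  one arity \<open>k\<close>.
\<close>

definition jacobi_sum :: "nat \<Rightarrow> nat \<Rightarrow> ('v \<times> int) list \<Rightarrow> 'v"
  where "jacobi_sum k m zs = shuffle_sum s m (k - 1) zs
    (\<lambda>X Y. foldl B (\<Delta> k) (foldl B (\<Delta> m) (map fst X) # map fst Y))"

text \<open>
  Each bracket in the shuffle expansion vanishes as soon as one factor has received too many
  arguments. Counting leaves the shuffles in which \<open>\<Delta> m\<close> receives \<open>m\<close> or \<open>m - 1\<close> arguments. In the first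
  case its iterated bracket lies in \<open>F\<close>, in the second case that of \<open>\<Delta> k\<close> does. This factor is moved to
  the front of the arguments of the other one, and all signs cancel because both \<open>\<Delta> m\<close> and \<open>\<Delta> k\<close> are odd.
\<close>

lemma nested_bracket_\<Delta>:
  assumes "m \<ge> 1" "k \<ge> 1" "length zs + 1 = m + k" "F_graded zs"
  shows "foldl B (B (\<Delta> m) (\<Delta> k)) (map fst zs) = jacobi_sum k m zs + jacobi_sum m k zs"
proof -
  let ?n = "length zs"
  let ?F = "\<lambda>X Y. s (parity_sign (1 * degree_sum X))
    (B (foldl B (\<Delta> m) (map fst X)) (foldl B (\<Delta> k) (map fst Y)))"
  let ?S = "\<lambda>i. shuffle_sum s i (?n - i) zs ?F"
  have sub: "F_graded X" if "set X \<subseteq> set zs" for X using F_graded_subset[OF assms(4) that] .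
  have "foldl B (B (\<Delta> m) (\<Delta> k)) (map fst zs) = (\<Sum>i\<le>?n. ?S i)"
    by (rule nested_bracket[OF \<Delta>_degree \<Delta>_degree F_graded_graded[OF assms(4)]])
  also have "\<dots> = (\<Sum>i\<in>{m - 1, m}. ?S i)"
  proof (rule sum.mono_neutral_right)
    show "{m - 1, m} \<subseteq> {..?n}" using assms(1-3) by auto
    show "\<forall>i\<in>{..?n} - {m - 1, m}. ?S i = 0"
    proof
      fix i assume i: "i \<in> {..?n} - {m - 1, m}"
      have "?S i = shuffle_sum s i (?n - i) zs (\<lambda>X Y. 0)"
      proof (rule shuffle_sum_cong)
        fix X Y :: "('v \<times> int) list"
        assume XY: "length X = i" "length Y = ?n - i" "set X \<subseteq> set zs" "set Y \<subseteq> set zs"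
        have T: "foldl B (\<Delta> j) (map fst X) \<in> T" "foldl B (\<Delta> j) (map fst Y) \<in> T" for j
          by (intro nested_closed G_T[OF \<Delta>_degree] F_graded_T sub XY)+
        from i consider "i > m" | "?n - i > k" using assms(1-3) by force
        then have "B (foldl B (\<Delta> m) (map fst X)) (foldl B (\<Delta> k) (map fst Y)) = 0"
        proof cases
          case 1
          then have "foldl B (\<Delta> m) (map fst X) = 0"
            using XY sub assms(1) by (intro nested_eq_0) auto
          then show ?thesis using T by (simp add: B_0_left)
        next
          case 2
          then have "foldl B (\<Delta> k) (map fst Y) = 0"
            using XY sub assms(2) by (intro nested_eq_0) auto
          then show ?thesis using T by (simp add: B_0_right)
        qed
        then show "?F X Y = 0" by simp
      qed (use i in auto)
      also have "\<dots> = 0" by (simp add: shuffle_sum_def)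
      finally show "?S i = 0" .
    qed
  qed simp
  also have "\<dots> = ?S m + ?S (m - 1)" using assms(1) by auto
  also have "?S m = jacobi_sum k m zs"
  proof -
    have "length zs - m = k - 1" using assms(2,3) by simp
    then have "?S m = shuffle_sum s m (k - 1) zs ?F" by (simp only:)
    also have "\<dots> = jacobi_sum k m zs"
      unfolding jacobi_sum_def
    proof (rule shuffle_sum_cong)
      fix X Y :: "('v \<times> int) list"
      assume XY: "length X = m" "length Y = k - 1" "set X \<subseteq> set zs" "set Y \<subseteq> set zs"
      let ?f = "foldl B (\<Delta> m) (map fst X)" and ?d = "1 + degree_sum X"
      have f: "?f \<in> F ?d"
        using XY sub assms(1) by (intro \<Delta>_closed) (auto simp: F_graded_def)
      have "B ?f (foldl B (\<Delta> k) (map fst Y))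
        = - s (parity_sign (?d * (1 + degree_sum Y))) (B (foldl B (\<Delta> k) (map fst Y)) ?f)"
        by (rule B_antisym[OF F_G[OF f] nested_degree[OF \<Delta>_degree F_graded_graded]]) (use XY sub in auto)
      also have "B (foldl B (\<Delta> k) (map fst Y)) ?f
        = s (parity_sign (?d * degree_sum Y)) (foldl B (\<Delta> k) (?f # map fst Y))"
        by (rule nested_move_front[OF \<Delta>_degree f]) (use XY sub in auto)
      finally show "?F X Y = foldl B (\<Delta> k) (?f # map fst Y)"
        by (cases "even (degree_sum X)"; cases "even (degree_sum Y)") (simp_all add: parity_sign_def)
    qed (use assms in auto)
    finally show ?thesis .
  qed
  also have "?S (m - 1) = jacobi_sum m k zs"
  proof -
    have "length zs - (m - 1) = k" using assms(1,3) by simp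
    then have "?S (m - 1) = shuffle_sum s (m - 1) k zs ?F" by (simp only:)
    also have "\<dots> = shuffle_sum s (m - 1) k zs (\<lambda>X Y. s (parity_sign (degree_sum X * degree_sum Y))
      (foldl B (\<Delta> m) (foldl B (\<Delta> k) (map fst Y) # map fst X)))"
    proof (rule shuffle_sum_cong)
      fix X Y :: "('v \<times> int) list"
      assume XY: "length X = m - 1" "length Y = k" "set X \<subseteq> set zs" "set Y \<subseteq> set zs"
      let ?g = "foldl B (\<Delta> k) (map fst Y)" and ?d = "1 + degree_sum Y"
      have g: "?g \<in> F ?d"
        using XY sub assms(2) by (intro \<Delta>_closed) (auto simp: F_graded_def)
      have "B (foldl B (\<Delta> m) (map fst X)) ?g
        = s (parity_sign (?d * degree_sum X)) (foldl B (\<Delta> m) (?g # map fst X))"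
        by (rule nested_move_front[OF \<Delta>_degree g]) (use XY sub in auto)
      then show "?F X Y = s (parity_sign (degree_sum X * degree_sum Y)) (foldl B (\<Delta> m) (?g # map fst X))"
        by (cases "even (degree_sum X)"; cases "even (degree_sum Y)") (simp_all add: parity_sign_def)
    qed (use assms in auto)
    also have "\<dots> = jacobi_sum m k zs"
      unfolding jacobi_sum_def using assms by (subst shuffle_sum_swap) auto
    finally show ?thesis .
  qed
  finally show ?thesis .
qed

text \<open>
  Every pair of operations occurs in both orders in the Maurer-Cartan equation, so the sum is obtained
  twice; characteristic 0 allows to divide by 2.
\<close>

lemma sum_jacobi_sum:
  assumes "length zs = n" "n \<ge> 1" "F_graded zs"
  shows "(\<Sum>i=1..n. jacobi_sum (n + 1 - i) i zs) = 0"
proof -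
  let ?S = "\<Sum>i=1..n. jacobi_sum (n + 1 - i) i zs"
  have T: "B (\<Delta> k) (\<Delta> m) \<in> T" for k m by (intro B_closed G_T[OF \<Delta>_degree])
  have "0 = foldl B (\<Sum>i=1..n. B (\<Delta> (n + 1 - i)) (\<Delta> i)) (map fst zs)"
    using nested_0[OF F_graded_T[OF assms(3)]] \<Delta>_maurer_cartan[OF assms(2)] by simp
  also have "\<dots> = (\<Sum>i=1..n. foldl B (B (\<Delta> (n + 1 - i)) (\<Delta> i)) (map fst zs))"
    by (rule nested_sum[OF _ T F_graded_T[OF assms(3)]]) simp
  also have "\<dots> = (\<Sum>i=1..n. jacobi_sum i (n + 1 - i) zs + jacobi_sum (n + 1 - i) i zs)"
    using assms by (intro sum.cong refl nested_bracket_\<Delta>) auto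
  also have "\<dots> = (\<Sum>i=1..n. jacobi_sum i (n + 1 - i) zs) + ?S"
    by (simp add: sum.distrib)
  also have "(\<Sum>i=1..n. jacobi_sum i (n + 1 - i) zs) = ?S"
    by (rule sum.reindex_bij_witness[of _ "\<lambda>i. n + 1 - i" "\<lambda>i. n + 1 - i"]) auto
  also have "?S + ?S = s 2 ?S"
    using scale_left_distrib[of 1 1 ?S] by simp
  finally show ?thesis by simp
qed

lemma graded_vector_space_F: "graded_vector_space s F"
  by (unfold_locales) (use subspace_F F_direct in auto)

theorem L_infinity_algebra:
  assumes l: "\<And>k xs. \<lbrakk>k \<ge> 1; length xs = k; set xs \<subseteq> T\<rbrakk> \<Longrightarrow> l k xs = foldl B (\<Delta> k) xs"
  shows "L_infinity_algebra s F l"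
proof -
  interpret F: graded_vector_space s F by (rule graded_vector_space_F)
  have total_T: "F.total \<subseteq> T"
    unfolding F.total_def by (rule span_minimal[OF _ subspace_T]) (auto dest: F_T)
  have \<Delta>_T: "\<Delta> k \<in> T" for k by (rule G_T[OF \<Delta>_degree])
  have zip: "F_graded (zip xs ds)" "map fst (zip xs ds) = xs" "map snd (zip xs ds) = ds" "set xs \<subseteq> T"
    if "list_all2 (\<lambda>x d. x \<in> F d) xs ds" for xs ds
  proof -
    show gr: "F_graded (zip xs ds)" and fst: "map fst (zip xs ds) = xs" and "map snd (zip xs ds) = ds"
      using that list_all2_lengthD[OF that] by (auto simp: F_graded_def list_all2_iff)
    show "set xs \<subseteq> T" using F_graded_T[OF gr] unfolding fst .
  qed
  have closed: "foldl B (\<Delta> k) xs \<in> F.total"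
    if k: "k \<ge> 1" "length xs = k" "set xs \<subseteq> F.total" for k xs
  proof -
    \<comment> \<open>the arguments are decomposed into homogeneous ones, slot by slot\<close>
    have slots: "foldl B (\<Delta> k) xs \<in> F.total"
      if "j \<le> k" "length xs = k" "set xs \<subseteq> F.total" "\<forall>i. j \<le> i \<and> i < k \<longrightarrow> (\<exists>d. xs ! i \<in> F d)"
      for j and xs :: "'v list"
      using that
    proof (induction j arbitrary: xs)
      case 0
      then obtain d where d: "\<And>i. i < k \<Longrightarrow> xs ! i \<in> F (d i)" by atomize_elim (rule choice, auto)
      define zs where "zs = zip xs (map d [0..<k])"
      have "foldl B (\<Delta> k) (map fst zs) \<in> F (1 + degree_sum zs)"
        using k(1) 0(2) d by (intro \<Delta>_closed) (auto simp: zs_def set_zip)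
      then show ?case
        using 0(2) unfolding F.total_def by (intro span_base) (auto simp: zs_def)
    next
      case (Suc j)
      have xs_T: "set xs \<subseteq> T" using Suc.prems(3) total_T by auto
      have j: "j < length xs" using Suc.prems by simp
      have total: "subspace F.total" unfolding F.total_def by (rule subspace_span)
      let ?P = "\<lambda>x. x \<in> T \<and> foldl B (\<Delta> k) (xs[j := x]) \<in> F.total"
      have "xs ! j \<in> span (\<Union>k. F k)"
        using Suc.prems nth_mem[of j xs] unfolding F.total_def by auto
      then have "?P (xs ! j)"
      proof (induction rule: span_induct)
        case base
        show ?case
        proof (rule subspaceI)
          have "foldl B (\<Delta> k) (xs[j := s 0 0]) = s 0 (foldl B (\<Delta> k) (xs[j := 0]))"
            by (rule nested_update_scale[OF \<Delta>_T xs_T j subspace_0[OF subspace_T]])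
          then show "0 \<in> {x. ?P x}"
            using subspace_0[OF total] subspace_0[OF subspace_T] by simp
        next
          fix x y assume "x \<in> {x. ?P x}" "y \<in> {x. ?P x}"
          then show "x + y \<in> {x. ?P x}"
            using nested_update_add[OF \<Delta>_T xs_T j] subspace_add[OF total] subspace_add[OF subspace_T]
            by simp
        next
          fix c x assume "x \<in> {x. ?P x}"
          then show "s c x \<in> {x. ?P x}"
            using nested_update_scale[OF \<Delta>_T xs_T j] subspace_scale[OF total] subspace_scale[OF subspace_T]
            by simp
        qed
      next
        case (step x)
        then obtain d where d: "x \<in> F d" by auto
        then have x: "x \<in> F.total" unfolding F.total_def by (intro span_base) auto
        have "set (xs[j := x]) \<subseteq> F.total"
          using set_update_subset_insert[of xs j x] Suc.prems(3) x by auto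
        moreover have "\<exists>d. xs[j := x] ! i \<in> F d" if "j \<le> i" "i < k" for i
          using Suc.prems that d by (cases "i = j") auto
        ultimately show ?case
          using Suc.IH[of "xs[j := x]"] Suc.prems x total_T by auto
      qed
      then show ?case by simp
    qed
    show ?thesis by (rule slots[OF le_refl k(2,3)]) auto
  qed
  show ?thesis
  proof (unfold_locales)
    fix k :: nat and xs :: "'v list"
    assume k: "k \<ge> 1" "length xs = k"
    have upd: "l k (xs[i := x]) = foldl B (\<Delta> k) (xs[i := x])" if "set xs \<subseteq> T" "x \<in> T" for i x
      using that set_update_subset_insert[of xs i x] by (intro l[OF k(1)]) (auto simp: k(2))
    show "l k xs \<in> F.total" if "set xs \<subseteq> F.total"
      using closed[OF k that] l[OF k] that total_T by (simp add: subset_trans)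
    show "l k (xs[i := x + y]) = l k (xs[i := x]) + l k (xs[i := y])"
      if "set xs \<subseteq> F.total" "i < k" "x \<in> F.total" "y \<in> F.total" for i x y
      using that k nested_update_add[OF \<Delta>_T, of xs i x y] total_T
      by (simp add: upd subset_iff subspace_add[OF subspace_T] subspace_scale[OF subspace_T])
    show "l k (xs[i := s c x]) = s c (l k (xs[i := x]))"
      if "set xs \<subseteq> F.total" "i < k" "x \<in> F.total" for i x c
      using that k nested_update_scale[OF \<Delta>_T, of xs i x] total_T
      by (simp add: upd subset_iff subspace_add[OF subspace_T] subspace_scale[OF subspace_T])
  next
    fix k :: nat and xs ds
    assume k: "k \<ge> 1" "length xs = k" and xs: "list_all2 (\<lambda>x d. x \<in> F d) xs ds"
    have "foldl B (\<Delta> k) (map fst (zip xs ds)) \<in> F (1 + degree_sum (zip xs ds))"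
      using k zip(1)[OF xs] list_all2_lengthD[OF xs] by (intro \<Delta>_closed) (auto simp: F_graded_def)
    then show "l k xs \<in> F (sum_list ds + 1)"
      using zip(2,3)[OF xs] l[OF k zip(4)[OF xs]] by (simp add: degree_sum_def add.commute)
  next
    fix n xs ds \<sigma>
    assume n: "n \<ge> 1" "length xs = n" and xs: "list_all2 (\<lambda>x d. x \<in> F d) xs ds"
      and \<sigma>: "\<sigma> permutes {..<n}"
    have len: "length (zip xs ds) = n" using n list_all2_lengthD[OF xs] by simp
    have "permute_list \<sigma> (map fst (zip xs ds)) = map fst (permute_list \<sigma> (zip xs ds))"
      using \<sigma> len by (intro permute_list_map) simp
    then show "l n (permute_list \<sigma> xs) = s (of_int (koszul_sign \<sigma> ds)) (l n xs)"
      using nested_permute[OF _ \<Delta>_degree[of n] zip(1)[OF xs], of \<sigma>] \<sigma> len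
        l[OF n zip(4)[OF xs]] l[OF n(1), of "permute_list \<sigma> xs"] n(2) zip(4)[OF xs] set_permute_list[of \<sigma> xs]
      by (simp only: zip(2,3)[OF xs] length_permute_list length_map)
  next
    fix n xs ds
    assume n: "n \<ge> 1" "length xs = n" and xs: "list_all2 (\<lambda>x d. x \<in> F d) xs ds"
    let ?zs = "zip xs ds"
    have len: "length ?zs = n" using n list_all2_lengthD[OF xs] by simp
    have "(\<Sum>i=1..n. \<Sum>\<sigma>\<in>shuffle_perms i (n - i).
        let ys = permute_list \<sigma> xs in
        s (of_int (koszul_sign \<sigma> ds)) (l (n - i + 1) (l i (take i ys) # drop i ys)))
      = (\<Sum>i=1..n. jacobi_sum (n + 1 - i) i ?zs)"
    proof (rule sum.cong[OF refl])
      fix i assume i: "i \<in> {1..n}"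
      have "(\<Sum>\<sigma>\<in>shuffle_perms i (n - i). let ys = permute_list \<sigma> xs in
          s (of_int (koszul_sign \<sigma> ds)) (l (n - i + 1) (l i (take i ys) # drop i ys)))
        = (\<Sum>\<sigma>\<in>shuffle_perms i (n - i). s (of_int (koszul_sign \<sigma> (map snd ?zs)))
            (foldl B (\<Delta> (n + 1 - i)) (foldl B (\<Delta> i) (map fst (take i (permute_list \<sigma> ?zs)))
              # map fst (drop i (permute_list \<sigma> ?zs)))))"
      proof (rule sum.cong[OF refl])
        fix \<sigma> assume "\<sigma> \<in> shuffle_perms i (n - i)"
        then have "\<sigma> permutes {..<n}" using shuffle_perms_permutes[of \<sigma> i "n - i"] i by simp
        then have perm: "permute_list \<sigma> (map fst ?zs) = map fst (permute_list \<sigma> ?zs)"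
          using len by (intro permute_list_map) simp
        have T: "set (permute_list \<sigma> xs) \<subseteq> T"
          using zip(4)[OF xs] set_permute_list[of \<sigma> xs] \<open>\<sigma> permutes {..<n}\<close> n by simp
        from perm have p: "map fst (permute_list \<sigma> ?zs) = permute_list \<sigma> xs" using zip(2)[OF xs] by simp
        have "l i (take i (permute_list \<sigma> xs)) = foldl B (\<Delta> i) (take i (permute_list \<sigma> xs))"
          using i n T set_take_subset[of i "permute_list \<sigma> xs"] by (intro l) auto
        moreover have "l (n - i + 1) (foldl B (\<Delta> i) (take i (permute_list \<sigma> xs)) # drop i (permute_list \<sigma> xs))
            = foldl B (\<Delta> (n - i + 1)) (foldl B (\<Delta> i) (take i (permute_list \<sigma> xs)) # drop i (permute_list \<sigma> xs))"
          using i n T set_drop_subset[of i "permute_list \<sigma> xs"] set_take_subset[of i "permute_list \<sigma> xs"]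
          by (intro l) (auto intro!: nested_closed[OF \<Delta>_T])
        moreover have "n - i + 1 = n + 1 - i" using i by (simp add: Suc_diff_le)
        ultimately show "(let ys = permute_list \<sigma> xs in
            s (of_int (koszul_sign \<sigma> ds)) (l (n - i + 1) (l i (take i ys) # drop i ys)))
          = s (of_int (koszul_sign \<sigma> (map snd ?zs)))
            (foldl B (\<Delta> (n + 1 - i)) (foldl B (\<Delta> i) (map fst (take i (permute_list \<sigma> ?zs)))
              # map fst (drop i (permute_list \<sigma> ?zs))))"
          unfolding Let_def take_map[symmetric] drop_map[symmetric] p zip(3)[OF xs] by (simp only:)
      qed
      moreover have "n + 1 - i - 1 = n - i" using i by simp
      ultimately show "(\<Sum>\<sigma>\<in>shuffle_perms i (n - i). let ys = permute_list \<sigma> xs in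
          s (of_int (koszul_sign \<sigma> ds)) (l (n - i + 1) (l i (take i ys) # drop i ys)))
        = jacobi_sum (n + 1 - i) i ?zs"
        by (simp only: jacobi_sum_def shuffle_sum_def)
    qed
    also have "\<dots> = 0" by (rule sum_jacobi_sum[OF len n(1) zip(1)[OF xs]])
    finally show "(\<Sum>i=1..n. \<Sum>\<sigma>\<in>shuffle_perms i (n - i).
        let ys = permute_list \<sigma> xs in
        s (of_int (koszul_sign \<sigma> ds)) (l (n - i + 1) (l i (take i ys) # drop i ys))) = 0" .
  qed
qed

end

section \<open>A recursive form of the insertion product\<close>

definition slot :: "'v \<times> 'v \<Rightarrow> ('v, 'w) cochain \<Rightarrow> ('v, 'w) cochain"
  where "slot X P = (\<lambda>Xs. P (X # Xs))"

lemma slot_apply: "slot X P Xs = P (X # Xs)"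
  by (simp add: slot_def)

definition homogeneous :: "int \<Rightarrow> ('v, 'w::zero) cochain \<Rightarrow> bool"
  where "homogeneous n P \<longleftrightarrow> (\<forall>Xs z. int (length Xs) \<noteq> n \<longrightarrow> P Xs z = 0)"

lemma homogeneousD: "homogeneous n P \<Longrightarrow> int (length Xs) \<noteq> n \<Longrightarrow> P Xs z = 0"
  by (simp add: homogeneous_def)

lemma homogeneous_slot: "homogeneous n P \<Longrightarrow> homogeneous (n - 1) (slot X P)"
  by (auto simp: homogeneous_def slot_apply)

definition cut :: "nat \<Rightarrow> ('v, 'w::zero) cochain \<Rightarrow> ('v, 'w) cochain"
  where "cut n P = (\<lambda>Xs z. if length Xs = n then P Xs z else 0)"

lemma homogeneous_cut: "homogeneous (int n) (cut n P)"
  by (simp add: homogeneous_def cut_def)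

locale multilinear_cochains = vector_space s
  for s :: "'k::field \<Rightarrow> 'v::ab_group_add \<Rightarrow> 'v"
begin

text \<open>
  A single equation for linearity. It allows additivity and homogeneity of the constructions below to be
  proved in one step, together with linear combinations of cochains.
\<close>

definition lin :: "('v \<Rightarrow> 'v) \<Rightarrow> bool"
  where "lin f \<longleftrightarrow> (\<forall>a b x y. f (s a x + s b y) = s a (f x) + s b (f y))"

lemma linD: "lin f \<Longrightarrow> f (s a x + s b y) = s a (f x) + s b (f y)"
  by (simp add: lin_def)

lemma lin_0: "lin f \<Longrightarrow> f 0 = 0"
  using linD[of f 0 0 0 0] by simp

lemma lin_add: "lin f \<Longrightarrow> f (x + y) = f x + f y"
  using linD[of f 1 x 1 y] by simp

lemma lin_plus: "lin f \<Longrightarrow> lin g \<Longrightarrow> lin (\<lambda>x. f x + g x)"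
  unfolding lin_def by (simp add: scale_right_distrib add_ac)

lemma lin_scale: "lin f \<Longrightarrow> lin (\<lambda>x. s c (f x))"
  unfolding lin_def by (simp add: scale_right_distrib mult.commute)

lemma lin_compose: "lin f \<Longrightarrow> lin g \<Longrightarrow> lin (\<lambda>x. f (g x))"
  unfolding lin_def by simp

definition multilinear :: "('v, 'v) cochain \<Rightarrow> bool"
  where "multilinear P \<longleftrightarrow> (\<forall>Xs. lin (P Xs)) \<and>
    (\<forall>Xs i x y z. i < length Xs \<longrightarrow>
      lin (\<lambda>x. P (Xs[i := (x, y)]) z) \<and> lin (\<lambda>y. P (Xs[i := (x, y)]) z))"

lemma multilinear_last: "multilinear P \<Longrightarrow> lin (P Xs)"
  by (simp add: multilinear_def)

lemma multilinear_update:
  assumes "multilinear P" "i < length Xs"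
  shows "lin (\<lambda>x. P (Xs[i := (x, y)]) z)" "lin (\<lambda>y. P (Xs[i := (x, y)]) z)"
  using assms unfolding multilinear_def by blast+

lemma multilinear_head:
  assumes "multilinear P"
  shows "lin (\<lambda>x. P ((x, y) # Xs) z)" "lin (\<lambda>y. P ((x, y) # Xs) z)"
  using multilinear_update[OF assms, of 0 "(x, y) # Xs"] by simp_all

lemma multilinear_slot:
  assumes "multilinear P"
  shows "multilinear (slot X P)"
  unfolding multilinear_def
proof (intro conjI allI impI)
  fix Xs :: "('v \<times> 'v) list" and i x y z assume "i < length Xs"
  then show "lin (\<lambda>x. slot X P (Xs[i := (x, y)]) z)" "lin (\<lambda>y. slot X P (Xs[i := (x, y)]) z)"
    using multilinear_update[OF assms, of "Suc i" "X # Xs"] by (simp_all add: slot_apply)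
qed (use multilinear_last[OF assms] in \<open>simp add: slot_def\<close>)

definition lincomb :: "'k \<Rightarrow> ('v, 'v) cochain \<Rightarrow> 'k \<Rightarrow> ('v, 'v) cochain \<Rightarrow> ('v, 'v) cochain"
  where "lincomb a P b Q = (\<lambda>Xs z. s a (P Xs z) + s b (Q Xs z))"

lemma lincomb_apply: "lincomb a P b Q Xs z = s a (P Xs z) + s b (Q Xs z)"
  by (simp add: lincomb_def)

lemma slot_lincomb: "slot X (lincomb a P b Q) = lincomb a (slot X P) b (slot X Q)"
  by (simp add: lincomb_def slot_def)

lemma multilinear_lincomb: "multilinear P \<Longrightarrow> multilinear Q \<Longrightarrow> multilinear (lincomb a P b Q)"
  unfolding multilinear_def lincomb_def by (auto intro!: lin_plus lin_scale)

text \<open>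
  The sign \<open>(-1)\<^sup>q\<close> on the component of degree \<open>q\<close>, for cochains that need not be homogeneous.
\<close>

definition alternate :: "('v, 'v) cochain \<Rightarrow> ('v, 'v) cochain"
  where "alternate P = (\<lambda>Xs z. s (parity_sign (int (length Xs))) (P Xs z))"

lemma alternate_apply: "alternate P Xs z = s (parity_sign (int (length Xs))) (P Xs z)"
  by (simp add: alternate_def)

lemma alternate_lincomb: "alternate (lincomb a P b Q) = lincomb a (alternate P) b (alternate Q)"
  by (simp add: lincomb_def alternate_def fun_eq_iff scale_right_distrib mult.commute)

lemma multilinear_alternate: "multilinear P \<Longrightarrow> multilinear (alternate P)"
  unfolding multilinear_def alternate_def by (auto intro!: lin_scale)

lemma alternate_homogeneous:
  "homogeneous n P \<Longrightarrow> alternate P = lincomb (parity_sign n) P 0 (\<lambda>Xs z. 0)"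
  by (auto simp: homogeneous_def alternate_def lincomb_def fun_eq_iff)

lemma homogeneous_alternate: "homogeneous n P \<Longrightarrow> homogeneous n (alternate P)"
  by (auto simp: homogeneous_def alternate_apply)

text \<open>
  The product \<open>P \<circ> Q\<close> of the shuffle formula, by recursion on the arguments and without reference to
  degrees. The summands of the second equation correspond to the roles that the first argument \<open>X\<close> can
  play: it goes to \<open>P\<close>, past all \<open>q\<close> arguments of \<open>Q\<close>, whence the sign; it goes to \<open>Q\<close>; or \<open>Q\<close>, of degree
  0, is applied to one of its components.
\<close>

fun circ :: "('v, 'v) cochain \<Rightarrow> ('v, 'v) cochain \<Rightarrow> ('v, 'v) cochain"
  where
    "circ P Q [] z = P [] (Q [] z)"
  | "circ P Q (X # Xs) z =
      circ (slot X P) (alternate Q) Xs z + circ P (slot X Q) Xs z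
      + P ((Q [] (fst X), snd X) # Xs) z + P ((fst X, Q [] (snd X)) # Xs) z"

lemma circ_lincomb_left:
  "circ (lincomb a P b P') Q Xs z = s a (circ P Q Xs z) + s b (circ P' Q Xs z)"
  by (induction Xs arbitrary: P P' Q)
    (simp_all add: slot_lincomb lincomb_apply scale_right_distrib add_ac)

lemma circ_lincomb_right:
  "multilinear P \<Longrightarrow> circ P (lincomb a Q b Q') Xs z = s a (circ P Q Xs z) + s b (circ P Q' Xs z)"
proof (induction Xs arbitrary: P Q Q')
  case Nil
  then show ?case by (simp add: lincomb_apply linD[OF multilinear_last])
next
  case (Cons X Xs)
  note P = Cons.prems
  show ?case
    unfolding circ.simps slot_lincomb alternate_lincomb Cons.IH[OF P] Cons.IH[OF multilinear_slot[OF P]]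
    unfolding lincomb_apply linD[OF multilinear_head(1)[OF P]] linD[OF multilinear_head(2)[OF P]]
    by (simp add: scale_right_distrib add_ac)
qed

lemma circ_add_left: "circ (P + P') Q = circ P Q + circ P' Q"
proof -
  have eq: "P + P' = lincomb 1 P 1 P'" by (simp add: fun_eq_iff lincomb_apply)
  show ?thesis
  proof (intro ext)
    show "circ (P + P') Q Xs z = (circ P Q + circ P' Q) Xs z" for Xs z
      unfolding eq circ_lincomb_left by simp
  qed
qed

lemma circ_add_right:
  assumes "multilinear P"
  shows "circ P (Q + Q') = circ P Q + circ P Q'"
proof -
  have eq: "Q + Q' = lincomb 1 Q 1 Q'" by (simp add: fun_eq_iff lincomb_apply)
  show ?thesis
  proof (intro ext)
    show "circ P (Q + Q') Xs z = (circ P Q + circ P Q') Xs z" for Xs z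
      unfolding eq circ_lincomb_right[OF assms] by simp
  qed
qed

lemma circ_0_left [simp]: "circ (\<lambda>Xs z. 0) Q Xs z = 0"
  using circ_lincomb_left[of 0 "\<lambda>Xs z. 0" 0 "\<lambda>Xs z. 0"] by (simp add: lincomb_def)

lemma circ_0_right: "multilinear P \<Longrightarrow> circ P (\<lambda>Xs z. 0) Xs z = 0"
  using circ_lincomb_right[of P 0 "\<lambda>Xs z. 0" 0 "\<lambda>Xs z. 0"] by (simp add: lincomb_def)

lemma circ_alternate_right:
  "multilinear P \<Longrightarrow> homogeneous q Q \<Longrightarrow> circ P (alternate Q) Xs z = s (parity_sign q) (circ P Q Xs z)"
  by (simp add: alternate_homogeneous circ_lincomb_right)

lemma multilinear_circ:
  assumes "multilinear P" "multilinear Q"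
  shows "multilinear (circ P Q)"
  unfolding multilinear_def
proof (intro conjI allI impI)
  fix Xs
  show "lin (circ P Q Xs)"
    using assms
  proof (induction Xs arbitrary: P Q)
    case Nil
    have "circ P Q [] = (\<lambda>z. P [] (Q [] z))" by (simp add: fun_eq_iff)
    then show ?case using lin_compose[OF multilinear_last[OF Nil(1)] multilinear_last[OF Nil(2)]] by simp
  next
    case (Cons X Xs)
    note P = Cons.prems(1) and Q = Cons.prems(2)
    have "circ P Q (X # Xs) = (\<lambda>z. circ (slot X P) (alternate Q) Xs z + circ P (slot X Q) Xs z
      + P ((Q [] (fst X), snd X) # Xs) z + P ((fst X, Q [] (snd X)) # Xs) z)"
      by (simp only: circ.simps fun_eq_iff) simp
    then show ?case
      using Cons.IH[OF multilinear_slot[OF P] multilinear_alternate[OF Q]]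
        Cons.IH[OF P multilinear_slot[OF Q]]
      by (simp only:) (intro lin_plus multilinear_last[OF P])
  qed
next
  fix Xs :: "('v \<times> 'v) list" and i x y z assume "i < length Xs"
  then have "lin (\<lambda>x. circ P Q (Xs[i := (x, y)]) z) \<and> lin (\<lambda>y. circ P Q (Xs[i := (x, y)]) z)"
    using assms
  proof (induction Xs arbitrary: i P Q)
    case (Cons X Xs)
    show ?case
    proof (cases i)
      case 0
      have sl: "slot (s a x + s b x', y) R = lincomb a (slot (x, y) R) b (slot (x', y) R)"
        "slot (y, s a x + s b x') R = lincomb a (slot (y, x) R) b (slot (y, x') R)"
        if "multilinear R" for a b x x' y R
        using multilinear_head[OF that] by (simp_all add: fun_eq_iff lin_def slot_apply lincomb_apply)
      note P = Cons.prems(2) and Q = Cons.prems(3)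
      note li = multilinear_head[OF P] multilinear_last[OF Q]
      have "lin (\<lambda>x. circ (slot (x, y) P) (alternate Q) Xs z)" for y
        unfolding lin_def by (simp add: sl[OF P] circ_lincomb_left)
      moreover have "lin (\<lambda>x. circ P (slot (x, y) Q) Xs z)" for y
        unfolding lin_def by (simp add: sl[OF Q] circ_lincomb_right[OF P])
      moreover have "lin (\<lambda>x. circ (slot (y, x) P) (alternate Q) Xs z)" for y
        unfolding lin_def by (simp add: sl[OF P] circ_lincomb_left)
      moreover have "lin (\<lambda>x. circ P (slot (y, x) Q) Xs z)" for y
        unfolding lin_def by (simp add: sl[OF Q] circ_lincomb_right[OF P])
      ultimately show ?thesis
        unfolding 0 list_update_code circ.simps fst_conv snd_conv
        by (intro conjI lin_plus lin_compose[OF li(1) li(3)] lin_compose[OF li(2) li(3)] li(1,2)) auto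
    next
      case (Suc j)
      note P = Cons.prems(2) and Q = Cons.prems(3)
      have j: "j < length Xs" using Cons.prems(1) Suc by simp
      note IH = Cons.IH[OF j multilinear_slot[OF P] multilinear_alternate[OF Q]]
        Cons.IH[OF j P multilinear_slot[OF Q]]
      show ?thesis
        unfolding Suc list_update_code circ.simps
        using IH multilinear_update[OF P, of "Suc j" "(a, b) # Xs" for a b] j
        by (intro conjI lin_plus) auto
    qed
  qed simp
  then show "lin (\<lambda>x. circ P Q (Xs[i := (x, y)]) z)" "lin (\<lambda>y. circ P Q (Xs[i := (x, y)]) z)"
    by auto
qed

lemma homogeneous_circ:
  assumes "multilinear P" "homogeneous p P" "homogeneous q Q"
  shows "homogeneous (p + q) (circ P Q)"
proof -
  have "circ P Q Xs z = 0" if "int (length Xs) \<noteq> p + q" for Xs z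
    using that assms
  proof (induction Xs arbitrary: P Q p q)
    case Nil
    then show ?case
      by (cases "q = 0") (auto simp: homogeneous_def lin_0[OF multilinear_last])
  next
    case (Cons X Xs)
    have 1: "circ (slot X P) (alternate Q) Xs z = 0"
      using Cons.prems
      by (intro Cons.IH[of "p - 1" q] multilinear_slot homogeneous_slot homogeneous_alternate) simp_all
    have 2: "circ P (slot X Q) Xs z = 0"
      using Cons.prems by (intro Cons.IH[of p "q - 1"] homogeneous_slot) simp_all
    have "P ((Q [] (fst X), snd X) # Xs) z = 0 \<and> P ((fst X, Q [] (snd X)) # Xs) z = 0"
    proof (cases "q = 0")
      case True
      then show ?thesis using Cons.prems by (auto simp: homogeneous_def)
    next
      case False
      then have "Q [] w = 0" for w using Cons.prems by (auto simp: homogeneous_def)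
      then show ?thesis
        by (simp add: lin_0[OF multilinear_head(1)] lin_0[OF multilinear_head(2)] Cons.prems(2))
    qed
    with 1 2 show ?case by simp
  qed
  then show ?thesis by (simp add: homogeneous_def)
qed

definition associator :: "('v, 'v) cochain \<Rightarrow> ('v, 'v) cochain \<Rightarrow> ('v, 'v) cochain \<Rightarrow> ('v, 'v) cochain"
  where "associator P Q R Xs z = circ (circ P Q) R Xs z - circ P (circ Q R) Xs z"

lemma slot_circ: "slot X (circ P Q) = circ (slot X P) (alternate Q) + circ P (slot X Q)
      + slot (Q [] (fst X), snd X) P + slot (fst X, Q [] (snd X)) P"
  by (simp add: fun_eq_iff slot_apply)

lemma circ_circ_alternate_left:
  "homogeneous q Q \<Longrightarrow> multilinear P \<Longrightarrow>
    circ (circ P (alternate Q)) R Xs z = s (parity_sign q) (circ (circ P Q) R Xs z)"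
proof -
  assume "homogeneous q Q" "multilinear P"
  then have "circ P (alternate Q) = lincomb (parity_sign q) (circ P Q) 0 (\<lambda>Xs z. 0)"
    by (simp add: fun_eq_iff circ_alternate_right lincomb_apply)
  then show ?thesis by (simp add: circ_lincomb_left)
qed

lemma circ_circ_alternate_right:
  "homogeneous r R \<Longrightarrow> multilinear P \<Longrightarrow> multilinear Q \<Longrightarrow>
    circ P (circ Q (alternate R)) Xs z = s (parity_sign r) (circ P (circ Q R) Xs z)"
proof -
  assume *: "homogeneous r R" "multilinear P" "multilinear Q"
  then have "circ Q (alternate R) = lincomb (parity_sign r) (circ Q R) 0 (\<lambda>Xs z. 0)"
    by (simp add: fun_eq_iff circ_alternate_right lincomb_apply)
  then show ?thesis using * by (simp add: circ_lincomb_right)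
qed

lemma associator_Nil: "associator P Q R [] z = 0"
  by (simp add: associator_def)

text \<open>
  Filling the first slot is a derivation up to corrections, hence it acts on the associator slot by
  slot. The corrections with both \<open>Q\<close> and \<open>R\<close> applied to the same component of \<open>X\<close> occur in both products
  and cancel.
\<close>

lemma associator_Cons:
  assumes "multilinear P" "multilinear Q" "multilinear R" "homogeneous q Q" "homogeneous r R"
  shows "associator P Q R (X # Xs) z =
    s (parity_sign (q + r)) (associator (slot X P) Q R Xs z)
    + s (parity_sign r) (associator P (slot X Q) R Xs z)
    + associator P Q (slot X R) Xs z
    + s (parity_sign r) (circ (slot (Q [] (fst X), snd X) P) R Xs z
        + circ (slot (fst X, Q [] (snd X)) P) R Xs z)
    + s (parity_sign q) (circ (slot (R [] (fst X), snd X) P) Q Xs z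
        + circ (slot (fst X, R [] (snd X)) P) Q Xs z)
    + (P ((Q [] (fst X), R [] (snd X)) # Xs) z + P ((R [] (fst X), Q [] (snd X)) # Xs) z)"
proof -
  note ml = assms(1-3) multilinear_slot multilinear_circ multilinear_alternate
  have qr: "homogeneous (q + r) (circ Q R)" by (rule homogeneous_circ[OF assms(2,4,5)])
  have L: "circ (circ P Q) R (X # Xs) z =
    s (parity_sign r) (s (parity_sign q) (circ (circ (slot X P) Q) R Xs z) + circ (circ P (slot X Q)) R Xs z
      + (circ (slot (Q [] (fst X), snd X) P) R Xs z + circ (slot (fst X, Q [] (snd X)) P) R Xs z))
    + circ (circ P Q) (slot X R) Xs z
    + (s (parity_sign q) (circ (slot (R [] (fst X), snd X) P) Q Xs z)
       + circ P (slot (R [] (fst X), snd X) Q) Xs z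
       + P ((Q [] (R [] (fst X)), snd X) # Xs) z + P ((R [] (fst X), Q [] (snd X)) # Xs) z)
    + (s (parity_sign q) (circ (slot (fst X, R [] (snd X)) P) Q Xs z)
       + circ P (slot (fst X, R [] (snd X)) Q) Xs z
       + P ((Q [] (fst X), R [] (snd X)) # Xs) z + P ((fst X, Q [] (R [] (snd X))) # Xs) z)"
    unfolding circ.simps(2)[of "circ P Q" R] slot_circ circ_add_left
    by (simp add: circ_alternate_right[OF _ assms(5)] circ_alternate_right[OF _ assms(4)]
        circ_circ_alternate_left[OF assms(4)] ml scale_right_distrib add.assoc slot_apply)
  have R: "circ P (circ Q R) (X # Xs) z =
    s (parity_sign (q + r)) (circ (slot X P) (circ Q R) Xs z)
    + (s (parity_sign r) (circ P (circ (slot X Q) R) Xs z) + circ P (circ Q (slot X R)) Xs z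
      + (circ P (slot (R [] (fst X), snd X) Q) Xs z + circ P (slot (fst X, R [] (snd X)) Q) Xs z))
    + P ((Q [] (R [] (fst X)), snd X) # Xs) z + P ((fst X, Q [] (R [] (snd X))) # Xs) z"
    unfolding circ.simps(2)[of P "circ Q R"] circ_alternate_right[OF multilinear_slot[OF assms(1)] qr]
      slot_circ circ_add_right[OF assms(1)]
    by (simp add: circ_circ_alternate_right[OF assms(5)] ml add.assoc)
  show ?thesis
    unfolding associator_def L R
    by (simp add: parity_sign_add scale_right_distrib scale_right_diff_distrib algebra_simps)
qed

text \<open>
  This is the graded pre-Lie identity. Comparing the expansions of both sides, the associators match by
  induction and the corrections are symmetric. The latter only occur if \<open>Q\<close> or \<open>R\<close> has degree 0,
  in which case the sign is \<open>+1\<close>.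
\<close>

theorem associator_graded_symmetric:
  assumes "multilinear P" "multilinear Q" "multilinear R" "homogeneous q Q" "homogeneous r R"
  shows "associator P Q R Xs z = s (parity_sign (q * r)) (associator P R Q Xs z)"
  using assms
proof (induction Xs arbitrary: P Q R q r)
  case Nil
  then show ?case by (simp add: associator_Nil)
next
  case (Cons X Xs)
  note P = Cons.prems(1) and Q = Cons.prems(2) and R = Cons.prems(3)
    and q = Cons.prems(4) and r = Cons.prems(5)
  have 1: "associator (slot X P) Q R Xs z = s (parity_sign (q * r)) (associator (slot X P) R Q Xs z)"
    by (rule Cons.IH[OF multilinear_slot[OF P] Q R q r])
  have 2: "associator P (slot X Q) R Xs z = s (parity_sign ((q - 1) * r)) (associator P R (slot X Q) Xs z)"
    by (rule Cons.IH[OF P multilinear_slot[OF Q] R homogeneous_slot[OF q] r])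
  have 3: "associator P Q (slot X R) Xs z = s (parity_sign (q * (r - 1))) (associator P (slot X R) Q Xs z)"
    by (rule Cons.IH[OF P Q multilinear_slot[OF R] q homogeneous_slot[OF r]])
  show ?case
  proof (cases "odd q \<and> odd r")
    case True
    then have "q \<noteq> 0" "r \<noteq> 0" by auto
    then have 0: "Q [] w = 0" "R [] w = 0" for w
      using q r by (auto simp: homogeneous_def)
    have z: "P ((0, y) # Ys) w = 0" "P ((y, 0) # Ys) w = 0" for y w Ys
      using lin_0[OF multilinear_head(1)[OF P]] lin_0[OF multilinear_head(2)[OF P]] by auto
    have sl: "slot (0, y) P = (\<lambda>Xs z. 0)" "slot (y, 0) P = (\<lambda>Xs z. 0)" for y
      by (simp_all add: fun_eq_iff z slot_apply)
    \<comment> \<open>both degrees are nonzero, so there are no corrections\<close>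
    show ?thesis
      using True
      by (simp add: associator_Cons[OF P Q R q r] associator_Cons[OF P R Q r q] 1 2 3 0 z sl
          parity_sign_def algebra_simps)
  next
    case False
    then show ?thesis
      by (cases "even q"; cases "even r")
        (simp_all add: associator_Cons[OF P Q R q r] associator_Cons[OF P R Q r q] 1 2 3
          parity_sign_def algebra_simps)
  qed
qed

definition bracket :: "int \<Rightarrow> int \<Rightarrow> ('v, 'v) cochain \<Rightarrow> ('v, 'v) cochain \<Rightarrow> ('v, 'v) cochain"
  where "bracket p q P Q = lincomb 1 (circ P Q) (- parity_sign (p * q)) (circ Q P)"

lemma homogeneous_bracket:
  assumes "multilinear P" "multilinear Q" "homogeneous p P" "homogeneous q Q"
  shows "homogeneous (p + q) (bracket p q P Q)"
  using homogeneous_circ[OF assms(1,3,4)] homogeneous_circ[OF assms(2,4,3)]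
  by (simp add: bracket_def homogeneous_def add.commute lincomb_apply)

text \<open>
  The commutator of a graded pre-Lie product satisfies the graded Jacobi identity: the associators
  cancel in pairs by their symmetry.
\<close>

theorem bracket_jacobi:
  assumes "multilinear P" "multilinear Q" "multilinear R"
    and "homogeneous p P" "homogeneous q Q" "homogeneous r R"
  shows "bracket (p + q) r (bracket p q P Q) R Xs z
    = bracket p (q + r) P (bracket q r Q R) Xs z
      + s (parity_sign (q * r)) (bracket (p + r) q (bracket p r P R) Q Xs z)"
proof -
  note ass = assms(1-3)
  have a: "associator P Q R Xs z = s (parity_sign (q * r)) (associator P R Q Xs z)"
    "associator Q P R Xs z = s (parity_sign (p * r)) (associator Q R P Xs z)"
    "associator R P Q Xs z = s (parity_sign (p * q)) (associator R Q P Xs z)"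
    by (rule associator_graded_symmetric; fact assms)+
  have e: "circ (circ P Q) R Xs z = s (parity_sign (q * r)) (associator P R Q Xs z) + circ P (circ Q R) Xs z"
    "circ (circ Q P) R Xs z = s (parity_sign (p * r)) (associator Q R P Xs z) + circ Q (circ P R) Xs z"
    "circ (circ R P) Q Xs z = s (parity_sign (p * q)) (associator R Q P Xs z) + circ R (circ P Q) Xs z"
    using a by (simp_all add: associator_def algebra_simps)
  show ?thesis
    unfolding bracket_def lincomb_apply circ_lincomb_left
      circ_lincomb_right[OF assms(1)] circ_lincomb_right[OF assms(2)] circ_lincomb_right[OF assms(3)]
      e associator_def
    by (cases "even p"; cases "even q"; cases "even r") (simp_all add: parity_sign_def algebra_simps)
qed

end

section \<open>Alternating and cyclic cochains\<close>

definition alternating :: "('v, 'w::zero) cochain \<Rightarrow> bool"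
  where "alternating P \<longleftrightarrow> (\<forall>Xs i x z. i < length Xs \<longrightarrow> P (Xs[i := (x, x)]) z = 0)"

definition cyclic :: "('v, 'w::ab_group_add) cochain \<Rightarrow> bool"
  where "cyclic P \<longleftrightarrow>
    (\<forall>Xs x y z. P (Xs @ [(x, y)]) z + P (Xs @ [(y, z)]) x + P (Xs @ [(z, x)]) y = 0)"

lemma alternating_slot: "alternating P \<Longrightarrow> alternating (slot X P)"
  unfolding alternating_def slot_def
proof (intro allI impI)
  fix Xs i x z
  assume "\<forall>Xs i x z. i < length Xs \<longrightarrow> P (Xs[i := (x, x)]) z = 0" "i < length (Xs :: ('a \<times> 'a) list)"
  from this(1)[rule_format, of "Suc i" "X # Xs" x z] this(2) show "P (X # Xs[i := (x, x)]) z = 0"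
    by simp
qed

lemma cyclic_slot: "cyclic P \<Longrightarrow> cyclic (slot X P)"
  unfolding cyclic_def slot_def
proof (intro allI)
  fix Xs x y z
  assume "\<forall>Xs x y z. P (Xs @ [(x, y)]) z + P (Xs @ [(y, z)]) x + P (Xs @ [(z, x)]) y = 0"
  from this[rule_format, of "X # Xs" x y z]
  show "P (X # Xs @ [(x, y)]) z + P (X # Xs @ [(y, z)]) x + P (X # Xs @ [(z, x)]) y = 0" by simp
qed

lemma cyclicD: "cyclic P \<Longrightarrow> P (Xs @ [(x, y)]) z + P (Xs @ [(y, z)]) x + P (Xs @ [(z, x)]) y = 0"
  by (simp add: cyclic_def)

context multilinear_cochains
begin

lemma alternating_lincomb: "alternating P \<Longrightarrow> alternating Q \<Longrightarrow> alternating (lincomb a P b Q)"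
  by (simp add: alternating_def lincomb_apply)

lemma cyclic_lincomb:
  assumes "cyclic P" "cyclic Q"
  shows "cyclic (lincomb a P b Q)"
  unfolding cyclic_def lincomb_apply
proof (intro allI)
  fix Xs x y z
  have "s a (P (Xs @ [(x, y)]) z) + s b (Q (Xs @ [(x, y)]) z) +
      (s a (P (Xs @ [(y, z)]) x) + s b (Q (Xs @ [(y, z)]) x)) +
      (s a (P (Xs @ [(z, x)]) y) + s b (Q (Xs @ [(z, x)]) y))
    = s a (P (Xs @ [(x, y)]) z + P (Xs @ [(y, z)]) x + P (Xs @ [(z, x)]) y)
      + s b (Q (Xs @ [(x, y)]) z + Q (Xs @ [(y, z)]) x + Q (Xs @ [(z, x)]) y)"
    by (simp add: scale_right_distrib add_ac)
  also have "\<dots> = 0" by (simp add: cyclicD assms)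
  finally show "s a (P (Xs @ [(x, y)]) z) + s b (Q (Xs @ [(x, y)]) z) +
      (s a (P (Xs @ [(y, z)]) x) + s b (Q (Xs @ [(y, z)]) x)) +
      (s a (P (Xs @ [(z, x)]) y) + s b (Q (Xs @ [(z, x)]) y)) = 0" .
qed

lemma alternating_alternate: "alternating P \<Longrightarrow> alternating (alternate P)"
  by (simp add: alternating_def alternate_apply)

lemma cyclic_alternate:
  assumes "cyclic P"
  shows "cyclic (alternate P)"
  unfolding cyclic_def
proof (intro allI)
  fix Xs x y z
  show "alternate P (Xs @ [(x, y)]) z + alternate P (Xs @ [(y, z)]) x + alternate P (Xs @ [(z, x)]) y = 0"
    using cyclicD[OF assms, of Xs x y z]
    by (simp add: alternate_apply scale_right_distrib[symmetric] del: scale_right_distrib)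
qed

text \<open>
  The only case that needs an argument is an equal pair in the first slot; there the two
  terms in which \<open>Q\<close> of degree 0 is applied to a component cancel by polarisation.
\<close>

lemma alternating_circ:
  assumes "multilinear P" "alternating P" "alternating Q"
  shows "alternating (circ P Q)"
proof -
  have "circ P Q (Xs[i := (x, x)]) z = 0" if "i < length Xs" for Xs i x z
    using that assms
  proof (induction Xs arbitrary: i P Q)
    case (Cons X Xs)
    note P = Cons.prems(2,3) and Q = Cons.prems(4)
    have alt: "R ((x, x) # Ys) w = 0" if "alternating R" for R :: "('v, 'v) cochain" and x w Ys
      using that[unfolded alternating_def, rule_format, of 0 "(x, x) # Ys" x w] by simp
    show ?case
    proof (cases i)
      case 0
      have sl: "slot (x, x) R = (\<lambda>Xs z. 0)" if "alternating R" for R :: "('v, 'v) cochain"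
        using alt[OF that] by (simp add: fun_eq_iff slot_apply)
      let ?q = "Q [] x"
      have add: "P ((u + v, w) # Xs) z = P ((u, w) # Xs) z + P ((v, w) # Xs) z"
        "P ((w, u + v) # Xs) z = P ((w, u) # Xs) z + P ((w, v) # Xs) z" for u v w
        using lin_add[OF multilinear_head(1)[OF P(1)]] lin_add[OF multilinear_head(2)[OF P(1)]] by auto
      have "P ((?q, x) # Xs) z + P ((x, ?q) # Xs) z = 0"
        using alt[OF P(2), of "?q + x" Xs z] unfolding add by (simp add: alt[OF P(2)] add.commute)
      then show ?thesis
        by (simp add: 0 sl[OF P(2)] sl[OF Q] circ_0_right[OF P(1)])
    next
      case (Suc j)
      then have j: "j < length Xs" using Cons.prems(1) by simp
      have "P (Y # Xs[j := (x, x)]) z = 0" for Y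
        using P(2)[unfolded alternating_def, rule_format, of "Suc j" "Y # Xs" x z] j by simp
      then show ?thesis
        using Cons.IH[OF j multilinear_slot[OF P(1)] alternating_slot[OF P(2)] alternating_alternate[OF Q]]
          Cons.IH[OF j P alternating_slot[OF Q]]
        by (simp add: Suc)
    qed
  qed simp
  then show ?thesis by (simp add: alternating_def)
qed

text \<open>
  After the first slots have been filled, one pair is left. Then the cyclic identity is that of \<open>Q\<close> under
  \<open>P\<close>, plus three instances of that of \<open>P\<close> in which \<open>Q\<close> is applied to one of the three arguments.
\<close>

lemma cyclic_circ:
  assumes "multilinear P" "cyclic P" "cyclic Q"
  shows "cyclic (circ P Q)"
proof -
  have "circ P Q (Xs @ [(x, y)]) z + circ P Q (Xs @ [(y, z)]) x + circ P Q (Xs @ [(z, x)]) y = 0" for Xs x y z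
    using assms
  proof (induction Xs arbitrary: P Q)
    case Nil
    note P = Nil(1,2) and Q = Nil(3)
    let ?q = "Q []"
    have eq: "circ P Q [(x, y)] z
      = P [(x, y)] (?q z) + P [] (Q [(x, y)] z) + P [(?q x, y)] z + P [(x, ?q y)] z" for x y z
      by (simp add: slot_apply alternate_apply)
    have p: "P [(x, y)] z + P [(y, z)] x + P [(z, x)] y = 0" for x y z
      using cyclicD[OF P(2), of "[]"] by simp
    have "P [] (Q [(x, y)] z) + P [] (Q [(y, z)] x) + P [] (Q [(z, x)] y)
      = P [] (Q [(x, y)] z + Q [(y, z)] x + Q [(z, x)] y)"
      by (simp only: lin_add[OF multilinear_last[OF P(1)]])
    also have "\<dots> = 0"
      using cyclicD[OF Q, of "[]" x y z] by (simp add: lin_0[OF multilinear_last[OF P(1)]])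
    finally have q: "P [] (Q [(x, y)] z) + P [] (Q [(y, z)] x) + P [] (Q [(z, x)] y) = 0" .
    have "circ P Q [(x, y)] z + circ P Q [(y, z)] x + circ P Q [(z, x)] y
      = (P [(x, y)] (?q z) + P [(y, ?q z)] x + P [(?q z, x)] y)
      + (P [(y, z)] (?q x) + P [(z, ?q x)] y + P [(?q x, y)] z)
      + (P [(z, x)] (?q y) + P [(x, ?q y)] z + P [(?q y, z)] x)
      + (P [] (Q [(x, y)] z) + P [] (Q [(y, z)] x) + P [] (Q [(z, x)] y))"
      unfolding eq by (simp add: add_ac)
    then show ?case unfolding p q by simp
  next
    case (Cons X Xs)
    note P = Cons.prems(1,2) and Q = Cons.prems(3)
    let ?Y = "(Q [] (fst X), snd X)" and ?Z = "(fst X, Q [] (snd X))"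
    let ?S = "\<lambda>R. R (Xs @ [(x, y)]) z + R (Xs @ [(y, z)]) x + R (Xs @ [(z, x)]) y"
    have "circ P Q ((X # Xs) @ [(x, y)]) z + circ P Q ((X # Xs) @ [(y, z)]) x + circ P Q ((X # Xs) @ [(z, x)]) y
      = ?S (circ (slot X P) (alternate Q)) + ?S (circ P (slot X Q)) + ?S (slot ?Y P) + ?S (slot ?Z P)"
      by (simp add: slot_apply add_ac)
    also have "\<dots> = 0"
      unfolding Cons.IH[OF multilinear_slot[OF P(1)] cyclic_slot[OF P(2)] cyclic_alternate[OF Q]]
        Cons.IH[OF P cyclic_slot[OF Q]] cyclicD[OF cyclic_slot[OF P(2)]] by simp
    finally show ?case .
  qed
  then show ?thesis by (simp add: cyclic_def)
qed

definition admissible :: "('v, 'v) cochain \<Rightarrow> bool"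
  where "admissible P \<longleftrightarrow> multilinear P \<and> alternating P \<and> cyclic P"

lemma admissible_multilinear: "admissible P \<Longrightarrow> multilinear P"
  by (simp add: admissible_def)

lemma admissible_lincomb: "admissible P \<Longrightarrow> admissible Q \<Longrightarrow> admissible (lincomb a P b Q)"
  by (simp add: admissible_def multilinear_lincomb alternating_lincomb cyclic_lincomb)

lemma admissible_circ: "admissible P \<Longrightarrow> admissible Q \<Longrightarrow> admissible (circ P Q)"
  by (simp add: admissible_def multilinear_circ alternating_circ cyclic_circ)

lemma admissible_bracket: "admissible P \<Longrightarrow> admissible Q \<Longrightarrow> admissible (bracket p q P Q)"
  by (simp add: bracket_def admissible_lincomb admissible_circ)

lemma admissible_0: "admissible (\<lambda>Xs z. 0)"
  by (simp add: admissible_def multilinear_def alternating_def cyclic_def lin_def)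

text \<open>
  All conditions on a cochain relate its values on lists of the same length, so they can be checked
  degree by degree.
\<close>

lemma admissible_by_length:
  assumes "\<And>n. admissible (R n)"
  shows "admissible (\<lambda>Xs. R (length Xs) Xs)"
  using assms unfolding admissible_def multilinear_def alternating_def cyclic_def by simp

lemma admissible_cut:
  assumes "admissible P"
  shows "admissible (cut n P)"
proof -
  let ?R = "\<lambda>m. if m = n then P else (\<lambda>Xs z. 0)"
  have eq: "cut n P = (\<lambda>Xs. ?R (length Xs) Xs)"
    by (simp add: cut_def fun_eq_iff)
  show ?thesis
    unfolding eq by (rule admissible_by_length[of ?R]) (simp add: assms admissible_0)
qed

lemma admissible_sum:
  assumes "\<And>p. admissible (R p)"
  shows "admissible (\<lambda>Xs z. \<Sum>p\<le>(n::nat). R p Xs z)"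
proof (induction n)
  case 0
  then show ?case using assms by simp
next
  case (Suc n)
  have "(\<lambda>Xs z. \<Sum>p\<le>Suc n. R p Xs z) = lincomb 1 (\<lambda>Xs z. \<Sum>p\<le>n. R p Xs z) 1 (R (Suc n))"
    by (simp add: fun_eq_iff lincomb_apply)
  then show ?case using admissible_lincomb[OF Suc assms] by (simp only:)
qed

end

section \<open>The shuffle formula and the recursion agree\<close>

context multilinear_cochains
begin

definition signed_shuffles ::
    "nat \<Rightarrow> nat \<Rightarrow> ('v \<times> 'v) list \<Rightarrow> (('v \<times> 'v) list \<Rightarrow> ('v \<times> 'v) list \<Rightarrow> 'v) \<Rightarrow> 'v"
  where "signed_shuffles k q Xs F = (\<Sum>\<sigma>\<in>shuffle_perms k q.
    s ((- 1) ^ (k * q) * of_int (sign \<sigma>)) (F (take k (permute_list \<sigma> Xs)) (drop k (permute_list \<sigma> Xs))))"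

lemma signed_shuffles_eq:
  assumes "length Xs = k + q"
  shows "signed_shuffles k q Xs F = s ((- 1) ^ (k * q))
    (shuffle_sum s k q (map (\<lambda>X. (X, 1)) Xs) (\<lambda>A B. F (map fst A) (map fst B)))"
  unfolding signed_shuffles_def shuffle_sum_def scale_sum_right
proof (rule sum.cong[OF refl])
  fix \<sigma> assume "\<sigma> \<in> shuffle_perms k q"
  then have \<sigma>: "\<sigma> permutes {..<length Xs}" using shuffle_perms_permutes assms by simp
  have p: "permute_list \<sigma> (map (\<lambda>X. (X, 1::int)) Xs) = map (\<lambda>X. (X, 1)) (permute_list \<sigma> Xs)"
    by (rule permute_list_map[OF \<sigma>])
  have "sign \<sigma> = koszul_sign \<sigma> (map snd (map (\<lambda>X. (X, 1::int)) Xs))"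
    by (simp add: sign_eq_koszul_sign[OF \<sigma>] map_replicate_const comp_def)
  moreover have "map fst (map (\<lambda>X. (X, 1::int)) Ys) = Ys" for Ys :: "('v \<times> 'v) list"
    by (simp add: comp_def)
  ultimately show "s ((- 1) ^ (k * q) * of_int (sign \<sigma>)) (F (take k (permute_list \<sigma> Xs)) (drop k (permute_list \<sigma> Xs)))
    = s ((- 1) ^ (k * q)) (s (of_int (koszul_sign \<sigma> (map snd (map (\<lambda>X. (X, 1::int)) Xs))))
      (F (map fst (take k (permute_list \<sigma> (map (\<lambda>X. (X, 1::int)) Xs))))
         (map fst (drop k (permute_list \<sigma> (map (\<lambda>X. (X, 1::int)) Xs))))))"
    unfolding p take_map drop_map by simp
qed

lemma signed_shuffles_Nil: "signed_shuffles 0 0 Xs F = F [] (permute_list id Xs)"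
  by (simp add: signed_shuffles_def shuffle_perms_0_0)

lemma signed_shuffles_Cons:
  assumes "Suc (length Xs) = k + q"
  shows "signed_shuffles k q (X # Xs) F =
    (if k = 0 then 0 else s (parity_sign (int q)) (signed_shuffles (k - 1) q Xs (\<lambda>A B. F (X # A) B))) +
    (if q = 0 then 0 else signed_shuffles k (q - 1) Xs (\<lambda>A B. F A (X # B)))"
proof -
  let ?zs = "map (\<lambda>X. (X, 1::int)) Xs"
  let ?F = "\<lambda>A B. F (map fst A) (map fst B)"
  have 1: "s ((- 1) ^ (k * q)) (shuffle_sum s (k - 1) q ?zs (\<lambda>A B. F (X # map fst A) (map fst B)))
    = s (parity_sign (int q)) (signed_shuffles (k - 1) q Xs (\<lambda>A B. F (X # A) B))" if "k \<noteq> 0"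
  proof -
    have "(- 1) ^ (k * q) = (parity_sign (int q) * (- 1) ^ ((k - 1) * q) :: 'k)"
      using that by (cases k) (simp_all add: power_add minus_one_power_parity_sign)
    then show ?thesis
      using that assms by (subst signed_shuffles_eq) auto
  qed
  have 2: "s ((- 1) ^ (k * q)) (shuffle_sum s k (q - 1) ?zs
      (\<lambda>A B. s (parity_sign (1 * degree_sum A)) (F (map fst A) (X # map fst B))))
    = signed_shuffles k (q - 1) Xs (\<lambda>A B. F A (X # B))" if "q \<noteq> 0"
  proof -
    have "shuffle_sum s k (q - 1) ?zs
        (\<lambda>A B. s (parity_sign (1 * degree_sum A)) (F (map fst A) (X # map fst B)))
      = shuffle_sum s k (q - 1) ?zs (\<lambda>A B. s ((- 1) ^ k) (F (map fst A) (X # map fst B)))"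
    proof (rule shuffle_sum_cong)
      fix A B :: "(('v \<times> 'v) \<times> int) list" assume A: "length A = k" "set A \<subseteq> set ?zs"
      then have "map snd A = replicate k 1"
        by (intro replicate_eqI) auto
      then have "degree_sum A = int k"
        by (simp add: degree_sum_def sum_list_replicate)
      then show "s (parity_sign (1 * degree_sum A)) (F (map fst A) (X # map fst B))
        = s ((- 1) ^ k) (F (map fst A) (X # map fst B))"
        by (simp add: minus_one_power_parity_sign)
    qed (use that assms in auto)
    also have "\<dots> = s ((- 1) ^ k) (shuffle_sum s k (q - 1) ?zs (\<lambda>A B. F (map fst A) (X # map fst B)))"
      by (rule shuffle_sum_scale)
    finally have *: "shuffle_sum s k (q - 1) ?zs
        (\<lambda>A B. s (parity_sign (1 * degree_sum A)) (F (map fst A) (X # map fst B)))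
      = s ((- 1) ^ k) (shuffle_sum s k (q - 1) ?zs (\<lambda>A B. F (map fst A) (X # map fst B)))" .
    have "(- 1) ^ (k * q) * (- 1) ^ k = ((- 1) ^ (k * (q - 1)) :: 'k)"
      using that by (cases q) (simp_all add: power_add mult.commute flip: power_mult_distrib)
    then show ?thesis
      unfolding * using that assms by (subst signed_shuffles_eq) auto
  qed
  have "signed_shuffles k q (X # Xs) F = s ((- 1) ^ (k * q)) (shuffle_sum s k q ((X, 1) # ?zs) ?F)"
    using assms by (subst signed_shuffles_eq) auto
  also have "\<dots> = s ((- 1) ^ (k * q))
      ((if k = 0 then 0 else shuffle_sum s (k - 1) q ?zs (\<lambda>A B. F (X # map fst A) (map fst B))) +
       (if q = 0 then 0 else shuffle_sum s k (q - 1) ?zs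
         (\<lambda>A B. s (parity_sign (1 * degree_sum A)) (F (map fst A) (X # map fst B)))))"
    using assms by (subst shuffle_sum_Cons) auto
  finally show ?thesis using 1 2 by (auto simp: scale_right_distrib)
qed

text \<open>
  The two summands in which the value of \<open>Q\<close> replaces one component of the argument at position \<open>m\<close>;
  \<open>A\<close> and \<open>B\<close> are the arguments before it that go to \<open>P\<close> and to \<open>Q\<close>.
\<close>

definition insertion ::
    "nat \<Rightarrow> ('v, 'v) cochain \<Rightarrow> ('v, 'v) cochain \<Rightarrow> ('v \<times> 'v) list \<Rightarrow> 'v \<Rightarrow> ('v \<times> 'v) list \<Rightarrow> ('v \<times> 'v) list \<Rightarrow> 'v"
  where "insertion m P Q Xs z A B =
    P (A @ (Q B (fst (Xs ! m)), snd (Xs ! m)) # drop (Suc m) Xs) z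
    + P (A @ (fst (Xs ! m), Q B (snd (Xs ! m))) # drop (Suc m) Xs) z"

lemma lts_circ_eq:
  "lts_circ s p q P Q Xs z =
    (\<Sum>k<p. signed_shuffles k q (take (k + q) Xs) (insertion (k + q) P Q Xs z))
    + signed_shuffles p q Xs (\<lambda>A B. P A (Q B z))"
  by (simp add: lts_circ_def signed_shuffles_def insertion_def Let_def case_prod_beta
      scale_right_distrib sum.distrib)

lemma insertion_Cons:
  "insertion (Suc m) P Q (X # Xs) z (X # A) B = insertion m (slot X P) Q Xs z A B"
  "insertion (Suc m) P Q (X # Xs) z A (X # B) = insertion m P (slot X Q) Xs z A B"
  by (simp_all add: insertion_def slot_apply)

text \<open>
  The shuffle formula satisfies the recursion of \<open>circ\<close>. The first argument is replaced by a
  value of \<open>Q\<close> only in the summand \<open>k = 0\<close> with \<open>q = 0\<close>; in all other summands it takes part in the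
  shuffle and goes to \<open>P\<close> or to \<open>Q\<close>.
\<close>

lemma lts_circ_Cons:
  assumes "Suc (length Xs) = p + q"
  shows "lts_circ s p q P Q (X # Xs) z =
    (if p = 0 then 0 else s (parity_sign (int q)) (lts_circ s (p - 1) q (slot X P) Q Xs z)) +
    (if q = 0 then P ((Q [] (fst X), snd X) # Xs) z + P ((fst X, Q [] (snd X)) # Xs) z
     else lts_circ s p (q - 1) P (slot X Q) Xs z)"
proof -
  let ?e = "parity_sign (int q) :: 'k"
  have summand: "signed_shuffles k q (take (k + q) (X # Xs)) (insertion (k + q) P Q (X # Xs) z) =
      (if k = 0 then 0 else s ?e (signed_shuffles (k - 1) q (take (k - 1 + q) Xs)
        (insertion (k - 1 + q) (slot X P) Q Xs z))) +
      (if q = 0 then 0 else signed_shuffles k (q - 1) (take (k + (q - 1)) Xs)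
        (insertion (k + (q - 1)) P (slot X Q) Xs z))"
    if "k < p" "k + q = Suc m" for k m
  proof -
    have m: "k - 1 + q = m" if "k \<noteq> 0" using that \<open>k + q = Suc m\<close> by simp
    have m': "k + (q - 1) = m" if "q \<noteq> 0" using that \<open>k + q = Suc m\<close> by simp
    have "Suc (length (take m Xs)) = k + q" using that assms by simp
    from signed_shuffles_Cons[OF this, of X "insertion (k + q) P Q (X # Xs) z"]
    show ?thesis
      unfolding that(2) take_Suc_Cons insertion_Cons using m m' by auto
  qed
  have S: "(\<Sum>k<p. signed_shuffles k q (take (k + q) (X # Xs)) (insertion (k + q) P Q (X # Xs) z)) =
    (if p = 0 then 0 else s ?e (\<Sum>k<p - 1. signed_shuffles k q (take (k + q) Xs)
      (insertion (k + q) (slot X P) Q Xs z))) +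
    (if q = 0 then P ((Q [] (fst X), snd X) # Xs) z + P ((fst X, Q [] (snd X)) # Xs) z
     else (\<Sum>k<p. signed_shuffles k (q - 1) (take (k + (q - 1)) Xs)
        (insertion (k + (q - 1)) P (slot X Q) Xs z)))"
  proof (cases "p = 0")
    case True
    then show ?thesis using assms by auto
  next
    case False
    then obtain p' where p': "p = Suc p'" by (cases p) auto
    let ?G = "\<lambda>k. signed_shuffles k q (take (k + q) Xs) (insertion (k + q) (slot X P) Q Xs z)"
    let ?H = "\<lambda>k. signed_shuffles k (q - 1) (take (k + (q - 1)) Xs) (insertion (k + (q - 1)) P (slot X Q) Xs z)"
    show ?thesis
    proof (cases "q = 0")
      case True
      have "signed_shuffles (Suc k) q (take (Suc k + q) (X # Xs)) (insertion (Suc k + q) P Q (X # Xs) z)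
        = s ?e (?G k)" if "k < p'" for k
        using summand[of "Suc k" k] that p' True by simp
      then show ?thesis
        using True unfolding p' sum.lessThan_Suc_shift
        by (simp add: signed_shuffles_Nil insertion_def scale_sum_right)
    next
      case False
      have "(\<Sum>k<p. signed_shuffles k q (take (k + q) (X # Xs)) (insertion (k + q) P Q (X # Xs) z))
        = (\<Sum>k<p. (if k = 0 then 0 else s ?e (?G (k - 1))) + ?H k)"
      proof (rule sum.cong[OF refl])
        fix k assume "k \<in> {..<p}"
        then show "signed_shuffles k q (take (k + q) (X # Xs)) (insertion (k + q) P Q (X # Xs) z)
          = (if k = 0 then 0 else s ?e (?G (k - 1))) + ?H k"
          using summand[of k "k + q - 1"] False by simp
      qed
      also have "\<dots> = (\<Sum>k<p'. s ?e (?G k)) + (\<Sum>k<p. ?H k)"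
        unfolding sum.distrib by (simp add: p' sum.lessThan_Suc_shift del: sum.lessThan_Suc)
      finally show ?thesis using False p' by (simp add: scale_sum_right)
    qed
  qed
  have T: "signed_shuffles p q (X # Xs) (\<lambda>A B. P A (Q B z)) =
    (if p = 0 then 0 else s ?e (signed_shuffles (p - 1) q Xs (\<lambda>A B. slot X P A (Q B z)))) +
    (if q = 0 then 0 else signed_shuffles p (q - 1) Xs (\<lambda>A B. P A (slot X Q B z)))"
    unfolding slot_apply by (rule signed_shuffles_Cons[OF assms])
  show ?thesis
    unfolding lts_circ_eq S T by (simp add: scale_right_distrib add_ac)
qed

theorem lts_circ_eq_circ:
  assumes "multilinear P" "homogeneous (int p) P" "homogeneous (int q) Q" "length Xs = p + q"
  shows "lts_circ s p q P Q Xs z = circ P Q Xs z"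
  using assms
proof (induction Xs arbitrary: P Q p q)
  case Nil
  then show ?case by (simp add: lts_circ_eq signed_shuffles_Nil)
next
  case (Cons X Xs)
  note P = Cons.prems(1,2) and Q = Cons.prems(3)
  have len: "Suc (length Xs) = p + q" using Cons.prems(4) by simp
  have 1: "circ (slot X P) (alternate Q) Xs z
    = (if p = 0 then 0 else s (parity_sign (int q)) (lts_circ s (p - 1) q (slot X P) Q Xs z))"
  proof (cases "p = 0")
    case True
    then have "slot X P = (\<lambda>Xs z. 0)" using P(2) by (simp add: homogeneous_def slot_def)
    then show ?thesis using True by simp
  next
    case False
    then have "homogeneous (int (p - 1)) (slot X P)"
      using homogeneous_slot[OF P(2), of X] by (simp add: of_nat_diff)
    then have "lts_circ s (p - 1) q (slot X P) Q Xs z = circ (slot X P) Q Xs z"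
      using False len by (intro Cons.IH[OF multilinear_slot[OF P(1)] _ Q]) auto
    then show ?thesis using False by (simp add: circ_alternate_right[OF multilinear_slot[OF P(1)] Q])
  qed
  show ?case
  proof (cases "q = 0")
    case True
    then have "slot X Q = (\<lambda>Xs z. 0)" using Q by (simp add: homogeneous_def slot_def)
    then show ?thesis
      unfolding lts_circ_Cons[OF len] circ.simps 1 using True by (simp add: circ_0_right[OF P(1)])
  next
    case False
    then have "homogeneous (int (q - 1)) (slot X Q)"
      using homogeneous_slot[OF Q, of X] by (simp add: of_nat_diff)
    then have "lts_circ s p (q - 1) P (slot X Q) Xs z = circ P (slot X Q) Xs z"
      using False len by (intro Cons.IH[OF P]) auto
    moreover have "Q [] w = 0" for w using Q False by (auto simp: homogeneous_def)
    then have "P ((Q [] (fst X), snd X) # Xs) z = 0" "P ((fst X, Q [] (snd X)) # Xs) z = 0"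
      by (simp_all add: lin_0[OF multilinear_head(1)[OF P(1)]] lin_0[OF multilinear_head(2)[OF P(1)]])
    ultimately show ?thesis
      unfolding lts_circ_Cons[OF len] circ.simps 1 using False by simp
  qed
qed

end

section \<open>The graded Lie algebra of cochains\<close>

context multilinear_cochains
begin

lemma lts_circ_cut:
  assumes "length Xs = p + q"
  shows "lts_circ s p q P Q Xs z = lts_circ s p q (cut p P) (cut q Q) Xs z"
  unfolding lts_circ_eq
proof (rule arg_cong2[where f = "(+)"])
  show "(\<Sum>k<p. signed_shuffles k q (take (k + q) Xs) (insertion (k + q) P Q Xs z))
    = (\<Sum>k<p. signed_shuffles k q (take (k + q) Xs) (insertion (k + q) (cut p P) (cut q Q) Xs z))"
    using assms by (intro sum.cong refl) (simp add: signed_shuffles_def insertion_def cut_def min_def)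
  show "signed_shuffles p q Xs (\<lambda>A B. P A (Q B z))
    = signed_shuffles p q Xs (\<lambda>A B. cut p P A (cut q Q B z))"
    using assms by (simp add: signed_shuffles_def cut_def)
qed

lemma multilinear_cut: "multilinear P \<Longrightarrow> multilinear (cut n P)"
  unfolding multilinear_def cut_def by (auto simp: lin_def)

text \<open>
  The bracket of arbitrary cochains is reduced to homogeneous components, so that the properties of
  \<open>bracket\<close> carry over.
\<close>

lemma lts_bracket_eq_sum:
  assumes "multilinear P" "multilinear Q"
  shows "lts_bracket s P Q Xs z =
    (\<Sum>p\<le>length Xs. bracket (int p) (int (length Xs - p)) (cut p P) (cut (length Xs - p) Q) Xs z)"
  unfolding lts_bracket_def
proof (rule sum.cong[OF refl])
  fix p assume p: "p \<in> {..length Xs}"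
  let ?q = "length Xs - p"
  note P = multilinear_cut[OF assms(1)] and Q = multilinear_cut[OF assms(2)]
  have "lts_circ s p ?q P Q Xs z = circ (cut p P) (cut ?q Q) Xs z"
    using p by (subst lts_circ_cut) (simp_all add: lts_circ_eq_circ[OF P homogeneous_cut homogeneous_cut])
  moreover have "lts_circ s ?q p Q P Xs z = circ (cut ?q Q) (cut p P) Xs z"
    using p by (subst lts_circ_cut) (simp_all add: lts_circ_eq_circ[OF Q homogeneous_cut homogeneous_cut])
  moreover have "(- 1) ^ (p * ?q) = (parity_sign (int p * int ?q) :: 'k)"
    by (metis minus_one_power_parity_sign of_nat_mult)
  ultimately show "lts_bracket_deg s p ?q P Q Xs z
    = bracket (int p) (int ?q) (cut p P) (cut ?q Q) Xs z"
    by (simp add: lts_bracket_deg_def bracket_def lincomb_apply)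
qed

lemma cut_homogeneous:
  assumes "homogeneous p P"
  shows "cut n P = (if int n = p then P else (\<lambda>Xs z. 0))"
proof (intro ext)
  show "cut n P Xs z = (if int n = p then P else (\<lambda>Xs z. 0)) Xs z" for Xs z
    using assms unfolding homogeneous_def cut_def by (cases "length Xs = n") auto
qed

lemma homogeneous_negative: "homogeneous p P \<Longrightarrow> p < 0 \<Longrightarrow> P = (\<lambda>Xs z. 0)"
  by (auto simp: homogeneous_def fun_eq_iff)

lemma bracket_0:
  "multilinear P \<Longrightarrow> bracket p q P (\<lambda>Xs z. 0) Xs z = 0"
  "multilinear P \<Longrightarrow> bracket p q (\<lambda>Xs z. 0) P Xs z = 0"
  by (simp_all add: bracket_def lincomb_apply circ_0_right)

lemma bracket_antisym:
  "bracket p q P Q = - cochain_scale s (parity_sign (p * q)) (bracket q p Q P)"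
proof (intro ext)
  fix Xs z
  have "bracket p q P Q Xs z = - s (parity_sign (p * q)) (bracket q p Q P Xs z)"
    unfolding bracket_def lincomb_apply
    by (cases "even p"; cases "even q") (simp_all add: parity_sign_def)
  then show "bracket p q P Q Xs z = (- cochain_scale s (parity_sign (p * q)) (bracket q p Q P)) Xs z"
    unfolding cochain_scale_def by (simp only: uminus_apply)
qed

lemma lts_bracket_eq_bracket:
  assumes "multilinear P" "multilinear Q" "homogeneous p P" "homogeneous q Q"
  shows "lts_bracket s P Q = bracket p q P Q"
proof (intro ext)
  fix Xs :: "('v \<times> 'v) list" and z
  let ?n = "length Xs"
  let ?t = "\<lambda>i. bracket (int i) (int (?n - i)) (cut i P) (cut (?n - i) Q) Xs z"
  have lts: "lts_bracket s P Q Xs z = (\<Sum>i\<le>?n. ?t i)"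
    by (rule lts_bracket_eq_sum[OF assms(1,2)])
  have c0: "multilinear (cut i P)" "multilinear (cut i Q)" for i
    using assms by (auto intro: multilinear_cut)
  show "lts_bracket s P Q Xs z = bracket p q P Q Xs z"
  proof (cases "int ?n = p + q \<and> p \<ge> 0 \<and> q \<ge> 0")
    case True
    then obtain p' q' where pq: "p = int p'" "q = int q'" "?n = p' + q'"
      by (metis nonneg_int_cases of_nat_add of_nat_eq_iff)
    have "(\<Sum>i\<le>?n. ?t i) = (\<Sum>i\<in>{p'}. ?t i)"
    proof (rule sum.mono_neutral_right)
      show "\<forall>i\<in>{..?n} - {p'}. ?t i = 0"
        using assms(3) by (simp add: pq(1) cut_homogeneous bracket_0 c0)
    qed (use pq in auto)
    also have "\<dots> = bracket p q P Q Xs z"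
      using assms(3,4) pq by (simp add: cut_homogeneous)
    finally show ?thesis using lts by simp
  next
    case False
    have "?t i = 0" if "i \<le> ?n" for i
    proof -
      have "cut i P = (\<lambda>Xs z. 0) \<or> cut (?n - i) Q = (\<lambda>Xs z. 0)"
      proof (rule ccontr)
        assume "\<not> ?thesis"
        then have "int i = p" "int (?n - i) = q"
          using cut_homogeneous[OF assms(3), of i] cut_homogeneous[OF assms(4), of "?n - i"] by presburger+
        then show False using False that by auto
      qed
      then show ?thesis using bracket_0 c0 by auto
    qed
    then have "lts_bracket s P Q Xs z = 0" unfolding lts by simp
    moreover have "bracket p q P Q Xs z = 0"
    proof (cases "int ?n = p + q")
      case True
      with False have "p < 0 \<or> q < 0" by auto
      then show ?thesis
        using homogeneous_negative[OF assms(3)] homogeneous_negative[OF assms(4)] bracket_0 assms(1,2)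
        by auto
    next
      case False
      then show ?thesis using homogeneous_bracket[OF assms] by (simp add: homogeneous_def)
    qed
    ultimately show ?thesis by simp
  qed
qed

lemma admissible_lts_bracket:
  assumes "admissible P" "admissible Q"
  shows "admissible (lts_bracket s P Q)"
proof -
  let ?R = "\<lambda>n Xs z. \<Sum>p\<le>n. bracket (int p) (int (n - p)) (cut p P) (cut (n - p) Q) Xs z"
  have eq: "lts_bracket s P Q = (\<lambda>Xs. ?R (length Xs) Xs)"
    by (intro ext lts_bracket_eq_sum admissible_multilinear assms)
  show ?thesis
    unfolding eq
    by (rule admissible_by_length[of ?R]) (intro admissible_sum admissible_bracket admissible_cut assms)
qed

lemma cut_lincomb: "cut n (lincomb a P b Q) = lincomb a (cut n P) b (cut n Q)"
  by (simp add: cut_def lincomb_def fun_eq_iff)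

lemma bracket_lincomb_left:
  "multilinear Q \<Longrightarrow> bracket p q (lincomb a P b P') Q Xs z
    = s a (bracket p q P Q Xs z) + s b (bracket p q P' Q Xs z)"
  by (simp add: bracket_def lincomb_apply[of 1] lincomb_apply[of _ _ "- _"] circ_lincomb_left circ_lincomb_right
    scale_right_distrib scale_right_diff_distrib mult.commute)

lemma bracket_lincomb_right:
  "multilinear P \<Longrightarrow> bracket p q P (lincomb a Q b Q') Xs z
    = s a (bracket p q P Q Xs z) + s b (bracket p q P Q' Xs z)"
  by (simp add: bracket_def lincomb_apply[of 1] circ_lincomb_left circ_lincomb_right
    scale_right_distrib scale_right_diff_distrib mult.commute)

lemma lts_bracket_lincomb_left:
  assumes "multilinear P" "multilinear P'" "multilinear Q"
  shows "lts_bracket s (lincomb a P b P') Q = lincomb a (lts_bracket s P Q) b (lts_bracket s P' Q)"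
proof (intro ext)
  show "lts_bracket s (lincomb a P b P') Q Xs z
    = lincomb a (lts_bracket s P Q) b (lts_bracket s P' Q) Xs z" for Xs z
    using assms
    by (simp add: lincomb_apply[of _ "lts_bracket s P Q"] lts_bracket_eq_sum multilinear_lincomb cut_lincomb
      bracket_lincomb_left multilinear_cut sum.distrib scale_sum_right)
qed

lemma lts_bracket_lincomb_right:
  assumes "multilinear P" "multilinear Q" "multilinear Q'"
  shows "lts_bracket s P (lincomb a Q b Q') = lincomb a (lts_bracket s P Q) b (lts_bracket s P Q')"
proof (intro ext)
  show "lts_bracket s P (lincomb a Q b Q') Xs z
    = lincomb a (lts_bracket s P Q) b (lts_bracket s P Q') Xs z" for Xs z
    using assms
    by (simp add: lincomb_apply[of _ "lts_bracket s P Q"] lts_bracket_eq_sum multilinear_lincomb cut_lincomb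
      bracket_lincomb_right multilinear_cut sum.distrib scale_sum_right)
qed

lemma add_eq_lincomb: "P + Q = lincomb 1 P 1 Q"
  by (simp add: fun_eq_iff lincomb_apply)

lemma cochain_scale_eq_lincomb: "cochain_scale s c P = lincomb c P 0 P"
  by (simp add: fun_eq_iff lincomb_apply cochain_scale_def)

lemma vector_space_cochain_scale: "vector_space (cochain_scale s :: 'k \<Rightarrow> ('v, 'v) cochain \<Rightarrow> _)"
  by unfold_locales (simp_all add: cochain_scale_def fun_eq_iff scale_right_distrib scale_left_distrib)

lemma subspace_cochains:
  assumes "S (\<lambda>Xs z. 0)" "\<And>P Q a b. S P \<Longrightarrow> S Q \<Longrightarrow> S (lincomb a P b Q)"
  shows "module.subspace (cochain_scale s) {P. S P}"
proof -
  interpret C: vector_space "cochain_scale s :: 'k \<Rightarrow> ('v, 'v) cochain \<Rightarrow> _"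
    by (rule vector_space_cochain_scale)
  have "(0 :: ('v, 'v) cochain) = (\<lambda>Xs z. 0)" by (simp add: fun_eq_iff)
  then show ?thesis
    using assms by (intro C.subspaceI) (auto simp: add_eq_lincomb cochain_scale_eq_lincomb)
qed

lemma graded_lie_algebra_cochains:
  "graded_lie_algebra (cochain_scale s) {P. admissible P}
    (\<lambda>d. {P. admissible P \<and> homogeneous d P}) (lts_bracket s)"
proof -
  interpret C: vector_space "cochain_scale s :: 'k \<Rightarrow> ('v, 'v) cochain \<Rightarrow> _"
    by (rule vector_space_cochain_scale)
  have hom: "homogeneous d (lincomb a P b Q)" if "homogeneous d P" "homogeneous d Q" for d a P b Q
    using that by (simp add: homogeneous_def lincomb_apply)
  have mul: "multilinear P" if "P \<in> {P. admissible P}" for P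
    using that by (simp add: admissible_multilinear)
  have eq: "lts_bracket s P Q = bracket p q P Q"
    if "P \<in> {P. admissible P \<and> homogeneous p P}" "Q \<in> {P. admissible P \<and> homogeneous q P}" for p q P Q
    using that by (simp add: lts_bracket_eq_bracket admissible_multilinear)
  have deg: "bracket p q P Q \<in> {P. admissible P \<and> homogeneous (p + q) P}"
    if "P \<in> {P. admissible P \<and> homogeneous p P}" "Q \<in> {P. admissible P \<and> homogeneous q P}" for p q P Q
    using that by (simp add: admissible_bracket homogeneous_bracket admissible_multilinear)
  have antisym: "lts_bracket s P Q = - cochain_scale s (parity_sign (p * q)) (lts_bracket s Q P)"
    if "P \<in> {P. admissible P \<and> homogeneous p P}" "Q \<in> {P. admissible P \<and> homogeneous q P}" for p q P Q
    using bracket_antisym[of p q P Q] by (simp only: eq[OF that] eq[OF that(2,1)])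
  have jacobi: "lts_bracket s (lts_bracket s P Q) R = lts_bracket s P (lts_bracket s Q R)
      + cochain_scale s (parity_sign (q * r)) (lts_bracket s (lts_bracket s P R) Q)"
    if P: "P \<in> {P. admissible P \<and> homogeneous p P}" and Q: "Q \<in> {P. admissible P \<and> homogeneous q P}"
      and R: "R \<in> {P. admissible P \<and> homogeneous r P}" for p q r P Q R
  proof -
    have "lts_bracket s (lts_bracket s P Q) R = bracket (p + q) r (bracket p q P Q) R"
      using eq[OF deg[OF P Q] R] by (simp only: eq[OF P Q])
    moreover have "lts_bracket s P (lts_bracket s Q R) = bracket p (q + r) P (bracket q r Q R)"
      using eq[OF P deg[OF Q R]] by (simp only: eq[OF Q R])
    moreover have "lts_bracket s (lts_bracket s P R) Q = bracket (p + r) q (bracket p r P R) Q"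
      using eq[OF deg[OF P R] Q] by (simp only: eq[OF P R])
    moreover have "bracket (p + q) r (bracket p q P Q) R = bracket p (q + r) P (bracket q r Q R)
      + cochain_scale s (parity_sign (q * r)) (bracket (p + r) q (bracket p r P R) Q)"
    proof (intro ext)
      fix Xs z
      show "bracket (p + q) r (bracket p q P Q) R Xs z = (bracket p (q + r) P (bracket q r Q R)
        + cochain_scale s (parity_sign (q * r)) (bracket (p + r) q (bracket p r P R) Q)) Xs z"
        unfolding plus_fun_apply cochain_scale_def
        using P Q R by (intro bracket_jacobi) (simp_all add: admissible_multilinear)
    qed
    ultimately show ?thesis by (simp only:)
  qed
  show ?thesis
  proof unfold_locales
    show "C.subspace {P. admissible P}"
      by (rule subspace_cochains) (auto simp: admissible_0 admissible_lincomb)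
    show "C.subspace {P. admissible P \<and> homogeneous d P}" for d
      by (rule subspace_cochains) (auto simp: admissible_0 admissible_lincomb hom, simp add: homogeneous_def)
  next
    fix P P' Q :: "('v, 'v) cochain" and c
    assume P: "P \<in> {P. admissible P}" and Q: "Q \<in> {P. admissible P}"
    show "lts_bracket s P Q \<in> {P. admissible P}" using P Q by (simp add: admissible_lts_bracket)
    show "lts_bracket s (cochain_scale s c P) Q = cochain_scale s c (lts_bracket s P Q)"
      "lts_bracket s P (cochain_scale s c Q) = cochain_scale s c (lts_bracket s P Q)"
      unfolding cochain_scale_eq_lincomb
      by (simp_all add: lts_bracket_lincomb_left lts_bracket_lincomb_right mul[OF P] mul[OF Q])
    assume P': "P' \<in> {P. admissible P}"
    show "lts_bracket s (P + P') Q = lts_bracket s P Q + lts_bracket s P' Q"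
      "lts_bracket s Q (P + P') = lts_bracket s Q P + lts_bracket s Q P'"
      unfolding add_eq_lincomb
      by (simp_all add: lts_bracket_lincomb_left lts_bracket_lincomb_right mul[OF P] mul[OF Q] mul[OF P'])
  next
    fix P Q p q
    assume PQ: "P \<in> {P. admissible P \<and> homogeneous p P}" "Q \<in> {P. admissible P \<and> homogeneous q P}"
    show "lts_bracket s P Q \<in> {P. admissible P \<and> homogeneous (p + q) P}"
      unfolding eq[OF PQ] by (rule deg[OF PQ])
    show "lts_bracket s P Q = - cochain_scale s (parity_sign (p * q)) (lts_bracket s Q P)"
      by (rule antisym[OF PQ])
    fix R r assume R: "R \<in> {P. admissible P \<and> homogeneous r P}"
    show "lts_bracket s (lts_bracket s P Q) R = lts_bracket s P (lts_bracket s Q R)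
      + cochain_scale s (parity_sign (q * r)) (lts_bracket s (lts_bracket s P R) Q)"
      by (rule jacobi[OF PQ R])
  qed auto
qed

end

section \<open>Filtrations\<close>

text \<open>
  \<open>U k\<close> is to be thought of as the part of weight at most \<open>k\<close>. Filtrations are used instead of gradings
  so that arguments need not be decomposed into homogeneous components.
\<close>

locale filtered_cochains = multilinear_cochains s
  for s :: "'k::field \<Rightarrow> 'v::ab_group_add \<Rightarrow> 'v" +
  fixes U :: "int \<Rightarrow> 'v set"
  assumes subspace_U: "subspace (U k)"
begin

text \<open>
  The pairs in \<open>cs\<close> and the number \<open>c\<close> bound the weights of the arguments.
\<close>

definition filtered :: "int \<Rightarrow> ('v, 'v) cochain \<Rightarrow> bool"
  where "filtered w P \<longleftrightarrow> (\<forall>Xs z cs c.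
    list_all2 (\<lambda>X C. fst X \<in> U (fst C) \<and> snd X \<in> U (snd C)) Xs cs \<and> z \<in> U c \<longrightarrow>
    P Xs z \<in> U (w + (\<Sum>C\<leftarrow>cs. fst C + snd C) + c))"

lemma filteredD:
  assumes "filtered w P" "list_all2 (\<lambda>X C. fst X \<in> U (fst C) \<and> snd X \<in> U (snd C)) Xs cs" "z \<in> U c"
    "w' = w + (\<Sum>C\<leftarrow>cs. fst C + snd C) + c"
  shows "P Xs z \<in> U w'"
  using assms unfolding filtered_def by blast

lemma filtered_slot:
  assumes "filtered w P" "x \<in> U a" "y \<in> U b"
  shows "filtered (w + a + b) (slot (x, y) P)"
  unfolding filtered_def
proof (intro allI impI, elim conjE)
  fix Xs z cs c
  assume "list_all2 (\<lambda>X C. fst X \<in> U (fst C) \<and> snd X \<in> U (snd C)) Xs cs" "z \<in> U c"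
  then show "slot (x, y) P Xs z \<in> U (w + a + b + (\<Sum>C\<leftarrow>cs. fst C + snd C) + c)"
    unfolding slot_apply
    using assms(2,3) by (intro filteredD[OF assms(1), where cs="(a, b) # cs"]) auto
qed

lemma filtered_lincomb: "filtered w P \<Longrightarrow> filtered w Q \<Longrightarrow> filtered w (lincomb a P b Q)"
  unfolding filtered_def lincomb_apply
  by (auto intro!: subspace_add[OF subspace_U] subspace_scale[OF subspace_U])

lemma filtered_alternate: "filtered w P \<Longrightarrow> filtered w (alternate P)"
  unfolding filtered_def alternate_apply by (auto intro!: subspace_scale[OF subspace_U])

lemma filtered_0: "filtered w (\<lambda>Xs z. 0)"
  unfolding filtered_def by (simp add: subspace_0[OF subspace_U])

text \<open>
  A cochain of weight \<open>w\<close> with its first slot filled has the weight of the argument added to \<open>w\<close>, and \<open>Q\<close>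
  applied to an argument raises its weight by \<open>w'\<close>; hence all summands of the recursion have the
  same weight.
\<close>

lemma filtered_circ:
  assumes "filtered w P" "filtered w' Q"
  shows "filtered (w + w') (circ P Q)"
proof -
  have "circ P Q Xs z \<in> U (w + w' + (\<Sum>C\<leftarrow>cs. fst C + snd C) + c)"
    if "list_all2 (\<lambda>X C. fst X \<in> U (fst C) \<and> snd X \<in> U (snd C)) Xs cs" "z \<in> U c" for Xs z cs c
    using that assms
  proof (induction Xs arbitrary: cs P Q w w')
    case Nil
    have "Q [] z \<in> U (w' + c)" using Nil by (intro filteredD[OF Nil(4), where cs="[]"]) auto
    then show ?case using Nil by (auto intro!: filteredD[OF Nil(3), where cs="[]"])
  next
    case (Cons X Xs)
    note P = Cons.prems(3) and Q = Cons.prems(4)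
    obtain C cs' where cs: "cs = C # cs'" using Cons.prems(1) by (cases cs) auto
    obtain x y a b where X: "X = (x, y)" and C: "C = (a, b)" by (cases X, cases C)
    have xy: "x \<in> U a" "y \<in> U b"
      and l: "list_all2 (\<lambda>X C. fst X \<in> U (fst C) \<and> snd X \<in> U (snd C)) Xs cs'"
      using Cons.prems(1) by (simp_all add: cs X C)
    have Q0: "Q [] u \<in> U (w' + d)" if "u \<in> U d" for u d
      using that by (intro filteredD[OF Q, where cs="[]"]) auto
    have 1: "circ (slot X P) (alternate Q) Xs z \<in> U (w + w' + (\<Sum>C\<leftarrow>cs. fst C + snd C) + c)"
      using Cons.IH[OF l Cons.prems(2) filtered_slot[OF P xy] filtered_alternate[OF Q]]
      by (simp add: X C cs add_ac)
    have 2: "circ P (slot X Q) Xs z \<in> U (w + w' + (\<Sum>C\<leftarrow>cs. fst C + snd C) + c)"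
      using Cons.IH[OF l Cons.prems(2) P filtered_slot[OF Q xy]]
      by (simp add: X C cs add_ac)
    have 3: "P ((Q [] x, y) # Xs) z \<in> U (w + w' + (\<Sum>C\<leftarrow>cs. fst C + snd C) + c)"
      using xy l Cons.prems(2) Q0 by (intro filteredD[OF P, where cs="(w' + a, b) # cs'"]) (auto simp: cs C)
    have 4: "P ((x, Q [] y) # Xs) z \<in> U (w + w' + (\<Sum>C\<leftarrow>cs. fst C + snd C) + c)"
      using xy l Cons.prems(2) Q0 by (intro filteredD[OF P, where cs="(a, w' + b) # cs'"]) (auto simp: cs C)
    show ?case
      using 1 2 3 4 by (simp add: X subspace_add[OF subspace_U])
  qed
  then show ?thesis by (simp add: filtered_def)
qed

lemma filtered_bracket:
  assumes "filtered w P" "filtered w' Q"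
  shows "filtered (w + w') (bracket p q P Q)"
  unfolding bracket_def
  using filtered_circ[OF assms] filtered_circ[OF assms(2,1)] by (intro filtered_lincomb) (simp_all add: add.commute)

end

section \<open>Trilinear maps as cochains of degree one\<close>

lemma cochain1_eq_0: "length Xs \<noteq> 1 \<Longrightarrow> cochain1 f Xs z = 0"
  by (auto simp: cochain1_def split: list.split)

lemma cochain1_single [simp]: "cochain1 f [X] z = f (fst X) (snd X) z"
  by (cases X) (simp add: cochain1_def)

lemma homogeneous_cochain1: "homogeneous 1 (cochain1 f)"
  by (simp add: homogeneous_def cochain1_eq_0)

context multilinear_cochains
begin

lemma admissible_cochain1:
  assumes "\<And>y z. lin (\<lambda>x. f x y z)" "\<And>x z. lin (\<lambda>y. f x y z)" "\<And>x y. lin (f x y)"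
    and "\<And>x z. f x x z = 0" "\<And>x y z. f x y z + f y z x + f z x y = 0"
  shows "admissible (cochain1 f)"
proof -
  have lin_zero: "lin (\<lambda>x. 0)" by (simp add: lin_def)
  have "lin (cochain1 f Xs)" for Xs
  proof (cases "length Xs = 1")
    case True
    then obtain X where "Xs = [X]" by (cases Xs) auto
    then have "cochain1 f Xs = f (fst X) (snd X)" by (simp add: fun_eq_iff)
    then show ?thesis using assms(3) by simp
  next
    case False
    then have "cochain1 f Xs = (\<lambda>z. 0)" by (simp add: fun_eq_iff cochain1_eq_0)
    then show ?thesis using lin_zero by simp
  qed
  moreover have "lin (\<lambda>x. cochain1 f (Xs[i := (x, y)]) z) \<and> lin (\<lambda>y. cochain1 f (Xs[i := (x, y)]) z)
      \<and> cochain1 f (Xs[i := (x, x)]) z = 0" if "i < length Xs" for Xs i x y z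
  proof (cases "length Xs = 1")
    case True
    then obtain X where "Xs = [X]" by (cases Xs) auto
    then show ?thesis using that assms by simp
  next
    case False
    then show ?thesis by (simp add: cochain1_eq_0 lin_zero)
  qed
  moreover have "cochain1 f (Xs @ [(x, y)]) z + cochain1 f (Xs @ [(y, z)]) x + cochain1 f (Xs @ [(z, x)]) y = 0"
    for Xs x y z
    using assms(5) by (cases Xs) (simp_all add: cochain1_eq_0)
  ultimately show ?thesis
    by (simp add: admissible_def multilinear_def alternating_def cyclic_def)
qed

lemma circ_cochain1:
  assumes "lin (f x1 x2)"
  shows "circ (cochain1 f) (cochain1 g) [(x1, x2), (y1, y2)] z
    = f (g x1 x2 y1) y2 z + f y1 (g x1 x2 y2) z - f x1 x2 (g y1 y2 z) + f y1 y2 (g x1 x2 z)"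
proof -
  have "f x1 x2 (- g y1 y2 z) = - f x1 x2 (g y1 y2 z)"
    using linD[OF assms, of "- 1" "g y1 y2 z" 0 0] by simp
  then show ?thesis by (simp add: slot_apply alternate_apply cochain1_eq_0 parity_sign_def)
qed

lemma lts_bracket_cochain1_eq_0:
  assumes "admissible (cochain1 f)" "admissible (cochain1 g)"
    and "\<And>x1 x2 y1 y2 z.
      (f (g x1 x2 y1) y2 z + f y1 (g x1 x2 y2) z - f x1 x2 (g y1 y2 z) + f y1 y2 (g x1 x2 z))
      + (g (f x1 x2 y1) y2 z + g y1 (f x1 x2 y2) z - g x1 x2 (f y1 y2 z) + g y1 y2 (f x1 x2 z)) = 0"
  shows "lts_bracket s (cochain1 f) (cochain1 g) = 0"
proof -
  note ml = assms(1,2)[THEN admissible_multilinear]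
  have lin: "lin (f x y)" "lin (g x y)" for x y
    using multilinear_last[OF ml(1), of "[(x, y)]"] multilinear_last[OF ml(2), of "[(x, y)]"]
    by (simp_all add: lin_def)
  have "bracket 1 1 (cochain1 f) (cochain1 g) Xs z = 0" for Xs z
  proof (cases "length Xs = 2")
    case True
    then obtain x1 x2 y1 y2 where "Xs = [(x1, x2), (y1, y2)]"
      by (auto simp: numeral_2_eq_2 length_Suc_conv)
    moreover have "- parity_sign (1 * 1) = (1 :: 'k)" by (simp add: parity_sign_def)
    ultimately show ?thesis
      unfolding bracket_def lincomb_apply
      using assms(3)[of x1 x2 y1 y2 z] by (simp only: circ_cochain1[OF lin(1)] circ_cochain1[OF lin(2)] scale_one)
  next
    case False
    then show ?thesis
      using homogeneous_bracket[OF ml homogeneous_cochain1 homogeneous_cochain1]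
      by (simp add: homogeneous_def)
  qed
  then show ?thesis
    unfolding lts_bracket_eq_bracket[OF ml homogeneous_cochain1 homogeneous_cochain1]
    by (simp add: fun_eq_iff)
qed

end

section \<open>Cochains on a direct sum\<close>

lemmas linear_addD = module_hom.add[OF Vector_Spaces.linear.axioms(3)]
lemmas linear_scaleD = module_hom.scale[OF Vector_Spaces.linear.axioms(3)]
lemmas linear_zeroD = module_hom.zero[OF Vector_Spaces.linear.axioms(3)]
lemmas linear_diffD = module_hom.diff[OF Vector_Spaces.linear.axioms(3)]

lemma linear_iff_lincomb:
  assumes "vector_space s1" "vector_space s2"
  shows "Vector_Spaces.linear s1 s2 f \<longleftrightarrow> (\<forall>a b x y. f (s1 a x + s1 b y) = s2 a (f x) + s2 b (f y))"
proof
  interpret V: vector_space s1 by fact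
  interpret W: vector_space s2 by fact
  assume f: "\<forall>a b x y. f (s1 a x + s1 b y) = s2 a (f x) + s2 b (f y)"
  have "f (x + y) = f x + f y" for x y
    using f[rule_format, of 1 x 1 y] by simp
  moreover have "f (s1 c x) = s2 c (f x)" for c x
    using f[rule_format, of c x 0 0] by simp
  ultimately show "Vector_Spaces.linear s1 s2 f"
    unfolding Vector_Spaces.linear_iff using assms by blast
qed (simp add: linear_addD linear_scaleD)

locale two_spaces = L: vector_space sL + M: vector_space sM
  for sL :: "'k::field \<Rightarrow> 'l::ab_group_add \<Rightarrow> 'l"
    and sM :: "'k \<Rightarrow> 'm::ab_group_add \<Rightarrow> 'm"
begin

abbreviation sV :: "'k \<Rightarrow> 'l \<times> 'm \<Rightarrow> 'l \<times> 'm"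
  where "sV \<equiv> module_prod.scale sL sM"

lemma vector_space_prod: "vector_space_prod sL sM"
  by unfold_locales

lemma sV_eq: "sV c v = (sL c (fst v), sM c (snd v))"
proof -
  interpret vector_space_prod sL sM by (rule vector_space_prod)
  show ?thesis by (rule scale_def)
qed

lemma vector_space_sV: "vector_space sV"
proof -
  interpret vector_space_prod sL sM by (rule vector_space_prod)
  show ?thesis by (rule p.vector_space_axioms)
qed

text \<open>
  \<open>L\<close> has weight 0 and \<open>M\<close> weight 1.
\<close>

definition U :: "int \<Rightarrow> ('l \<times> 'm) set"
  where "U k = (if k < 0 then {0} else if k = 0 then {v. snd v = 0} else UNIV)"

sublocale V: filtered_cochains sV U
proof -
  interpret vector_space sV by (rule vector_space_sV)
  show "filtered_cochains sV U"
  proof unfold_locales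
    show "subspace (U k)" for k
      by (rule subspaceI) (auto simp: U_def sV_eq zero_prod_def split: if_splits)
  qed
qed

text \<open>
  With all arguments of weight at most 1, the value of \<open>P\<close> has weight at most 0 and so lies in \<open>L\<close>. As soon
  as one argument lies in \<open>L\<close>, the value has negative weight and vanishes; hence every argument may be
  replaced by its component in \<open>M\<close>.
\<close>

lemma cochains_eq_extend_fst:
  assumes "V.admissible P" "V.filtered (- (2 * int n + 1)) P" "length Xs = n"
  shows "P Xs z = (fst (P (map (map_prod (Pair 0) (Pair 0)) (map (map_prod snd snd) Xs)) (0, snd z)), 0)"
proof -
  let ?p = "\<lambda>v :: 'l \<times> 'm. (0 :: 'l, snd v)"
  let ?ps = "map (map_prod ?p ?p)"
  have U1: "v \<in> U 1" and U0: "v - ?p v \<in> U 0" for v by (simp_all add: U_def)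
  have ones: "list_all2 (\<lambda>X C. fst X \<in> U (fst C) \<and> snd X \<in> U (snd C)) Ys (replicate (length Ys) (1, 1))" for Ys
    by (simp add: list_all2_conv_all_nth U1)
  have sum_ones: "(\<Sum>C\<leftarrow>replicate m (1, 1). fst C + snd C) = 2 * int m" for m
    by (simp add: sum_list_replicate)
  have proj: "P Xs z = P (?ps Xs) (?p z)"
    if "V.multilinear P" "V.filtered (- (2 * int (length Xs) + 1)) P" for P Xs z
    using that
  proof (induction Xs arbitrary: P)
    case Nil
    have "P [] (z - ?p z) \<in> U (-1)"
      by (rule V.filteredD[OF Nil(2), where cs="[]" and c=0]) (simp_all add: U0)
    then have "P [] (z - ?p z) = 0" by (simp add: U_def)
    moreover have "P [] (z - ?p z + ?p z) = P [] (z - ?p z) + P [] (?p z)"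
      by (rule V.lin_add[OF V.multilinear_last[OF Nil(1)]])
    ultimately show ?case by simp
  next
    case (Cons X Xs)
    obtain x y where X: "X = (x, y)" by (cases X)
    note P = Cons.prems
    have fl: "V.filtered (- (2 * int (length Xs) + 1)) (slot X P)"
      using V.filtered_slot[OF P(2) U1 U1, of x y] by (simp add: X algebra_simps)
    have "P (X # Xs) z = P (X # ?ps Xs) (?p z)"
      using Cons.IH[OF V.multilinear_slot[OF P(1)] fl] by (simp only: slot_apply)
    also have "\<dots> = P ((?p x, y) # ?ps Xs) (?p z)"
    proof -
      have "P ((x - ?p x, y) # ?ps Xs) (?p z) \<in> U (-1)"
        by (rule V.filteredD[OF P(2), where cs="(0, 1) # replicate (length (?ps Xs)) (1, 1)" and c=1])
          (use U0 U1 ones[of "?ps Xs"] in \<open>simp_all add: sum_list_replicate\<close>)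
      then have "P ((x - ?p x, y) # ?ps Xs) (?p z) = 0" by (simp add: U_def)
      moreover have "P ((x - ?p x + ?p x, y) # ?ps Xs) (?p z)
        = P ((x - ?p x, y) # ?ps Xs) (?p z) + P ((?p x, y) # ?ps Xs) (?p z)"
        by (rule V.lin_add[OF V.multilinear_head(1)[OF P(1)]])
      ultimately show ?thesis by (simp add: X)
    qed
    also have "\<dots> = P ((?p x, ?p y) # ?ps Xs) (?p z)"
    proof -
      have "P ((?p x, y - ?p y) # ?ps Xs) (?p z) \<in> U (-1)"
        by (rule V.filteredD[OF P(2), where cs="(1, 0) # replicate (length (?ps Xs)) (1, 1)" and c=1])
          (use U0 U1 ones[of "?ps Xs"] in \<open>simp_all add: sum_list_replicate\<close>)
      then have "P ((?p x, y - ?p y) # ?ps Xs) (?p z) = 0" by (simp add: U_def)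
      moreover have "P ((?p x, y - ?p y + ?p y) # ?ps Xs) (?p z)
        = P ((?p x, y - ?p y) # ?ps Xs) (?p z) + P ((?p x, ?p y) # ?ps Xs) (?p z)"
        by (rule V.lin_add[OF V.multilinear_head(2)[OF P(1)]])
      ultimately show ?thesis by simp
    qed
    finally show ?case by (simp add: X)
  qed
  have "P Xs z \<in> U 0"
    by (rule V.filteredD[OF assms(2) ones U1]) (simp add: assms(3) sum_list_replicate)
  then have "snd (P Xs z) = 0" by (simp add: U_def)
  moreover have "P Xs z = P (?ps Xs) (?p z)"
    using assms by (intro proj) (auto simp: V.admissible_multilinear)
  moreover have "?ps Xs = map (map_prod (Pair 0) (Pair 0)) (map (map_prod snd snd) Xs)"
    by (simp add: map_prod_def case_prod_beta comp_def)
  ultimately show ?thesis by (simp add: prod_eq_iff)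
qed

text \<open>
  If the weights of \<open>2 n\<close> vectors add up to less than \<open>2 n\<close>, then one of them is at most 0, and this
  vector has no component in \<open>M\<close>.
\<close>

lemma list_all2_U_vanishing_slot:
  assumes "list_all2 (\<lambda>X C. fst X \<in> U (fst C) \<and> snd X \<in> U (snd C)) Xs cs"
    and "(\<Sum>C\<leftarrow>cs. fst C + snd C) < 2 * int (length Xs)"
  shows "\<exists>i<length Xs. snd (fst (Xs ! i)) = 0 \<or> snd (snd (Xs ! i)) = 0"
  using assms
proof (induction rule: list_all2_induct)
  case (Cons X Xs C cs)
  show ?case
  proof (cases "fst C \<le> 0 \<or> snd C \<le> 0")
    case True
    then have "snd (fst X) = 0 \<or> snd (snd X) = 0"
      using Cons.hyps(1) by (auto simp: U_def split: if_splits)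
    then show ?thesis by (intro exI[of _ 0]) simp
  next
    case False
    then have "(\<Sum>C\<leftarrow>cs. fst C + snd C) < 2 * int (length Xs)" using Cons.prems by simp
    from Cons.IH[OF this] obtain i where
      "i < length Xs" "snd (fst (Xs ! i)) = 0 \<or> snd (snd (Xs ! i)) = 0" by blast
    then show ?thesis by (intro exI[of _ "Suc i"]) simp
  qed
qed simp

lemma cochain_extend_in:
  assumes Q: "Q \<in> lts_cochains sM sL n"
  shows "V.admissible (cochain_extend Q)" "homogeneous (int n) (cochain_extend Q)"
    "V.filtered (- (2 * int n + 1)) (cochain_extend Q)"
proof -
  note lin = linear_iff_lincomb[OF M.vector_space_axioms L.vector_space_axioms]
  have 0: "Q Xs z = 0" if "length Xs \<noteq> n" for Xs z
    using Q that by (simp add: lts_cochains_def)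
  have last: "Q Xs (sM a u + sM b v) = sL a (Q Xs u) + sL b (Q Xs v)" for Xs a b u v
    using Q 0 by (cases "length Xs = n") (simp_all add: lts_cochains_def lin)
  have slots: "Q (Xs[i := (sM a u + sM b v, y)]) z = sL a (Q (Xs[i := (u, y)]) z) + sL b (Q (Xs[i := (v, y)]) z)"
    "Q (Xs[i := (y, sM a u + sM b v)]) z = sL a (Q (Xs[i := (y, u)]) z) + sL b (Q (Xs[i := (y, v)]) z)"
    "Q (Xs[i := (y, y)]) z = 0"
    if "i < length Xs" for Xs i a b u v y z
    using Q 0 that by (cases "length Xs = n"; simp add: lts_cochains_def lin)+
  have cyc: "Q (Xs @ [(x, y)]) z + Q (Xs @ [(y, z)]) x + Q (Xs @ [(z, x)]) y = 0" for Xs x y z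
    using Q 0 by (cases "Suc (length Xs) = n") (simp_all add: lts_cochains_def)
  show "V.admissible (cochain_extend Q)"
    unfolding V.admissible_def V.multilinear_def V.lin_def alternating_def cyclic_def cochain_extend_def
    using last slots cyc by (simp add: map_update sV_eq zero_prod_def)
  show "homogeneous (int n) (cochain_extend Q)"
    using 0 by (simp add: homogeneous_def cochain_extend_def zero_prod_def)
  have z0: "Q Xs 0 = 0" for Xs using last[of Xs 0 0 0 0] by simp
  have s0: "Q (Xs[i := (0, y)]) z = 0" "Q (Xs[i := (y, 0)]) z = 0" if "i < length Xs" for Xs i y z
    using slots(1)[OF that, of 0 0 0 0] slots(2)[OF that, of _ 0 0 0 0] by simp_all
  show "V.filtered (- (2 * int n + 1)) (cochain_extend Q)"
    unfolding V.filtered_def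
  proof (intro allI impI, elim conjE)
    fix Xs z cs c
    assume l: "list_all2 (\<lambda>X C. fst X \<in> U (fst C) \<and> snd X \<in> U (snd C)) Xs cs" and z: "z \<in> U c"
    let ?k = "- (2 * int n + 1) + (\<Sum>C\<leftarrow>cs. fst C + snd C) + c"
    show "cochain_extend Q Xs z \<in> U ?k"
    proof (cases "?k \<ge> 0 \<or> length Xs \<noteq> n")
      case True
      then show ?thesis using 0 by (auto simp: U_def cochain_extend_def zero_prod_def)
    next
      case False
      then have "c \<le> 0 \<or> (\<Sum>C\<leftarrow>cs. fst C + snd C) < 2 * int (length Xs)" by linarith
      then have "Q (map (map_prod snd snd) Xs) (snd z) = 0"
      proof
        assume "c \<le> 0"
        then have "snd z = 0" using z by (auto simp: U_def split: if_splits)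
        then show ?thesis by (simp add: z0)
      next
        assume "(\<Sum>C\<leftarrow>cs. fst C + snd C) < 2 * int (length Xs)"
        from list_all2_U_vanishing_slot[OF l this] obtain i where
          i: "i < length Xs" "snd (fst (Xs ! i)) = 0 \<or> snd (snd (Xs ! i)) = 0" by blast
        let ?Ys = "map (map_prod snd snd) Xs"
        have "?Ys ! i = (snd (fst (Xs ! i)), snd (snd (Xs ! i)))"
          using i(1) by (simp add: map_prod_def case_prod_beta)
        then have "?Ys = ?Ys[i := (snd (fst (Xs ! i)), snd (snd (Xs ! i)))]"
          by (metis list_update_id)
        then show ?thesis using s0[of i ?Ys] i by (metis length_map)
      qed
      then show ?thesis by (simp add: V.subspace_0[OF V.subspace_U] cochain_extend_def flip: zero_prod_def)
    qed
  qed
qed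

lemma in_cochain_extend:
  assumes P: "V.admissible P" "homogeneous (int n) P" "V.filtered (- (2 * int n + 1)) P"
  shows "P \<in> cochain_extend ` lts_cochains sM sL n"
proof
  define Q where "Q Xs z = fst (P (map (map_prod (Pair 0) (Pair 0)) Xs) (0, z))" for Xs z
  show "P = cochain_extend Q"
  proof (intro ext)
    fix Xs z
    show "P Xs z = cochain_extend Q Xs z"
    proof (cases "length Xs = n")
      case True
      show ?thesis unfolding cochain_extend_def Q_def by (rule cochains_eq_extend_fst[OF P(1,3) True])
    next
      case False
      then have "int (length Xs) \<noteq> int n" by simp
      then show ?thesis using P(2) False
        by (simp add: homogeneousD cochain_extend_def Q_def flip: zero_prod_def)
    qed
  qed
  note lin = linear_iff_lincomb[OF M.vector_space_axioms L.vector_space_axioms]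
  have emb: "(0, sM a u + sM b v) = sV a (0, u) + sV b (0, v)" for a b u v
    by (simp add: sV_eq)
  have m: "V.multilinear P" by (rule V.admissible_multilinear[OF P(1)])
  have "Q Xs (sM a u + sM b v) = sL a (Q Xs u) + sL b (Q Xs v)" for Xs a b u v
    unfolding Q_def emb V.linD[OF V.multilinear_last[OF m]] by (simp add: sV_eq)
  moreover have "Q (Xs[i := (sM a u + sM b v, y)]) z = sL a (Q (Xs[i := (u, y)]) z) + sL b (Q (Xs[i := (v, y)]) z)"
    "Q (Xs[i := (y, sM a u + sM b v)]) z = sL a (Q (Xs[i := (y, u)]) z) + sL b (Q (Xs[i := (y, v)]) z)"
    if "i < length Xs" for Xs i a b u v y z
  proof -
    have i: "i < length (map (map_prod (Pair 0) (Pair 0)) Xs)" using that by simp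
    show "Q (Xs[i := (sM a u + sM b v, y)]) z = sL a (Q (Xs[i := (u, y)]) z) + sL b (Q (Xs[i := (v, y)]) z)"
      "Q (Xs[i := (y, sM a u + sM b v)]) z = sL a (Q (Xs[i := (y, u)]) z) + sL b (Q (Xs[i := (y, v)]) z)"
      unfolding Q_def map_update map_prod_simp emb
        V.linD[OF V.multilinear_update(1)[OF m i]] V.linD[OF V.multilinear_update(2)[OF m i]]
      by (simp_all add: sV_eq)
  qed
  moreover have "Q (Xs[i := (y, y)]) z = 0" if "i < length Xs" for Xs i y z
    using P(1) that unfolding Q_def map_update map_prod_simp V.admissible_def alternating_def by simp
  moreover have "Q (Xs @ [(x, y)]) z + Q (Xs @ [(y, z)]) x + Q (Xs @ [(z, x)]) y = 0" for Xs x y z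
  proof -
    have "cyclic P" using P(1) by (simp add: V.admissible_def)
    from cyclicD[OF this, of "map (map_prod (Pair 0) (Pair 0)) Xs" "(0, x)" "(0, y)" "(0, z)"]
    show ?thesis by (simp add: Q_def flip: fst_add)
  qed
  moreover have "Q Xs z = 0" if "length Xs \<noteq> n" for Xs z
    using homogeneousD[OF P(2)] that by (simp add: Q_def)
  ultimately show "Q \<in> lts_cochains sM sL n"
    by (simp add: lts_cochains_def lin)
qed

text \<open>
  This description of \<open>C\<^sup>*(M, L)\<close> turns all membership questions into additions of degrees and weights.
\<close>

theorem cochains_ML_eq:
  "cochains_ML sL sM d =
    {P. V.admissible P \<and> homogeneous d P \<and> V.filtered (- (2 * d + 1)) P}"
proof (cases "d \<ge> 0")
  case True
  then show ?thesis
    using cochain_extend_in[of _ "nat d"] in_cochain_extend[of _ "nat d"]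
    unfolding cochains_ML_def by auto
next
  case False
  have "{P. V.admissible P \<and> homogeneous d P \<and> V.filtered (- (2 * d + 1)) P} = {\<lambda>Xs z. 0}"
  proof -
    have "homogeneous d (\<lambda>Xs z. 0 :: 'l \<times> 'm)" by (simp add: homogeneous_def)
    then show ?thesis using False V.admissible_0 V.filtered_0 by (auto dest: V.homogeneous_negative)
  qed
  moreover have "cochains_ML sL sM d = {0}" using False by (simp add: cochains_ML_def)
  moreover have "(0 :: ('l \<times> 'm, 'l \<times> 'm) cochain) = (\<lambda>Xs z. 0)" by (simp add: fun_eq_iff)
  ultimately show ?thesis by simp
qed

text \<open>
  A cochain of degree \<open>n\<close> has \<open>2 n + 1\<close> arguments of weight at most 1 each.
\<close>

lemma filtered_less_eq_0:
  assumes "V.admissible P" "homogeneous n P" "V.filtered w P" "w < - (2 * n + 1)"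
  shows "P = 0"
proof -
  have "P Xs z = 0" for Xs z
  proof (cases "int (length Xs) = n")
    case True
    have "P Xs z \<in> U (w + 2 * int (length Xs) + 1)"
      by (rule V.filteredD[OF assms(3), where cs="replicate (length Xs) (1, 1)" and c=1])
        (simp_all add: list_all2_conv_all_nth U_def sum_list_replicate)
    then show ?thesis using assms(4) True by (simp add: U_def split: if_splits)
  next
    case False
    then show ?thesis by (rule homogeneousD[OF assms(2)])
  qed
  then show ?thesis by (simp add: fun_eq_iff)
qed

lemma filtered_cochain1:
  assumes "\<And>y z. f 0 y z = 0" "\<And>x z. f x 0 z = 0" "\<And>x y. f x y 0 = 0"
    and "\<And>x y z a b c. \<lbrakk>x \<in> U a; y \<in> U b; z \<in> U c; a \<ge> 0; b \<ge> 0; c \<ge> 0\<rbrakk> \<Longrightarrow> f x y z \<in> U (w + a + b + c)"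
  shows "V.filtered w (cochain1 f)"
  unfolding V.filtered_def
proof (intro allI impI, elim conjE)
  fix Xs z cs c
  assume l: "list_all2 (\<lambda>X C. fst X \<in> U (fst C) \<and> snd X \<in> U (snd C)) Xs cs" and z: "z \<in> U c"
  note zero = V.subspace_0[OF V.subspace_U]
  show "cochain1 f Xs z \<in> U (w + (\<Sum>C\<leftarrow>cs. fst C + snd C) + c)"
  proof (cases "length Xs = 1")
    case True
    then obtain x y where Xs: "Xs = [(x, y)]" by (cases Xs) auto
    with l obtain a b where cs: "cs = [(a, b)]" by (auto simp: list_all2_Cons1)
    have xy: "x \<in> U a" "y \<in> U b" using l by (simp_all add: Xs cs)
    show ?thesis
    proof (cases "a \<ge> 0 \<and> b \<ge> 0 \<and> c \<ge> 0")
      case True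
      then show ?thesis using assms(4)[OF xy z] by (simp add: Xs cs add_ac)
    next
      case False
      then have "x = 0 \<or> y = 0 \<or> z = 0" using xy z by (auto simp: U_def split: if_splits)
      then have "f x y z = 0" using assms(1)[of y z] assms(2)[of x z] assms(3)[of x y] by auto
      then show ?thesis by (simp add: Xs zero)
    qed
  next
    case False
    then show ?thesis by (simp add: cochain1_eq_0 zero)
  qed
qed

lemma sum_cochain_apply: "finite I \<Longrightarrow> (\<Sum>i\<in>I. f i) Xs z = (\<Sum>i\<in>I. (f i :: ('l \<times> 'm, 'l \<times> 'm) cochain) Xs z)"
  by (induction I rule: finite_induct) auto

lemma cochains_ML_direct:
  assumes "finite I" "\<And>d. d \<in> I \<Longrightarrow> v d \<in> cochains_ML sL sM d" "(\<Sum>d\<in>I. v d) = 0" "d \<in> I"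
  shows "v d = 0"
proof -
  have hom: "homogeneous e (v e)" if "e \<in> I" for e using assms(2)[OF that] by (simp add: cochains_ML_eq)
  have "v d Xs z = 0" for Xs z
  proof (cases "int (length Xs) = d")
    case True
    then have "v e Xs z = 0" if "e \<in> I - {d}" for e
      using homogeneousD[OF hom[of e]] that by simp
    then have "(\<Sum>e\<in>I. v e Xs z) = (\<Sum>e\<in>{d}. v e Xs z)"
      using assms(1,4) by (intro sum.mono_neutral_right) auto
    then show ?thesis using assms(3) sum_cochain_apply[OF assms(1), of v Xs z] by simp
  next
    case False
    then show ?thesis by (rule homogeneousD[OF hom[OF assms(4)]])
  qed
  then show ?thesis by (simp add: fun_eq_iff)
qed

lemma subspace_cochains_ML: "module.subspace (cochain_scale sV) (cochains_ML sL sM d)"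
  unfolding cochains_ML_eq
  by (rule V.subspace_cochains)
    (auto simp: V.admissible_0 V.admissible_lincomb V.filtered_0 V.filtered_lincomb homogeneous_def V.lincomb_apply)

text \<open>
  The weights add up to \<open>- (2 (p + q) + 2)\<close>, one less than what a nonzero cochain of degree \<open>p + q\<close> allows.
\<close>

lemma lts_bracket_cochains_ML_eq_0:
  assumes "P \<in> cochains_ML sL sM p" "Q \<in> cochains_ML sL sM q"
  shows "lts_bracket sV P Q = 0"
proof -
  have P: "V.admissible P" "homogeneous p P" "V.filtered (- (2 * p + 1)) P"
    and Q: "V.admissible Q" "homogeneous q Q" "V.filtered (- (2 * q + 1)) Q"
    using assms by (simp_all add: cochains_ML_eq)
  note ml = V.admissible_multilinear[OF P(1)] V.admissible_multilinear[OF Q(1)]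
  show ?thesis
    unfolding V.lts_bracket_eq_bracket[OF ml P(2) Q(2)]
    by (rule filtered_less_eq_0[OF V.admissible_bracket[OF P(1) Q(1)] V.homogeneous_bracket[OF ml P(2) Q(2)]
        V.filtered_bracket[OF P(3) Q(3)]]) simp
qed

text \<open>
  A bracket with an element of degree \<open>d\<close> lowers the weight by \<open>2 d + 1\<close> while it raises the degree by \<open>d\<close>:
  relative to the least weight in each degree, it is one step down.
\<close>

lemma nested_lts_bracket_cochains_ML:
  assumes "V.admissible D" "homogeneous e D" "V.filtered w D" "\<forall>(P, d)\<in>set zs. P \<in> cochains_ML sL sM d"
  shows "V.admissible (foldl (lts_bracket sV) D (map fst zs))
    \<and> homogeneous (e + degree_sum zs) (foldl (lts_bracket sV) D (map fst zs))
    \<and> V.filtered (w - 2 * degree_sum zs - int (length zs)) (foldl (lts_bracket sV) D (map fst zs))"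
  using assms
proof (induction zs arbitrary: D e w)
  case (Cons z zs)
  obtain P d where z: "z = (P, d)" by (cases z)
  have P: "V.admissible P" "homogeneous d P" "V.filtered (- (2 * d + 1)) P"
    using Cons.prems(4) by (simp_all add: z cochains_ML_eq)
  note D = Cons.prems(1-3)
  note ml = V.admissible_multilinear[OF D(1)] V.admissible_multilinear[OF P(1)]
  have "V.admissible (lts_bracket sV D P)" "homogeneous (e + d) (lts_bracket sV D P)"
    "V.filtered (w - 2 * d - 1) (lts_bracket sV D P)"
    unfolding V.lts_bracket_eq_bracket[OF ml D(2) P(2)]
    using V.admissible_bracket[OF D(1) P(1)] V.homogeneous_bracket[OF ml D(2) P(2)]
      V.filtered_bracket[OF D(3) P(3), of e d] by (simp_all add: algebra_simps)
  from Cons.IH[OF this] show ?case using Cons.prems(4) by (simp add: z algebra_simps)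
qed simp

end

section \<open>The twisted semidirect product\<close>

locale twisted_pair = lts_3cocycle sL br sM \<theta> H
  for sL :: "'k::field_char_0 \<Rightarrow> 'l::ab_group_add \<Rightarrow> 'l"
    and br :: "'l \<Rightarrow> 'l \<Rightarrow> 'l \<Rightarrow> 'l"
    and sM :: "'k \<Rightarrow> 'm::ab_group_add \<Rightarrow> 'm"
    and \<theta> :: "'l \<Rightarrow> 'l \<Rightarrow> 'm \<Rightarrow> 'm"
    and H :: "'l \<Rightarrow> 'l \<Rightarrow> 'l \<Rightarrow> 'm"
begin

sublocale two_spaces sL sM
  by unfold_locales

definition semidirect :: "'l \<times> 'm \<Rightarrow> 'l \<times> 'm \<Rightarrow> 'l \<times> 'm \<Rightarrow> 'l \<times> 'm"
  where "semidirect X Y Z = (br (fst X) (fst Y) (fst Z),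
    \<theta> (fst Y) (fst Z) (snd X) - \<theta> (fst X) (fst Z) (snd Y) + rep_D \<theta> (fst X) (fst Y) (snd Z))"

definition cocycle :: "'l \<times> 'm \<Rightarrow> 'l \<times> 'm \<Rightarrow> 'l \<times> 'm \<Rightarrow> 'l \<times> 'm"
  where "cocycle X Y Z = (0, H (fst X) (fst Y) (fst Z))"

lemma semidirect_cochain_eq: "semidirect_cochain br \<theta> = cochain1 semidirect"
  unfolding semidirect_cochain_def by (rule arg_cong[where f = cochain1]) (auto simp: fun_eq_iff semidirect_def)

lemma cocycle_cochain_eq: "cocycle_cochain H = cochain1 cocycle"
  unfolding cocycle_cochain_def by (rule arg_cong[where f = cochain1]) (auto simp: fun_eq_iff cocycle_def)

lemmas br_simps =
  L.br_linear(1)[THEN linear_addD] L.br_linear(2)[THEN linear_addD] L.br_linear(3)[THEN linear_addD]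
  L.br_linear(1)[THEN linear_scaleD] L.br_linear(2)[THEN linear_scaleD] L.br_linear(3)[THEN linear_scaleD]
  L.br_linear(1)[THEN linear_zeroD] L.br_linear(2)[THEN linear_zeroD] L.br_linear(3)[THEN linear_zeroD]

lemmas H_simps =
  H_linear(1)[THEN linear_addD] H_linear(2)[THEN linear_addD] H_linear(3)[THEN linear_addD]
  H_linear(1)[THEN linear_scaleD] H_linear(2)[THEN linear_scaleD] H_linear(3)[THEN linear_scaleD]
  H_linear(1)[THEN linear_zeroD] H_linear(2)[THEN linear_zeroD] H_linear(3)[THEN linear_zeroD]

lemmas \<theta>_simps =
  rep_linear(1)[THEN linear_addD] rep_linear(2)[THEN linear_addD] rep_linear(3)[THEN linear_addD]
  rep_linear(1)[THEN linear_scaleD] rep_linear(2)[THEN linear_scaleD] rep_linear(3)[THEN linear_scaleD]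
  rep_linear(1)[THEN linear_zeroD] rep_linear(2)[THEN linear_zeroD] rep_linear(3)[THEN linear_zeroD]
  rep_linear(3)[THEN linear_diffD]

lemma admissible_semidirect: "V.admissible (cochain1 semidirect)"
proof (rule V.admissible_cochain1)
  show "V.lin (\<lambda>X. semidirect X Y Z)" "V.lin (\<lambda>Y. semidirect X Y Z)" "V.lin (semidirect X Y)" for X Y Z
    unfolding V.lin_def semidirect_def sV_eq rep_D_def
    by (simp_all add: br_simps \<theta>_simps M.scale_right_distrib M.scale_right_diff_distrib algebra_simps)
  show "semidirect X X Z = 0" for X Z
    by (simp add: semidirect_def rep_D_def L.br_alt zero_prod_def)
  show "semidirect X Y Z + semidirect Y Z X + semidirect Z X Y = 0" for X Y Z
    by (simp add: semidirect_def rep_D_def L.br_cyclic zero_prod_def)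
qed

lemma admissible_cocycle: "V.admissible (cochain1 cocycle)"
proof (rule V.admissible_cochain1)
  show "V.lin (\<lambda>X. cocycle X Y Z)" "V.lin (\<lambda>Y. cocycle X Y Z)" "V.lin (cocycle X Y)" for X Y Z
    unfolding V.lin_def cocycle_def sV_eq by (simp_all add: H_simps)
  show "cocycle X X Z = 0" for X Z
    by (simp add: cocycle_def H_alt zero_prod_def)
  show "cocycle X Y Z + cocycle Y Z X + cocycle Z X Y = 0" for X Y Z
    by (simp add: cocycle_def H_cyclic zero_prod_def)
qed

lemma filtered_semidirect: "V.filtered 0 (cochain1 semidirect)"
proof (rule filtered_cochain1)
  show "semidirect 0 Y Z = 0" "semidirect X 0 Z = 0" "semidirect X Y 0 = 0" for X Y Z
    by (simp_all add: semidirect_def rep_D_def br_simps \<theta>_simps zero_prod_def)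
  fix X Y Z a b c assume "X \<in> U a" "Y \<in> U b" "Z \<in> U c" "a \<ge> 0" "b \<ge> 0" "c \<ge> (0 :: int)"
  then show "semidirect X Y Z \<in> U (0 + a + b + c)"
    by (cases "a + b + c = 0") (auto simp: U_def semidirect_def rep_D_def \<theta>_simps)
qed

lemma filtered_cocycle: "V.filtered 1 (cochain1 cocycle)"
proof (rule filtered_cochain1)
  show "cocycle 0 Y Z = 0" "cocycle X 0 Z = 0" "cocycle X Y 0 = 0" for X Y Z
    by (simp_all add: cocycle_def H_simps zero_prod_def)
qed (auto simp: U_def)

text \<open>
  The component in \<open>L\<close> is the fundamental identity of \<open>L\<close>. The component in \<open>M\<close> is linear in the five
  \<open>M\<close>-components of the arguments. Their coefficients vanish by the first axiom of a
  representation for the arguments \<open>X1\<close> and \<open>X2\<close>, by the second one for \<open>Y1\<close> and \<open>Y2\<close>, and by two instances of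
  the second one for \<open>Z\<close>.
\<close>

lemma semidirect_fundamental:
  "semidirect X1 X2 (semidirect Y1 Y2 Z) = semidirect (semidirect X1 X2 Y1) Y2 Z
    + semidirect Y1 (semidirect X1 X2 Y2) Z + semidirect Y1 Y2 (semidirect X1 X2 Z)"
proof -
  obtain x1 u1 x2 u2 y1 v1 y2 v2 z w where
    X: "X1 = (x1, u1)" "X2 = (x2, u2)" "Y1 = (y1, v1)" "Y2 = (y2, v2)" "Z = (z, w)"
    by (cases X1, cases X2, cases Y1, cases Y2, cases Z)
  have 1: "\<theta> x (br y1 y2 z) u = \<theta> y2 z (\<theta> x y1 u) - \<theta> y1 z (\<theta> x y2 u) + \<theta> y2 y1 (\<theta> x z u) - \<theta> y1 y2 (\<theta> x z u)" for x u
    using rep_1[of y2 z x y1 u] by (simp add: rep_D_def algebra_simps)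
  have 2: "\<theta> x2 x1 (\<theta> y t v) = \<theta> x1 x2 (\<theta> y t v) + \<theta> y t (\<theta> x2 x1 v) - \<theta> y t (\<theta> x1 x2 v)
    + \<theta> (br x1 x2 y) t v + \<theta> y (br x1 x2 t) v" for y t v
    using rep_2[of y t x1 x2 v] by (simp add: rep_D_def \<theta>_simps algebra_simps)
  show ?thesis
    unfolding X semidirect_def rep_D_def
    by (simp add: L.br_fundamental[of x1 x2 y1 y2 z] \<theta>_simps 1 2 algebra_simps)
qed

lemma bracket_semidirect_semidirect: "lts_bracket sV (cochain1 semidirect) (cochain1 semidirect) = 0"
proof (rule V.lts_bracket_cochain1_eq_0[OF admissible_semidirect admissible_semidirect])
  show "(semidirect (semidirect X1 X2 Y1) Y2 Z + semidirect Y1 (semidirect X1 X2 Y2) Z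
      - semidirect X1 X2 (semidirect Y1 Y2 Z) + semidirect Y1 Y2 (semidirect X1 X2 Z))
    + (semidirect (semidirect X1 X2 Y1) Y2 Z + semidirect Y1 (semidirect X1 X2 Y2) Z
      - semidirect X1 X2 (semidirect Y1 Y2 Z) + semidirect Y1 Y2 (semidirect X1 X2 Z)) = 0" for X1 X2 Y1 Y2 Z
    unfolding semidirect_fundamental[of X1 X2] by simp
qed

lemma semidirect_cocycle:
  "(semidirect (cocycle X1 X2 Y1) Y2 Z + semidirect Y1 (cocycle X1 X2 Y2) Z
      - semidirect X1 X2 (cocycle Y1 Y2 Z) + semidirect Y1 Y2 (cocycle X1 X2 Z))
    + (cocycle (semidirect X1 X2 Y1) Y2 Z + cocycle Y1 (semidirect X1 X2 Y2) Z
      - cocycle X1 X2 (semidirect Y1 Y2 Z) + cocycle Y1 Y2 (semidirect X1 X2 Z)) = 0"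
  using H_cocycle[of "fst X1" "fst X2" "fst Y1" "fst Y2" "fst Z"]
  by (simp add: semidirect_def cocycle_def rep_D_def br_simps \<theta>_simps zero_prod_def algebra_simps)

lemma bracket_semidirect_cocycle: "lts_bracket sV (cochain1 semidirect) (cochain1 cocycle) = 0"
  by (rule V.lts_bracket_cochain1_eq_0[OF admissible_semidirect admissible_cocycle semidirect_cocycle])

lemma bracket_cocycle_semidirect: "lts_bracket sV (cochain1 cocycle) (cochain1 semidirect) = 0"
  using semidirect_cocycle
  by (intro V.lts_bracket_cochain1_eq_0[OF admissible_cocycle admissible_semidirect]) (simp add: add.commute)

lemma bracket_cocycle_cocycle: "lts_bracket sV (cochain1 cocycle) (cochain1 cocycle) = 0"
  by (rule V.lts_bracket_cochain1_eq_0[OF admissible_cocycle admissible_cocycle])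
    (simp add: cocycle_def H_simps zero_prod_def)

text \<open>
  The index is the arity of the derived bracket that the cochain defines.
\<close>

definition twisted :: "nat \<Rightarrow> ('l \<times> 'm, 'l \<times> 'm) cochain"
  where "twisted k = (if k = 3 then cochain1 semidirect else if k = 4 then cochain1 cocycle else 0)"

lemma bracket_twisted: "lts_bracket sV (twisted i) (twisted j) = 0"
proof -
  interpret graded_lie_algebra "cochain_scale sV" "{P. V.admissible P}"
    "\<lambda>d. {P. V.admissible P \<and> homogeneous d P}" "lts_bracket sV"
    by (rule V.graded_lie_algebra_cochains)
  have T: "cochain1 semidirect \<in> {P. V.admissible P}" "cochain1 cocycle \<in> {P. V.admissible P}"
    "0 \<in> {P. V.admissible P}"
    using admissible_semidirect admissible_cocycle subspace_0[OF subspace_T] by auto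
  show ?thesis
    by (simp add: twisted_def bracket_semidirect_semidirect bracket_semidirect_cocycle
        bracket_cocycle_semidirect bracket_cocycle_cocycle B_0_left B_0_right T[simplified] T)
qed

text \<open>
  The weight of \<open>\<pi> + \<theta>\<close> exceeds the least weight \<open>-3\<close> in degree 1 by three, that of the cocycle by four.
  These are the numbers of brackets after which \<open>C\<^sup>*(M, L)\<close> is reached.
\<close>

lemma derived_brackets_twisted:
  "derived_brackets (cochain_scale sV) {P. V.admissible P}
    (\<lambda>d. {P. V.admissible P \<and> homogeneous d P}) (lts_bracket sV) (cochains_ML sL sM) twisted"
proof -
  interpret graded_lie_algebra "cochain_scale sV" "{P. V.admissible P}"
    "\<lambda>d. {P. V.admissible P \<and> homogeneous d P}" "lts_bracket sV"
    by (rule V.graded_lie_algebra_cochains)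
  have F: "cochains_ML sL sM d \<subseteq> {P. V.admissible P \<and> homogeneous d P}" for d
    by (auto simp: cochains_ML_eq)
  show ?thesis
  proof unfold_locales
    show "subspace (cochains_ML sL sM d)" for d by (rule subspace_cochains_ML)
    show "cochains_ML sL sM d \<subseteq> {P. V.admissible P \<and> homogeneous d P}" for d by (rule F)
    show "v d = 0" if "finite I" "\<And>d. d \<in> I \<Longrightarrow> v d \<in> cochains_ML sL sM d" "(\<Sum>d\<in>I. v d) = 0" "d \<in> I"
      for I :: "int set" and v d
      using that by (rule cochains_ML_direct)
    show "lts_bracket sV P Q = 0" if "P \<in> cochains_ML sL sM p" "Q \<in> cochains_ML sL sM q" for P Q p q
      using that by (rule lts_bracket_cochains_ML_eq_0)
    show "twisted k \<in> {P. V.admissible P \<and> homogeneous 1 P}" for k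
      using subspace_0[OF subspace_G[of 1]]
      by (simp add: twisted_def admissible_semidirect admissible_cocycle homogeneous_cochain1)
    show "(\<Sum>i=1..n. lts_bracket sV (twisted (n + 1 - i)) (twisted i)) = 0" for n
      by (simp add: bracket_twisted)
    show "foldl (lts_bracket sV) (twisted k) (map fst zs) \<in> cochains_ML sL sM (1 + degree_sum zs)"
      if "length zs = k" "\<forall>(P, d)\<in>set zs. P \<in> cochains_ML sL sM d" for k zs
    proof -
      have "twisted k = 0" if "k \<noteq> 3" "k \<noteq> 4" using that by (simp add: twisted_def)
      then consider "k = 3" | "k = 4" | "twisted k = 0" by blast
      then show ?thesis
      proof cases
        case 1
        then have w: "0 - 2 * degree_sum zs - int (length zs) = - (2 * (1 + degree_sum zs) + 1)"
          using that(1) by simp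
        have "twisted k = cochain1 semidirect" using 1 by (simp add: twisted_def)
        then show ?thesis
          using nested_lts_bracket_cochains_ML[OF admissible_semidirect homogeneous_cochain1
              filtered_semidirect that(2), unfolded w]
          by (simp only: cochains_ML_eq mem_Collect_eq)
      next
        case 2
        then have w: "1 - 2 * degree_sum zs - int (length zs) = - (2 * (1 + degree_sum zs) + 1)"
          using that(1) by simp
        have "twisted k = cochain1 cocycle" using 2 by (simp add: twisted_def)
        then show ?thesis
          using nested_lts_bracket_cochains_ML[OF admissible_cocycle homogeneous_cochain1
              filtered_cocycle that(2), unfolded w]
          by (simp only: cochains_ML_eq mem_Collect_eq)
      next
        case 3
        have "set (map fst zs) \<subseteq> {P. V.admissible P}" using that(2) F by fastforce
        then show ?thesis using 3 nested_0 subspace_0[OF subspace_cochains_ML] by simp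
      qed
    qed
  qed
qed

theorem L_infinity_cochains_ML:
  "L_infinity_algebra (cochain_scale sV) (cochains_ML sL sM) (cochain_ops sL sM br \<theta> H)"
proof -
  interpret derived_brackets "cochain_scale sV" "{P. V.admissible P}"
    "\<lambda>d. {P. V.admissible P \<and> homogeneous d P}" "lts_bracket sV" "cochains_ML sL sM" twisted
    by (rule derived_brackets_twisted)
  show ?thesis
  proof (rule L_infinity_algebra)
    fix k and Ps :: "('l \<times> 'm, 'l \<times> 'm) cochain list"
    assume Ps: "length Ps = k" "set Ps \<subseteq> {P. V.admissible P}"
    consider "k = 3" | "k = 4" | "k \<noteq> 3" "k \<noteq> 4" by auto
    then show "cochain_ops sL sM br \<theta> H k Ps = foldl (lts_bracket sV) (twisted k) Ps"
    proof cases
      case 1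
      then obtain P Q R where "Ps = [P, Q, R]" using Ps(1) by (auto simp: numeral_3_eq_3 length_Suc_conv)
      then show ?thesis using 1 by (simp add: cochain_ops_def twisted_def semidirect_cochain_eq Let_def)
    next
      case 2
      then obtain P Q R S where "Ps = [P, Q, R, S]"
        using Ps(1) by (auto simp: eval_nat_numeral length_Suc_conv)
      then show ?thesis using 2 by (simp add: cochain_ops_def twisted_def cocycle_cochain_eq Let_def numeral_2_eq_2 numeral_3_eq_3)
    next
      case 3
      then show ?thesis using nested_0[OF Ps(2)] by (simp add: cochain_ops_def twisted_def)
    qed
  qed
qed

end

theorem proposition4p4:
  fixes sL :: "'k::field_char_0 \<Rightarrow> 'l::ab_group_add \<Rightarrow> 'l"
    and br :: "'l \<Rightarrow> 'l \<Rightarrow> 'l \<Rightarrow> 'l"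
    and sM :: "'k \<Rightarrow> 'm::ab_group_add \<Rightarrow> 'm"
    and \<theta> :: "'l \<Rightarrow> 'l \<Rightarrow> 'm \<Rightarrow> 'm"
    and H :: "'l \<Rightarrow> 'l \<Rightarrow> 'l \<Rightarrow> 'm"
  assumes "lie_triple_system sL br"
    and "lts_representation sL br sM \<theta>"
    and "lts_3cocycle sL br sM \<theta> H"
  shows "L_infinity_algebra (cochain_scale (module_prod.scale sL sM))
    (cochains_ML sL sM) (cochain_ops sL sM br \<theta> H)"
proof -
  interpret twisted_pair sL br sM \<theta> H
    using assms(3) by (rule twisted_pair.intro)
  show ?thesis by (rule L_infinity_cochains_ML)
qed

end
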